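(* Let $\gamma^*=\sup\{\gamma\in[0,1]:\ h_\gamma(b_1,b_2,b_{12})\ge 0\text{ for every feasible configuration }(b_1,b_2,b_{12})\}$. Then $\gamma^*\in[0.9539798,\,0.95398]$. Furthermore, the minimum of $h_{\gamma^*}$ over all feasible configurations is attained at a point of the form $(b,b,-1-2b)$ with $b\in[b_0-\varepsilon,b_0+\varepsilon]$, where $b_0=-0.1824167935$ and $\varepsilon=10^{-6}$.
   Context: $\Phi$ denotes the standard normal CDF, with $\Phi^{-1}(0)=-\infty$, $\Phi^{-1}(1)=+\infty$. For $\rho\in[-1,1]$, $\Phi_\rho(x,y)=\Pr[X\le x,\,Y\le y]$ for jointly Gaussian standard normals $X,Y$ with correlation $\rho$. A configuration is a triple $(b_1,b_2,b_{12})\in[-1,1]^3$; $\rho(b_1,b_2,b_{12})=\frac{b_{12}-b_1b_2}{\sqrt{(1-b_1^2)(1-b_2^2)}}$ if the denominator is nonzero and $0$ otherwise. It is feasible if there are unit vectors $\mathbf v_0,\mathbf v_1,\mathbf v_2$ with $\mathbf v_0\cdot\mathbf v_1=b_1$, $\mathbf v_0\cdot\mathbf v_2=b_2$, $\mathbf v_1\cdot\mathbf v_2=b_{12}$, and $-1+|b_1+b_2|\le b_{12}\le 1-|b_1-b_2|$. $\mathsf{Value}(b_1,b_2,b_{12})=\frac{3-b_1-b_2-b_{12}}{4}$. For $\gamma\in[0,1]$, $h_\gamma(b_1,b_2,b_{12})=1-\Phi_\rho\big(\Phi^{-1}(\tfrac{\gamma(1+b_1)}{2}),\Phi^{-1}(\tfrac{\gamma(1+b_2)}{2})\big)-\gamma\,\mathsf{Value}(b_1,b_2,b_{12})$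 with $\rho=\rho(b_1,b_2,b_{12})$. *)

theory Defs
  imports "HOL-Probability.Probability"
begin

definition std_normal :: "real measure" where
  "std_normal = density lborel std_normal_density"

definition Phi :: "real \<Rightarrow> real" where
  "Phi x = measure std_normal {..x}"

text \<open>Inverse CDF with the conventions Phi_inv 0 = -infinity, Phi_inv 1 = +infinity
  (extended reals).  Only arguments in [0,1] are used.\<close>
definition Phi_inv :: "real \<Rightarrow> ereal" where
  "Phi_inv p = (if p \<le> 0 then -\<infinity> else if p \<ge> 1 then \<infinity>
                else ereal (THE x. Phi x = p))"

text \<open>Bivariate normal CDF: X = Z1, Y = rho Z1 + sqrt(1 - rho^2) Z2 with Z1, Z2 independent
  standard normals; (X,Y) are jointly Gaussian standard normals with correlation rho
  (valid for all rho in [-1,1], including the degenerate cases).\<close>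
definition Phi2 :: "real \<Rightarrow> ereal \<Rightarrow> ereal \<Rightarrow> real" where
  "Phi2 \<rho> x y = measure (std_normal \<Otimes>\<^sub>M std_normal)
     {(z1, z2). ereal z1 \<le> x \<and> ereal (\<rho> * z1 + sqrt (1 - \<rho>\<^sup>2) * z2) \<le> y}"

definition rho :: "real \<Rightarrow> real \<Rightarrow> real \<Rightarrow> real" where
  "rho b1 b2 b12 = (if sqrt ((1 - b1\<^sup>2) * (1 - b2\<^sup>2)) \<noteq> 0
      then (b12 - b1 * b2) / sqrt ((1 - b1\<^sup>2) * (1 - b2\<^sup>2)) else 0)"

definition feasible :: "real \<Rightarrow> real \<Rightarrow> real \<Rightarrow> bool" where
  "feasible b1 b2 b12 \<longleftrightarrow>
     b1 \<in> {-1..1} \<and> b2 \<in> {-1..1} \<and> b12 \<in> {-1..1} \<and>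
     (\<exists>v0 v1 v2 :: real^3. norm v0 = 1 \<and> norm v1 = 1 \<and> norm v2 = 1 \<and>
        v0 \<bullet> v1 = b1 \<and> v0 \<bullet> v2 = b2 \<and> v1 \<bullet> v2 = b12) \<and>
     -1 + \<bar>b1 + b2\<bar> \<le> b12 \<and> b12 \<le> 1 - \<bar>b1 - b2\<bar>"

definition Value :: "real \<Rightarrow> real \<Rightarrow> real \<Rightarrow> real" where
  "Value b1 b2 b12 = (3 - b1 - b2 - b12) / 4"

definition h :: "real \<Rightarrow> real \<Rightarrow> real \<Rightarrow> real \<Rightarrow> real" where
  "h \<gamma> b1 b2 b12 = 1 - Phi2 (rho b1 b2 b12)
       (Phi_inv (\<gamma> * (1 + b1) / 2)) (Phi_inv (\<gamma> * (1 + b2) / 2))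
     - \<gamma> * Value b1 b2 b12"

definition gamma_star :: real where
  "gamma_star = Sup {\<gamma> \<in> {0..1}. \<forall>b1 b2 b12. feasible b1 b2 b12 \<longrightarrow> h \<gamma> b1 b2 b12 \<ge> 0}"

end

theory Submission
  imports Defs
begin

text \<open>
  By Plackett's identity the bivariate distribution function at correlation \<open>- sin \<Theta>\<close> differs
  from the independent one by an integral over \<open>\<theta> \<in> {0..\<Theta>}\<close> of \<open>exp (- a\<^sup>2 / (1 - sin \<theta>) - e\<^sup>2 / (1 + sin \<theta>))\<close>,
  where \<open>a\<close> and \<open>e\<close> are the half sum and the half difference of the two thresholds. For nonnegative
  correlation \<open>h\<close> is at least \<open>1 - \<gamma>\<close>. For negative correlation, replacing both thresholds by \<open>a\<close> at fixed
  \<open>b1 b2 - b12\<close> (up to a factor \<open>exp (- 0.57 e\<^sup>2)\<close>) costs nothing that the log-concavity of \<open>\<Phi>\<close>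
  does not pay for, so only \<open>b1 = b2 = b\<close> matters. There tangent bounds for the exponential settle
  all \<open>b\<close> outside \<open>[- 0.45, - 0.1]\<close>, and inside \<open>h\<close> decreases towards the facet \<open>b12 = - 1 - 2 b\<close>. On the
  facet \<open>h\<close> is a convex function of \<open>b\<close> with an explicit derivative, whose sign is
  evaluated at \<open>b0 \<plusminus> 0.000001\<close> by Taylor polynomials; the bounds on \<open>gamma_star\<close> come from the value at \<open>b0\<close>
  for the two extreme \<open>\<gamma>\<close>.\<close>

section \<open>The standard normal distribution\<close>

text \<open>For the relevant \<gamma> the minimum of \<open>h\<close> is almost 0, so no reduction
  may lose a fixed amount near the minimiser: every loss has to vanish with the half difference
  \<open>e\<close> of the thresholds. The gain that pays for such losses is
  \<open>(1 - \<gamma>) * (1 - exp (- c * e\<^sup>2))\<close>, roughly 0.046 c e^2, while replacing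
  the kernel at \<open>e\<close> by the kernel at 0 costs about 0.022 e^2. The choice c = 0.57 is a
  compromise: the products of \<open>Phi\<close> must decay at this rate for thresholds up to 1.7,
  and the gain must exceed the cost. Square roots and arcsines disappear by writing the correlation
  as a sine and passing to the tangent of half the complementary angle: the exponent of the kernel
  becomes polynomial in its reciprocal, and the facet is the curve on which its square is
  \<open>- b\<close>. All estimates are uniform in \<gamma> over [0.9539798, 0.95398] and are
  applied to \<open>gamma_star\<close> once it is located there.\<close>

abbreviation \<phi> :: "real \<Rightarrow> real" where "\<phi> \<equiv> std_normal_density"

lemma std_normal_density_pos [simp]: "\<phi> x > 0"
  by (simp add: normal_density_pos)

lemma std_normal_density_minus [simp]: "\<phi> (- x) = \<phi> x"
  by (simp add: std_normal_density_def)

lemma std_normal_density_le: "\<phi> x \<le> 1 / sqrt (2 * pi)"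
  by (simp add: std_normal_density_def divide_simps)

lemma std_normal_density_abs_mono: "\<bar>x\<bar> \<le> \<bar>y\<bar> \<Longrightarrow> \<phi> y \<le> \<phi> x"
  by (simp add: std_normal_density_def divide_simps abs_le_square_iff)

lemma DERIV_std_normal_density: "(\<phi> has_real_derivative - x * \<phi> x) (at x within S)"
  unfolding std_normal_density_def
  by (rule derivative_eq_intros refl | simp)+

lemma continuous_on_std_normal_density [continuous_intros]:
  "continuous_on S f \<Longrightarrow> continuous_on S (\<lambda>x. \<phi> (f x))"
  unfolding std_normal_density_def by (intro continuous_intros) auto

lemma tendsto_std_normal_density_at_bot: "(\<phi> \<longlongrightarrow> 0) at_bot"
  unfolding std_normal_density_def by real_asymp

interpretation std_normal: prob_space std_normal
  unfolding std_normal_def by (rule prob_space_normal_density) simp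

lemma sets_std_normal [simp, measurable_cong]: "sets std_normal = sets borel"
  by (simp add: std_normal_def)

lemma space_std_normal [simp]: "space std_normal = UNIV"
  by (simp add: std_normal_def)

lemma integral_std_normal:
  fixes f :: "real \<Rightarrow> real"
  assumes [measurable]: "f \<in> borel_measurable borel"
  shows "(\<integral>x. f x \<partial>std_normal) = (\<integral>x. \<phi> x * f x \<partial>lborel)"
  unfolding std_normal_def by (subst integral_density) auto

lemma measure_std_normal:
  assumes [measurable]: "S \<in> sets borel"
  shows "measure std_normal S = (\<integral>x. \<phi> x * indicator S x \<partial>lborel)"
proof -
  have "measure std_normal S = (\<integral>x. indicator S x \<partial>std_normal)" by simp
  also have "\<dots> = (\<integral>x. \<phi> x * indicator S x \<partial>lborel)"
    by (rule integral_std_normal) simp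
  finally show ?thesis .
qed

lemma Phi_diff:
  assumes "a \<le> b"
  shows "Phi b - Phi a = integral {a..b} \<phi>"
proof -
  have "Phi b - Phi a = measure std_normal ({..b} - {..a})"
    unfolding Phi_def using assms by (subst std_normal.finite_measure_Diff) auto
  also have "{..b} - {..a} = {a<..b}" by auto
  also have "measure std_normal {a<..b} = (\<integral>x. \<phi> x * indicator {a<..b} x \<partial>lborel)"
    by (rule measure_std_normal) simp
  also have "\<dots> = (\<integral>x. indicator {a..b} x *\<^sub>R \<phi> x \<partial>lborel)"
    by (rule integral_cong_AE) (use AE_lborel_singleton[of a] in \<open>auto elim!: eventually_mono simp: indicator_def\<close>)
  also have "\<dots> = integral {a..b} \<phi>"
  proof -
    have "set_integrable lborel {a..b} \<phi>"
      unfolding set_integrable_def by (rule integrable_mult_indicator) auto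
    from set_borel_integral_eq_integral(2)[OF this] show ?thesis
      by (simp add: set_lebesgue_integral_def)
  qed
  finally show ?thesis .
qed

lemma DERIV_Phi: "(Phi has_real_derivative \<phi> x) (at x)"
proof -
  have "((\<lambda>u. integral {x - 1..u} \<phi>) has_vector_derivative \<phi> x) (at x within {x - 1..x + 1})"
    by (rule integral_has_vector_derivative) (auto intro!: continuous_intros)
  hence "((\<lambda>u. integral {x - 1..u} \<phi>) has_real_derivative \<phi> x) (at x within {x - 1..x + 1})"
    by (simp add: has_real_derivative_iff_has_vector_derivative)
  hence "((\<lambda>u. integral {x - 1..u} \<phi>) has_real_derivative \<phi> x) (at x)"
    by (subst (asm) at_within_Icc_at) auto
  hence "((\<lambda>u. Phi (x - 1) + integral {x - 1..u} \<phi>) has_real_derivative \<phi> x) (at x)"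
    by (auto intro!: derivative_eq_intros)
  thus ?thesis
  proof (rule DERIV_cong_ev[THEN iffD1, rotated -1])
    show "\<forall>\<^sub>F u in nhds x. Phi (x - 1) + integral {x - 1..u} \<phi> = Phi u"
      using eventually_nhds_in_open[of "{x-1<..}" x]
    proof (rule eventually_mono)
      fix u assume "u \<in> {x - 1<..}"
      thus "Phi (x - 1) + integral {x - 1..u} \<phi> = Phi u"
        using Phi_diff[of "x - 1" u] by simp
    qed auto
  qed auto
qed

lemmas DERIV_Phi_compose [derivative_intros] = DERIV_chain2[OF DERIV_Phi]
lemmas DERIV_std_normal_density_compose [derivative_intros] = DERIV_chain2[OF DERIV_std_normal_density]

lemma isCont_Phi: "isCont Phi x"
  using DERIV_Phi DERIV_isCont by blast

lemma continuous_on_Phi [continuous_intros]: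
  "continuous_on S f \<Longrightarrow> continuous_on S (\<lambda>x. Phi (f x))"
  using continuous_on_compose2[of UNIV Phi S f] isCont_Phi
  by (simp add: continuous_on_eq_continuous_at)

lemma borel_measurable_Phi [measurable]: "Phi \<in> borel_measurable borel"
  by (intro borel_measurable_continuous_onI continuous_intros)

lemma Phi_nonneg [simp]: "0 \<le> Phi x" and Phi_le_1 [simp]: "Phi x \<le> 1"
  by (auto simp: Phi_def)

lemma strict_mono_Phi: "strict_mono Phi"
  by (rule strict_monoI, rule DERIV_pos_imp_increasing) (use DERIV_Phi in \<open>auto intro!: exI[of _ "\<phi> _"]\<close>)

lemma Phi_less_iff [simp]: "Phi x < Phi y \<longleftrightarrow> x < y"
  using strict_mono_Phi by (rule strict_mono_less)

lemma Phi_le_iff [simp]: "Phi x \<le> Phi y \<longleftrightarrow> x \<le> y"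
  using strict_mono_Phi by (rule strict_mono_less_eq)

lemma Phi_eq_iff [simp]: "Phi x = Phi y \<longleftrightarrow> x = y"
  using strict_mono_Phi by (rule strict_mono_eq)

lemma Phi_pos [simp]: "Phi x > 0"
  using Phi_less_iff[of "x - 1" x] Phi_nonneg[of "x - 1"] by (simp del: Phi_less_iff Phi_nonneg)

lemma Phi_less_1 [simp]: "Phi x < 1"
  using Phi_less_iff[of x "x + 1"] Phi_le_1[of "x + 1"] by (simp del: Phi_less_iff Phi_le_1)

lemma Phi_at_bot: "(Phi \<longlongrightarrow> 0) at_bot"
proof -
  interpret real_distribution std_normal by standard auto
  have "Phi = cdf std_normal" by (auto simp: Phi_def cdf_def fun_eq_iff)
  thus ?thesis using cdf_lim_at_bot by simp
qed

lemma Phi_at_top: "(Phi \<longlongrightarrow> 1) at_top"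
proof -
  interpret real_distribution std_normal by standard auto
  have "Phi = cdf std_normal" by (auto simp: Phi_def cdf_def fun_eq_iff)
  thus ?thesis using cdf_lim_at_top_prob by simp
qed

text \<open>Evenness of the density makes the sum \<open>Phi (- x) + Phi x\<close> constant; its
  limit at infinity is 1.\<close>

lemma Phi_minus: "Phi (- x) = 1 - Phi x"
proof -
  have const: "Phi (- x) + Phi x = Phi (- y) + Phi y" for x y
  proof -
    have "\<forall>x. ((\<lambda>x. Phi (- x) + Phi x) has_real_derivative 0) (at x)"
      by (auto intro!: derivative_eq_intros)
    from DERIV_isconst_all[OF this, of x y] show ?thesis .
  qed
  have "((\<lambda>y. Phi (- y) + Phi y) \<longlongrightarrow> 0 + 1) at_top"
    by (intro tendsto_add Phi_at_top filterlim_compose[OF Phi_at_bot]) (rule filterlim_uminus_at_bot_at_top)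
  moreover have "(\<lambda>y. Phi (- y) + Phi y) = (\<lambda>y. Phi (- x) + Phi x)" using const by blast
  ultimately have "((\<lambda>y::real. Phi (- x) + Phi x) \<longlongrightarrow> 1) at_top" by simp
  thus ?thesis by (simp add: tendsto_const_iff)
qed

lemma Phi_0 [simp]: "Phi 0 = 1 / 2"
  using Phi_minus[of 0] by simp

lemma ex_Phi_eq:
  assumes "0 < p" "p < 1"
  shows "\<exists>x. Phi x = p"
proof -
  obtain l where l: "Phi l < p"
    using order_tendstoD(2)[OF Phi_at_bot assms(1)] by (auto simp: eventually_at_bot_linorder)
  obtain u where u: "Phi u > p"
    using order_tendstoD(1)[OF Phi_at_top assms(2)] by (auto simp: eventually_at_top_linorder)
  have "l \<le> u" using l u by (meson Phi_less_iff less_trans less_imp_le)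
  thus ?thesis using IVT[of Phi l p u] l u isCont_Phi by auto
qed

text \<open>The real-valued branch of \<open>Phi_inv\<close> inside (0, 1), kept separate so that
  calculus does not pass through \<open>ereal\<close>.\<close>

definition quantile :: "real \<Rightarrow> real" where
  "quantile p = (THE x. Phi x = p)"

lemma Phi_quantile [simp]: assumes "0 < p" "p < 1" shows "Phi (quantile p) = p"
proof -
  obtain x where "Phi x = p" using ex_Phi_eq[OF assms] ..
  thus ?thesis unfolding quantile_def by (metis (mono_tags, lifting) Phi_eq_iff theI)
qed

lemma quantile_Phi [simp]: "quantile (Phi x) = x"
  unfolding quantile_def by (rule the_equality) auto

lemma Phi_inv_quantile: "0 < p \<Longrightarrow> p < 1 \<Longrightarrow> Phi_inv p = ereal (quantile p)"
  by (simp add: Phi_inv_def quantile_def)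

lemma quantile_le_iff: "0 < p \<Longrightarrow> p < 1 \<Longrightarrow> quantile p \<le> x \<longleftrightarrow> p \<le> Phi x"
  by (metis Phi_quantile Phi_le_iff)

lemma DERIV_quantile:
  assumes "0 < p" "p < 1"
  shows "(quantile has_real_derivative 1 / \<phi> (quantile p)) (at p)"
proof -
  have "(quantile has_real_derivative inverse (\<phi> (quantile p))) (at p)"
  proof (rule DERIV_inverse_function[where f = Phi and a = 0 and b = 1])
    show "isCont quantile p"
      using isCont_inverse_function[of 1 "quantile p" quantile Phi] assms isCont_Phi by simp
    show "\<phi> (quantile p) \<noteq> 0" using std_normal_density_pos[of "quantile p"] by linarith
  qed (use assms DERIV_Phi in auto)
  thus ?thesis by (simp add: divide_inverse)
qed

section \<open>The bivariate distribution function\<close>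

interpretation std_normal_pair: pair_prob_space std_normal std_normal
  by unfold_locales

lemma sets_std_normal_pair [simp, measurable_cong]:
  "sets (std_normal \<Otimes>\<^sub>M std_normal) = sets (borel \<Otimes>\<^sub>M borel)"
  by (intro sets_pair_measure_cong sets_std_normal)

lemma space_std_normal_pair [simp]: "space (std_normal \<Otimes>\<^sub>M std_normal) = UNIV"
  by (simp add: space_pair_measure)

lemma Phi2_set_borel [measurable, simp]:
  "{(z1, z2). ereal z1 \<le> x \<and> ereal (r * z1 + q * z2) \<le> y} \<in> sets (borel \<Otimes>\<^sub>M borel)"
proof -
  have "{p \<in> space (borel \<Otimes>\<^sub>M borel). ereal (fst p) \<le> x \<and> ereal (r * fst p + q * snd p) \<le> y}
    \<in> sets (borel \<Otimes>\<^sub>M borel)"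
    by measurable
  thus ?thesis by (simp add: case_prod_beta' space_pair_measure)
qed

lemma measure_std_normal_times:
  assumes "A \<in> sets borel" "B \<in> sets borel"
  shows "measure (std_normal \<Otimes>\<^sub>M std_normal) (A \<times> B) = measure std_normal A * measure std_normal B"
  using assms by (simp add: measure_def std_normal.emeasure_pair_measure_Times enn2real_mult)

lemma Phi2_nonneg: "0 \<le> Phi2 r x y"
  by (simp add: Phi2_def)

lemma Phi2_mono: "x \<le> x' \<Longrightarrow> y \<le> y' \<Longrightarrow> Phi2 r x y \<le> Phi2 r x' y'"
  unfolding Phi2_def
  by (rule std_normal_pair.P.finite_measure_mono) (auto intro: order_trans)

lemma Phi2_minus_infinity [simp]: "Phi2 r (- \<infinity>) y = 0" "Phi2 r x (- \<infinity>) = 0"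
  by (simp_all add: Phi2_def)

lemma Phi2_le_Phi: "Phi2 r (ereal x) y \<le> Phi x"
proof -
  have "Phi2 r (ereal x) y \<le> measure (std_normal \<Otimes>\<^sub>M std_normal) ({..x} \<times> UNIV)"
    unfolding Phi2_def by (rule std_normal_pair.P.finite_measure_mono) auto
  also have "\<dots> = Phi x"
    by (simp add: measure_std_normal_times Phi_def std_normal.prob_space[simplified])
  finally show ?thesis .
qed

section \<open>Plackett's identity\<close>

lemma Phi2_Fubini:
  assumes "cos \<theta> > 0"
  shows "Phi2 (sin \<theta>) (ereal x) (ereal y) =
    (\<integral>z. \<phi> z * (indicator {..x} z * Phi ((y - sin \<theta> * z) / cos \<theta>)) \<partial>lborel)"
proof -
  let ?S = "{(z1, z2). ereal z1 \<le> ereal x \<and> ereal (sin \<theta> * z1 + sqrt (1 - (sin \<theta>)\<^sup>2) * z2) \<le> ereal y}"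
  have c: "sqrt (1 - (sin \<theta>)\<^sup>2) = cos \<theta>"
    using assms by (simp add: cos_squared_eq[symmetric])
  have "Phi2 (sin \<theta>) (ereal x) (ereal y) = (\<integral>p. indicator ?S p \<partial>(std_normal \<Otimes>\<^sub>M std_normal))"
    unfolding Phi2_def by simp
  also have "\<dots> = (\<integral>z1. (\<integral>z2. indicator ?S (z1, z2) \<partial>std_normal) \<partial>std_normal)"
    by (rule std_normal_pair.integral_fst'[symmetric])
       (auto intro!: std_normal_pair.P.integrable_const_bound[where B = 1] simp: indicator_def)
  also have "\<dots> = (\<integral>z1. indicator {..x} z1 * Phi ((y - sin \<theta> * z1) / cos \<theta>) \<partial>std_normal)"
  proof (rule Bochner_Integration.integral_cong)
    fix z1 :: real
    have "(\<lambda>z2. indicator ?S (z1, z2) :: real) =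
          (\<lambda>z2. indicator {..x} z1 * indicator {..(y - sin \<theta> * z1) / cos \<theta>} z2)"
      using assms by (auto simp: indicator_def fun_eq_iff c field_simps)
    thus "(\<integral>z2. indicator ?S (z1, z2) \<partial>std_normal) = indicator {..x} z1 * Phi ((y - sin \<theta> * z1) / cos \<theta>)"
      by (simp add: Phi_def)
  qed simp
  also have "\<dots> = (\<integral>z. \<phi> z * (indicator {..x} z * Phi ((y - sin \<theta> * z) / cos \<theta>)) \<partial>lborel)"
    by (rule integral_std_normal) measurable
  finally show ?thesis .
qed

text \<open>With correlation \<open>sin \<theta>\<close> the factor
  \<open>sqrt (1 - \<rho>\<^sup>2)\<close> is \<open>cos \<theta>\<close>. Subtracting the value at
  \<open>x0\<close> leaves a compact domain of integration, on which differentiation under the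
  integral sign is available.\<close>

lemma Phi2_diff:
  assumes "cos \<theta> > 0" "x0 \<le> x"
  shows "Phi2 (sin \<theta>) (ereal x) (ereal y) - Phi2 (sin \<theta>) (ereal x0) (ereal y) =
    integral {x0..x} (\<lambda>z. \<phi> z * Phi ((y - sin \<theta> * z) / cos \<theta>))"
proof -
  let ?g = "\<lambda>z. \<phi> z * Phi ((y - sin \<theta> * z) / cos \<theta>)"
  have int: "integrable lborel (\<lambda>z. \<phi> z * (indicator A z * Phi ((y - sin \<theta> * z) / cos \<theta>)))"
    if [measurable]: "A \<in> sets borel" for A
    by (rule Bochner_Integration.integrable_bound[OF integrable_normal_density[of 1 0]])
       (auto simp: indicator_def abs_mult intro!: mult_left_le)
  have "Phi2 (sin \<theta>) (ereal x) (ereal y) - Phi2 (sin \<theta>) (ereal x0) (ereal y) =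
    (\<integral>z. \<phi> z * (indicator {..x} z * Phi ((y - sin \<theta> * z) / cos \<theta>)) -
          \<phi> z * (indicator {..x0} z * Phi ((y - sin \<theta> * z) / cos \<theta>)) \<partial>lborel)"
    unfolding Phi2_Fubini[OF assms(1)] by (rule Bochner_Integration.integral_diff[symmetric]) (auto intro: int)
  also have "\<dots> = (\<integral>z. indicator {x0..x} z *\<^sub>R ?g z \<partial>lborel)"
    by (rule integral_cong_AE)
       (use AE_lborel_singleton[of x0] assms(2) in \<open>auto elim!: eventually_mono simp: indicator_def\<close>)
  also have "\<dots> = integral {x0..x} ?g"
  proof -
    have "set_integrable lborel {x0..x} ?g"
      using int[of "{x0..x}"] by (simp add: set_integrable_def mult_ac)
    from set_borel_integral_eq_integral(2)[OF this] show ?thesis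
      by (simp add: set_lebesgue_integral_def)
  qed
  finally show ?thesis .
qed

text \<open>Plackett's kernel in the variable \<open>\<theta> = arcsin \<rho>\<close>: it is at the same time the
  \<open>\<theta>\<close>-derivative of the bivariate distribution function and, as a function of \<open>z\<close>, a primitive
  of the \<open>\<theta>\<close>-derivative of the Fubini integrand.\<close>
definition plackett :: "real \<Rightarrow> real \<Rightarrow> real \<Rightarrow> real" where
  "plackett y z \<theta> = \<phi> z * \<phi> ((y - sin \<theta> * z) / cos \<theta>)"

text \<open>This is the bivariate normal density at (z, y) times \<open>cos \<theta>\<close>, the
  Jacobian of \<open>\<rho> = sin \<theta>\<close>.\<close>

lemma plackett_eq:
  assumes "cos \<theta> > 0"
  shows "plackett y z \<theta> = exp (- ((z\<^sup>2 + y\<^sup>2 - 2 * sin \<theta> * z * y) / (2 * (cos \<theta>)\<^sup>2))) / (2 * pi)"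
proof -
  have square: "z\<^sup>2 + ((y - s * z) / c)\<^sup>2 = (z\<^sup>2 * (s\<^sup>2 + c\<^sup>2) + y\<^sup>2 - 2 * s * z * y) / c\<^sup>2"
    if "c \<noteq> 0" for s c :: real
    using that by (simp add: power_divide add_divide_eq_iff) (simp add: power2_eq_square algebra_simps)
  have *: "z\<^sup>2 + ((y - sin \<theta> * z) / cos \<theta>)\<^sup>2 = (z\<^sup>2 + y\<^sup>2 - 2 * sin \<theta> * z * y) / (cos \<theta>)\<^sup>2"
    using square[of "cos \<theta>" "sin \<theta>"] assms by simp
  have "plackett y z \<theta> = exp (- (z\<^sup>2 + ((y - sin \<theta> * z) / cos \<theta>)\<^sup>2) / 2) / (sqrt (2 * pi) * sqrt (2 * pi))"
    by (simp add: plackett_def std_normal_density_def exp_add[symmetric] field_simps)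
  also have "sqrt (2 * pi) * sqrt (2 * pi) = 2 * pi" by simp
  also have "- (z\<^sup>2 + ((y - sin \<theta> * z) / cos \<theta>)\<^sup>2) / 2 =
      - ((z\<^sup>2 + y\<^sup>2 - 2 * sin \<theta> * z * y) / (2 * (cos \<theta>)\<^sup>2))"
    unfolding * by simp
  finally show ?thesis .
qed

lemma plackett_bounds:
  assumes "cos \<theta> > 0"
  shows "0 \<le> plackett y z \<theta>" "plackett y z \<theta> \<le> \<phi> z"
proof -
  have "\<phi> w \<le> 1" for w
  proof -
    have "1 / sqrt (2 * pi) \<le> 1" using pi_gt3 by (simp add: divide_simps)
    thus ?thesis using std_normal_density_le[of w] by linarith
  qed
  thus "plackett y z \<theta> \<le> \<phi> z" unfolding plackett_def by (intro mult_left_le) auto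
qed (auto simp: plackett_def)

lemma Plackett_truncated:
  fixes y :: real
  assumes I: "\<And>\<theta>. \<theta> \<in> {\<theta>0..\<theta>1} \<Longrightarrow> cos \<theta> > 0" and le: "\<theta>0 \<le> \<theta>1" "x0 \<le> x"
  defines "D \<equiv> (\<lambda>y \<theta>. Phi2 (sin \<theta>) (ereal x) (ereal y) - Phi2 (sin \<theta>) (ereal x0) (ereal y))"
  shows "((\<lambda>\<theta>. plackett y x \<theta> - plackett y x0 \<theta>) has_integral D y \<theta>1 - D y \<theta>0) {\<theta>0..\<theta>1}"
proof (rule fundamental_theorem_of_calculus)
  fix \<theta> assume th: "\<theta> \<in> {\<theta>0..\<theta>1}"
  let ?w = "\<lambda>\<theta> z. (y - sin \<theta> * z) / cos \<theta>"
  let ?f' = "\<lambda>\<theta> z. plackett y z \<theta> * ((y * sin \<theta> - z) / (cos \<theta>)\<^sup>2)"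
  have nz: "cos \<theta> \<noteq> 0" if "\<theta> \<in> {\<theta>0..\<theta>1}" for \<theta> using I[OF that] by simp
  have sc: "cos t * cos t = 1 - sin t * sin t" for t :: real
    using sin_cos_squared_add[of t] by (simp add: power2_eq_square algebra_simps)
  have "((\<lambda>\<theta>. integral (cbox x0 x) (\<lambda>z. \<phi> z * Phi (?w \<theta> z))) has_real_derivative
         integral (cbox x0 x) (?f' \<theta>)) (at \<theta> within {\<theta>0..\<theta>1})"
  proof (rule leibniz_rule_field_derivative)
    fix \<theta> z assume "\<theta> \<in> {\<theta>0..\<theta>1}" "z \<in> cbox x0 x"
    note c = nz[OF this(1)]
    have 1: "((\<lambda>\<theta>. ?w \<theta> z) has_real_derivative (y * sin \<theta> - z) / (cos \<theta>)\<^sup>2) (at \<theta> within {\<theta>0..\<theta>1})"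
      using c by (auto intro!: derivative_eq_intros simp: divide_simps power2_eq_square)
                 (simp add: algebra_simps sc)
    show "((\<lambda>\<theta>. \<phi> z * Phi (?w \<theta> z)) has_real_derivative ?f' \<theta> z) (at \<theta> within {\<theta>0..\<theta>1})"
      unfolding plackett_def by (rule derivative_eq_intros 1 refl | simp add: mult_ac)+
  next
    fix \<theta> assume "\<theta> \<in> {\<theta>0..\<theta>1}"
    thus "(\<lambda>z. \<phi> z * Phi (?w \<theta> z)) integrable_on cbox x0 x"
      using nz by (intro integrable_continuous continuous_intros) auto
  next
    show "continuous_on ({\<theta>0..\<theta>1} \<times> cbox x0 x) (\<lambda>(\<theta>, z). ?f' \<theta> z)"
      unfolding plackett_def case_prod_beta'
      by (intro continuous_intros) (use nz in auto)
  qed (use th in auto)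
  moreover have "integral (cbox x0 x) (?f' \<theta>) = plackett y x \<theta> - plackett y x0 \<theta>"
  proof (rule integral_unique, unfold cbox_interval, rule fundamental_theorem_of_calculus)
    fix z
    have 1: "((\<lambda>z. ?w \<theta> z) has_real_derivative - sin \<theta> / cos \<theta>) (at z within {x0..x})"
      using nz[OF th] by (auto intro!: derivative_eq_intros)
    have "((\<lambda>z. plackett y z \<theta>) has_real_derivative ?f' \<theta> z) (at z within {x0..x})"
      unfolding plackett_def
      by (rule DERIV_cong[OF DERIV_mult[OF DERIV_std_normal_density DERIV_std_normal_density_compose[OF 1]]])
         (use nz[OF th] in \<open>simp add: divide_simps power2_eq_square\<close>, simp add: algebra_simps sc)
    thus "((\<lambda>z. plackett y z \<theta>) has_vector_derivative ?f' \<theta> z) (at z within {x0..x})"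
      by (simp add: has_real_derivative_iff_has_vector_derivative)
  qed (use le in auto)
  ultimately have "((\<lambda>\<theta>. integral {x0..x} (\<lambda>z. \<phi> z * Phi (?w \<theta> z))) has_vector_derivative
         plackett y x \<theta> - plackett y x0 \<theta>) (at \<theta> within {\<theta>0..\<theta>1})"
    by (simp add: has_real_derivative_iff_has_vector_derivative)
  thus "(D y has_vector_derivative plackett y x \<theta> - plackett y x0 \<theta>) (at \<theta> within {\<theta>0..\<theta>1})"
    by (rule has_vector_derivative_transform[rotated -1]) (use th I le in \<open>auto simp: D_def Phi2_diff\<close>)
qed (use le in auto)

lemma Plackett:
  assumes I: "\<And>\<theta>. \<theta> \<in> {\<theta>0..\<theta>1} \<Longrightarrow> cos \<theta> > 0" and le: "\<theta>0 \<le> \<theta>1"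
  shows "(plackett y x has_integral
           Phi2 (sin \<theta>1) (ereal x) (ereal y) - Phi2 (sin \<theta>0) (ereal x) (ereal y)) {\<theta>0..\<theta>1}"
proof -
  have cont: "continuous_on {\<theta>0..\<theta>1} (plackett y z)" for z
    unfolding plackett_def using I by (intro continuous_intros) fastforce+
  \<comment> \<open>By construction \<open>T u\<close> minus the integral of
    \<open>plackett y u\<close> is constant in \<open>u\<close>. The truncated identity shows that
    \<open>T u\<close> is the increment of \<open>Phi2\<close> at \<open>u\<close>, so both parts
    vanish as \<open>u\<close> tends to minus infinity and the constant is 0.\<close>
  define T where "T = (\<lambda>u. integral {\<theta>0..\<theta>1} (plackett y u) +
    (Phi2 (sin \<theta>1) (ereal x) (ereal y) - Phi2 (sin \<theta>0) (ereal x) (ereal y) - integral {\<theta>0..\<theta>1} (plackett y x)))"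
  have T: "T u = Phi2 (sin \<theta>1) (ereal u) (ereal y) - Phi2 (sin \<theta>0) (ereal u) (ereal y)" if "u \<le> x" for u
  proof -
    have "integral {\<theta>0..\<theta>1} (plackett y x) - integral {\<theta>0..\<theta>1} (plackett y u) =
      integral {\<theta>0..\<theta>1} (\<lambda>\<theta>. plackett y x \<theta> - plackett y u \<theta>)"
      by (intro integral_diff[symmetric] integrable_continuous_real cont)
    also have "\<dots> = (Phi2 (sin \<theta>1) (ereal x) (ereal y) - Phi2 (sin \<theta>1) (ereal u) (ereal y)) -
      (Phi2 (sin \<theta>0) (ereal x) (ereal y) - Phi2 (sin \<theta>0) (ereal u) (ereal y))"
        by (rule integral_unique, rule Plackett_truncated) (use I le that in auto)
    finally show ?thesis by (simp add: T_def)
  qed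
  have lim1: "((\<lambda>u. T u) \<longlongrightarrow> 0) at_bot"
  proof (rule Lim_null_comparison)
    show "\<forall>\<^sub>F u in at_bot. norm (T u) \<le> Phi u"
      using eventually_le_at_bot[of x]
    proof eventually_elim
      case (elim u)
      show ?case unfolding T[OF elim]
        using Phi2_le_Phi[of "sin \<theta>1" u] Phi2_le_Phi[of "sin \<theta>0" u] Phi2_nonneg by (auto simp: abs_le_iff intro: order_trans)
          (smt (verit) Phi2_nonneg Phi2_le_Phi)+
    qed
  qed (rule Phi_at_bot)
  have lim2: "((\<lambda>u. integral {\<theta>0..\<theta>1} (plackett y u)) \<longlongrightarrow> 0) at_bot"
  proof (rule Lim_null_comparison)
    show "\<forall>\<^sub>F u in at_bot. norm (integral {\<theta>0..\<theta>1} (plackett y u)) \<le> \<phi> u * (\<theta>1 - \<theta>0)"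
    proof (intro always_eventually allI)
      fix u
      have "norm (integral {\<theta>0..\<theta>1} (plackett y u)) \<le> \<phi> u * (\<theta>1 - \<theta>0)"
        by (rule integral_bound) (use le cont plackett_bounds I in auto)
      thus "norm (integral {\<theta>0..\<theta>1} (plackett y u)) \<le> \<phi> u * (\<theta>1 - \<theta>0)" .
    qed
    show "((\<lambda>u. \<phi> u * (\<theta>1 - \<theta>0)) \<longlongrightarrow> 0) at_bot"
      using tendsto_mult_left_zero[OF tendsto_std_normal_density_at_bot] by simp
  qed
  have "((\<lambda>u. T u - integral {\<theta>0..\<theta>1} (plackett y u)) \<longlongrightarrow> 0 - 0) at_bot"
    by (intro tendsto_diff lim1 lim2)
  hence "Phi2 (sin \<theta>1) (ereal x) (ereal y) - Phi2 (sin \<theta>0) (ereal x) (ereal y) = integral {\<theta>0..\<theta>1} (plackett y x)"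
    by (simp add: T_def tendsto_const_iff)
  thus ?thesis using integrable_integral[OF integrable_continuous_real[OF cont[of x]]] by simp
qed

lemma Phi2_0: "Phi2 0 (ereal x) (ereal y) = Phi x * Phi y"
proof -
  have "Phi2 0 (ereal x) (ereal y) = measure (std_normal \<Otimes>\<^sub>M std_normal) ({..x} \<times> {..y})"
    unfolding Phi2_def by (rule arg_cong[where f = "measure _"]) auto
  thus ?thesis by (simp add: measure_std_normal_times Phi_def)
qed

text \<open>\<open>K a e \<Theta>\<close> is the amount by which correlation \<open>- sin \<Theta>\<close> lowers the probability
  that the two variables stay below \<open>a + e\<close> and \<open>a - e\<close>.\<close>
definition kern :: "real \<Rightarrow> real \<Rightarrow> real \<Rightarrow> real" where
  "kern a e \<theta> = exp (- (a\<^sup>2 / (1 - sin \<theta>) + e\<^sup>2 / (1 + sin \<theta>)))"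

definition K :: "real \<Rightarrow> real \<Rightarrow> real \<Rightarrow> real" where
  "K a e \<Theta> = integral {0..\<Theta>} (kern a e) / (2 * pi)"

lemma cos_pos_sin:
  fixes \<theta> :: real
  assumes "cos \<theta> > 0"
  shows "sin \<theta> < 1" "- 1 < sin \<theta>" "1 - sin \<theta> > 0" "1 + sin \<theta> > 0"
proof -
  have "(sin \<theta>)\<^sup>2 < 1"
    using assms sin_cos_squared_add[of \<theta>] zero_less_power[OF assms, of 2] by linarith
  hence "\<bar>sin \<theta>\<bar> < 1" by (simp add: abs_square_less_1)
  thus "sin \<theta> < 1" "- 1 < sin \<theta>" "1 - sin \<theta> > 0" "1 + sin \<theta> > 0" by auto
qed

lemma continuous_on_kern: "(\<And>\<theta>. \<theta> \<in> S \<Longrightarrow> cos \<theta> > 0) \<Longrightarrow> continuous_on S (kern a e)"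
  unfolding kern_def
  by (intro continuous_intros) (use cos_pos_sin in \<open>fastforce+\<close>)

lemma kern_nonneg: "0 \<le> kern a e \<theta>"
  by (simp add: kern_def)

text \<open>The half sum and the half difference of the variables are uncorrelated, with variances
  (1 - sin \<theta>) / 2 and (1 + sin \<theta>) / 2 at correlation \<open>- sin \<theta>\<close>;
  this diagonalises the exponent.\<close>

lemma plackett_kern:
  assumes "cos \<theta> > 0"
  shows "plackett y x (- \<theta>) = kern ((x + y) / 2) ((x - y) / 2) \<theta> / (2 * pi)"
proof -
  note s = cos_pos_sin[OF assms]
  have "(x\<^sup>2 + y\<^sup>2 + 2 * s * x * y) / (2 * ((1 - s) * (1 + s))) = ((x + y) / 2)\<^sup>2 / (1 - s) + ((x - y) / 2)\<^sup>2 / (1 + s)"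
    if "1 - s > 0" "1 + s > 0" for s
    using that by (simp add: divide_simps) (simp add: power2_eq_square algebra_simps)
  note * = this[OF s(3,4)]
  have "(cos \<theta>)\<^sup>2 = (1 - sin \<theta>) * (1 + sin \<theta>)"
    by (simp add: cos_squared_eq algebra_simps power2_eq_square)
  hence "(x\<^sup>2 + y\<^sup>2 - 2 * sin (- \<theta>) * x * y) / (2 * (cos (- \<theta>))\<^sup>2) =
      ((x + y) / 2)\<^sup>2 / (1 - sin \<theta>) + ((x - y) / 2)\<^sup>2 / (1 + sin \<theta>)"
    using * by simp
  thus ?thesis using plackett_eq[of "- \<theta>" y x] assms
    by (simp only: kern_def cos_minus)
qed

lemma cos_pos_Icc: "0 \<le> \<Theta> \<Longrightarrow> \<Theta> < pi / 2 \<Longrightarrow> \<theta> \<in> {- \<Theta>..\<Theta>} \<Longrightarrow> cos \<theta> > 0"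
  by (rule cos_gt_zero_pi) auto

lemma Phi2_nonpos_correlation:
  assumes "0 \<le> \<Theta>" "\<Theta> < pi / 2"
  shows "Phi2 (- sin \<Theta>) (ereal x) (ereal y) = Phi x * Phi y - K ((x + y) / 2) ((x - y) / 2) \<Theta>"
proof -
  have "(plackett y x has_integral Phi2 (sin 0) (ereal x) (ereal y) - Phi2 (sin (- \<Theta>)) (ereal x) (ereal y)) {- \<Theta>..0}"
    by (rule Plackett) (use cos_pos_Icc[OF assms] assms in auto)
  hence "((\<lambda>\<theta>. plackett y x (- \<theta>)) has_integral Phi x * Phi y - Phi2 (- sin \<Theta>) (ereal x) (ereal y)) {0..\<Theta>}"
    using has_integral_reflect_real[where f = "plackett y x" and a = "- \<Theta>" and b = 0] assms by (simp add: Phi2_0)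
  hence "((\<lambda>\<theta>. kern ((x + y) / 2) ((x - y) / 2) \<theta> / (2 * pi)) has_integral
      Phi x * Phi y - Phi2 (- sin \<Theta>) (ereal x) (ereal y)) {0..\<Theta>}"
    by (rule has_integral_eq[rotated]) (use cos_pos_Icc[OF assms] plackett_kern in auto)
  from integral_unique[OF this] show ?thesis by (simp add: K_def)
qed

section \<open>Nonnegative correlation: the covariance of the two threshold events\<close>

lemma plackett_diag:
  assumes "cos \<theta> > 0"
  shows "plackett x x \<theta> = exp (- (x\<^sup>2 / (1 + sin \<theta>))) / (2 * pi)"
  using plackett_kern[of "- \<theta>" x x] assms by (simp add: kern_def)

text \<open>Chord bound for a convex function. In the variable \<open>sin \<theta>\<close> the
  integrand becomes \<open>q\<close>, which is increasing, so the integral is convex in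
  \<open>sin \<theta>\<close>; it vanishes at 0 and stays below
  \<open>Phi x - (Phi x)\<^sup>2\<close>, because \<open>Phi2\<close> is at most
  \<open>Phi x\<close>.\<close>

lemma Phi2_diag_le:
  assumes "0 \<le> \<theta>" "\<theta> < pi / 2"
  shows "integral {0..\<theta>} (plackett x x) \<le> sin \<theta> * (Phi x * (1 - Phi x))"
proof (cases "\<theta> = 0")
  case False
  define R where "R = (\<lambda>\<theta>. integral {0..\<theta>} (plackett x x))"
  define q where "q = (\<lambda>\<theta>. exp (- (x\<^sup>2 / (1 + sin \<theta>))) / (2 * pi * cos \<theta>))"
  have cp: "cos u > 0" if "u \<in> {0..<pi / 2}" for u using that by (intro cos_gt_zero_pi) auto
  have pl: "plackett x x u = q u * cos u" if "u \<in> {0..<pi / 2}" for u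
  proof -
    show ?thesis using plackett_diag[OF cp[OF that], of x] cp[OF that] by (simp add: q_def)
  qed
  have cont: "continuous_on {a..b} (plackett x x)" if "0 \<le> a" "b < pi / 2" for a b
  proof -
    have "\<forall>u\<in>{a..b}. cos u \<noteq> 0" using cp that by (auto intro!: less_imp_neq[THEN not_sym])
    thus ?thesis unfolding plackett_def by (intro continuous_intros)
  qed
  have cos_mono: "cos v \<le> cos u" if "0 \<le> u" "u \<le> v" "v < pi / 2" for u v
    using that by (intro cos_monotone_0_pi_le) auto
  have sin_mono: "sin u \<le> sin v" if "0 \<le> u" "u \<le> v" "v < pi / 2" for u v
    using that by (intro sin_monotone_2pi_le) auto
  have q_mono: "q u \<le> q v" if "0 \<le> u" "u \<le> v" "v < pi / 2" for u v
  proof -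
    have s: "0 \<le> sin u" using that by (intro sin_ge_zero) auto
    have "x\<^sup>2 / (1 + sin v) \<le> x\<^sup>2 / (1 + sin u)"
      using s sin_mono[OF that] by (intro divide_left_mono) auto
    thus ?thesis unfolding q_def
      using cp[of u] cp[of v] that cos_mono[OF that] by (intro frac_le) auto
  qed
  have sin_int: "((\<lambda>u. c * cos u) has_integral c * sin v - c * sin u) {u..v}" if "u \<le> v" for u v c :: real
    by (rule fundamental_theorem_of_calculus)
       (use that in \<open>auto intro!: derivative_eq_intros simp: has_real_derivative_iff_has_vector_derivative[symmetric]\<close>)
  \<comment> \<open>The average slopes on [0, \<theta>] and [\<theta>, v] are compared through
    \<open>q \<theta>\<close>. The point \<open>v\<close> stays below pi / 2, where the cosine would
    vanish; the limit is taken at the end.\<close>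
  have upper: "R \<theta> * sin v \<le> (Phi x * (1 - Phi x)) * sin \<theta>" if v: "\<theta> \<le> v" "v < pi / 2" for v
  proof -
    have "R v = Phi2 (sin v) (ereal x) (ereal x) - Phi x * Phi x"
      unfolding R_def using Plackett[of 0 v x x] cp v assms by (auto simp: Phi2_0 intro!: integral_unique)
    hence Rv: "R v \<le> Phi x * (1 - Phi x)"
      using Phi2_le_Phi[of "sin v" x "ereal x"] by (simp add: algebra_simps)
    have s0: "sin \<theta> > 0" using assms False by (intro sin_gt_zero) auto
    have "R \<theta> \<le> integral {0..\<theta>} (\<lambda>u. q \<theta> * cos u)"
      unfolding R_def
    proof (rule integral_le)
      fix u assume "u \<in> {0..\<theta>}"
      thus "plackett x x u \<le> q \<theta> * cos u"
        using pl[of u] q_mono[of u \<theta>] cp[of u] assms by (auto intro!: mult_right_mono)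
    qed (use cont assms sin_int[of 0 \<theta>] in \<open>auto intro!: integrable_continuous_real continuous_intros\<close>)
    also have "\<dots> = q \<theta> * sin \<theta>" using sin_int[of 0 \<theta> "q \<theta>"] assms by (simp add: integral_unique)
    finally have 1: "R \<theta> \<le> q \<theta> * sin \<theta>" .
    have "q \<theta> * sin v - q \<theta> * sin \<theta> = integral {\<theta>..v} (\<lambda>u. q \<theta> * cos u)"
      using integral_unique[OF sin_int[of \<theta> v "q \<theta>"]] v by simp
    also have "\<dots> \<le> integral {\<theta>..v} (plackett x x)"
    proof (rule integral_le)
      fix u assume "u \<in> {\<theta>..v}"
      thus "q \<theta> * cos u \<le> plackett x x u"
        using pl[of u] q_mono[of \<theta> u] cp[of u] assms v by (auto intro!: mult_right_mono)
    qed (use cont assms v in \<open>auto intro!: integrable_continuous_real continuous_intros\<close>)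
    also have "\<dots> = R v - R \<theta>"
    proof -
      have "plackett x x integrable_on {0..v}"
        using cont[of 0 v] v by (auto intro!: integrable_continuous_real)
      from Henstock_Kurzweil_Integration.integral_combine[OF assms(1) v(1) this] show ?thesis
        by (simp add: R_def)
    qed
    finally have 2: "q \<theta> * (sin v - sin \<theta>) \<le> R v - R \<theta>" by (simp add: algebra_simps)
    have "R \<theta> * (sin v - sin \<theta>) \<le> q \<theta> * sin \<theta> * (sin v - sin \<theta>)"
      by (rule mult_right_mono[OF 1]) (use sin_mono[of \<theta> v] assms v in auto)
    also have "\<dots> \<le> (R v - R \<theta>) * sin \<theta>"
      using mult_right_mono[OF 2, of "sin \<theta>"] s0 by (simp add: mult_ac)
    finally have "R \<theta> * sin v \<le> R v * sin \<theta>" by (simp add: algebra_simps)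
    also have "\<dots> \<le> (Phi x * (1 - Phi x)) * sin \<theta>" using Rv s0 by (intro mult_right_mono) auto
    finally show ?thesis .
  qed
  have "((\<lambda>v. R \<theta> * sin v) \<longlongrightarrow> R \<theta> * sin (pi / 2)) (at_left (pi / 2))"
    by (intro tendsto_intros)
  moreover have "\<forall>\<^sub>F v in at_left (pi / 2). R \<theta> * sin v \<le> (Phi x * (1 - Phi x)) * sin \<theta>"
    using eventually_at_left_real[OF assms(2)] by (rule eventually_mono) (use upper in auto)
  ultimately have "R \<theta> * sin (pi / 2) \<le> (Phi x * (1 - Phi x)) * sin \<theta>"
    by (rule tendsto_upperbound) simp
  thus ?thesis by (simp add: R_def mult.commute)
qed simp

text \<open>Covariance of two indicators against the product of their standard deviations. Off the
  diagonal the kernel is at most the geometric mean of the two diagonal kernels, which reduces the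
  claim to \<open>Phi2_diag_le\<close>.\<close>

lemma Phi2_nonneg_correlation_le:
  assumes "0 \<le> \<theta>" "\<theta> < pi / 2"
  shows "Phi2 (sin \<theta>) (ereal x) (ereal y) \<le>
    Phi x * Phi y + sin \<theta> * (sqrt (Phi x * (1 - Phi x)) * sqrt (Phi y * (1 - Phi y)))"
proof -
  define v where "v = (\<lambda>x. sqrt (Phi x * (1 - Phi x)))"
  have v: "v x > 0" "(v x)\<^sup>2 = Phi x * (1 - Phi x)" for x by (auto simp: v_def)
  \<comment> \<open>Weight in
    \<open>X * Y \<le> c / 2 * X\<^sup>2 + 1 / (2 * c) * Y\<^sup>2\<close>, chosen so that the
    bounds for the two diagonal contributions become equal.\<close>
  define c where "c = v y / v x"
  have c: "c > 0" using v by (simp add: c_def)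
  have cp: "cos u > 0" if "u \<in> {0..\<theta>}" for u using that assms by (intro cos_gt_zero_pi) auto
  have cont: "continuous_on {0..\<theta>} (plackett z w)" for z w
    unfolding plackett_def by (intro continuous_intros) (use cp in fastforce)
  have "Phi2 (sin \<theta>) (ereal x) (ereal y) - Phi x * Phi y = integral {0..\<theta>} (plackett y x)"
    using Plackett[of 0 \<theta> y x] cp assms by (auto simp: Phi2_0 intro!: integral_unique[symmetric])
  also have "\<dots> \<le> integral {0..\<theta>} (\<lambda>u. c / 2 * plackett x x u + 1 / (2 * c) * plackett y y u)"
  proof (rule integral_le)
    fix u assume u: "u \<in> {0..\<theta>}"
    have s: "0 \<le> sin u" "sin u < 1" using u assms cos_pos_sin[OF cp[OF u]] by (auto intro!: sin_ge_zero)
    have c2: "(cos u)\<^sup>2 = (1 - sin u) * (1 + sin u)"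
      by (simp add: cos_squared_eq algebra_simps power2_eq_square)
    have diag: "plackett z z u = exp (- (z\<^sup>2 / (1 + sin u))) / (2 * pi)" for z
      by (rule plackett_diag[OF cp[OF u]])
    define X where "X = exp (- (x\<^sup>2 / (1 + sin u) / 2))"
    define Y where "Y = exp (- (y\<^sup>2 / (1 + sin u) / 2))"
    have "(1 - sin u) * (x\<^sup>2 + y\<^sup>2) \<le> x\<^sup>2 + y\<^sup>2 - 2 * sin u * x * y"
    proof -
      have "0 \<le> sin u * (x - y)\<^sup>2" using s by simp
      thus ?thesis by (simp add: power2_eq_square algebra_simps)
    qed
    hence "(1 - sin u) * (x\<^sup>2 + y\<^sup>2) / (2 * (cos u)\<^sup>2) \<le> (x\<^sup>2 + y\<^sup>2 - 2 * sin u * x * y) / (2 * (cos u)\<^sup>2)"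
      by (intro divide_right_mono) auto
    moreover have "(1 - s) * (x\<^sup>2 + y\<^sup>2) / (2 * ((1 - s) * (1 + s))) = x\<^sup>2 / (1 + s) / 2 + y\<^sup>2 / (1 + s) / 2"
      if "0 \<le> s" "s < 1" for s
      using that by (simp add: divide_simps)
    note this[OF s, folded c2]
    ultimately have "exp (- ((x\<^sup>2 + y\<^sup>2 - 2 * sin u * x * y) / (2 * (cos u)\<^sup>2))) \<le> X * Y"
      unfolding X_def Y_def exp_add[symmetric] by simp
    also have "X * Y \<le> c / 2 * X\<^sup>2 + 1 / (2 * c) * Y\<^sup>2"
    proof -
      have "0 \<le> (c * X - Y)\<^sup>2 / (2 * c)" using c by simp
      also have "\<dots> = c / 2 * X\<^sup>2 + 1 / (2 * c) * Y\<^sup>2 - X * Y"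
        using c by (simp add: power2_eq_square field_simps)
      finally show ?thesis by simp
    qed
    finally have "exp (- ((x\<^sup>2 + y\<^sup>2 - 2 * sin u * x * y) / (2 * (cos u)\<^sup>2))) \<le> c / 2 * X\<^sup>2 + 1 / (2 * c) * Y\<^sup>2" .
    moreover have "X\<^sup>2 = exp (- (x\<^sup>2 / (1 + sin u)))" "Y\<^sup>2 = exp (- (y\<^sup>2 / (1 + sin u)))"
      by (simp_all only: X_def Y_def exp_double[symmetric]) (simp_all del: divide_divide_eq_left)
    ultimately have "exp (- ((x\<^sup>2 + y\<^sup>2 - 2 * sin u * x * y) / (2 * (cos u)\<^sup>2))) / (2 * pi) \<le>
        (c / 2 * exp (- (x\<^sup>2 / (1 + sin u))) + 1 / (2 * c) * exp (- (y\<^sup>2 / (1 + sin u)))) / (2 * pi)"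
      by (intro divide_right_mono) auto
    thus "plackett y x u \<le> c / 2 * plackett x x u + 1 / (2 * c) * plackett y y u"
      unfolding diag plackett_eq[OF cp[OF u], of y x] by (simp add: add_divide_distrib)
  qed (use cont c in \<open>auto intro!: integrable_continuous_real continuous_intros\<close>)
  also have "\<dots> = c / 2 * integral {0..\<theta>} (plackett x x) + 1 / (2 * c) * integral {0..\<theta>} (plackett y y)"
    using cont c by (subst integral_add) (auto intro!: integrable_continuous_real continuous_intros)
  also have "\<dots> \<le> c / 2 * (sin \<theta> * (v x)\<^sup>2) + 1 / (2 * c) * (sin \<theta> * (v y)\<^sup>2)"
    unfolding v using c Phi2_diag_le[OF assms] by (intro add_mono mult_left_mono) auto
  also have "\<dots> = sin \<theta> * (v x * v y)"
    using v(1)[of x] v(1)[of y] by (simp add: c_def field_simps power2_eq_square)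
  finally show ?thesis by (simp add: v_def)
qed

section \<open>Splitting \<open>h\<close>, and the configurations with the easy bound
  \<open>1 - \<gamma>\<close>\<close>

definition thr :: "real \<Rightarrow> real \<Rightarrow> real" where
  "thr \<gamma> b = quantile (\<gamma> * (1 + b) / 2)"

lemma prob_range:
  fixes \<gamma> b :: real
  assumes "0 < \<gamma>" "\<gamma> < 1" "- 1 < b" "b \<le> 1"
  shows "0 < \<gamma> * (1 + b) / 2" "\<gamma> * (1 + b) / 2 < 1"
proof -
  show "0 < \<gamma> * (1 + b) / 2" using assms by simp
  have "\<gamma> * (1 + b) \<le> \<gamma> * 2" using assms by (intro mult_left_mono) auto
  thus "\<gamma> * (1 + b) / 2 < 1" using assms by linarith
qed

lemma Phi_thr [simp]:
  assumes "0 < \<gamma>" "\<gamma> < 1" "- 1 < b" "b \<le> 1"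
  shows "Phi (thr \<gamma> b) = \<gamma> * (1 + b) / 2"
  unfolding thr_def by (rule Phi_quantile) (use prob_range[OF assms] in auto)

text \<open>Rests on \<open>3 - b1 - b2 - b12 = 4 - (1 + b1) * (1 + b2) + (b1 * b2 - b12)\<close>.
  The last bracket of the conclusion is the covariance of the two threshold events, to which
  Plackett's identity applies.\<close>

lemma h_eq:
  assumes "0 < \<gamma>" "\<gamma> < 1" "- 1 < b1" "b1 \<le> 1" "- 1 < b2" "b2 \<le> 1"
  shows "h \<gamma> b1 b2 b12 = (1 - \<gamma>) * (1 + \<gamma> * ((1 + b1) * (1 + b2)) / 4) - \<gamma> * (b1 * b2 - b12) / 4
    - (Phi2 (rho b1 b2 b12) (ereal (thr \<gamma> b1)) (ereal (thr \<gamma> b2)) - Phi (thr \<gamma> b1) * Phi (thr \<gamma> b2))"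
proof -
  have "Phi_inv (\<gamma> * (1 + b) / 2) = ereal (thr \<gamma> b)" if "- 1 < b" "b \<le> 1" for b
    unfolding thr_def by (rule Phi_inv_quantile) (use prob_range[OF assms(1,2) that] in auto)
  hence q: "Phi_inv (\<gamma> * (1 + b1) / 2) = ereal (thr \<gamma> b1)" "Phi_inv (\<gamma> * (1 + b2) / 2) = ereal (thr \<gamma> b2)"
    using assms by auto
  show ?thesis unfolding h_def Value_def q using assms
    by (simp add: algebra_simps add_divide_distrib diff_divide_distrib)
qed

text \<open>Here \<open>x = 1 + b1\<close>, \<open>y = 1 + b2\<close>, and the right side is what
  \<open>h\<close> keeps beyond \<open>1 - \<gamma>\<close>. Passing from the standard deviations at
  \<gamma> to those at 1 costs a factor \<open>(2 - \<gamma> * x) / (2 - x)\<close>; the triangle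
  inequality \<open>rA\<close> shows that the term with \<open>1 - \<gamma>\<close> pays for
  it.\<close>

lemma positive_correlation_algebra:
  fixes x y \<gamma> r :: real
  assumes "0 < x" "x < 2" "0 < y" "y \<le> x" "0 < \<gamma>" "\<gamma> < 1" "0 \<le> r"
  defines "A \<equiv> sqrt (x * y * ((2 - x) * (2 - y)))"
  assumes rA: "r * A \<le> y * (2 - x)"
  shows "r * (sqrt (\<gamma> * x / 2 * (1 - \<gamma> * x / 2)) * sqrt (\<gamma> * y / 2 * (1 - \<gamma> * y / 2)))
    \<le> (1 - \<gamma>) * (\<gamma> * (x * y) / 4) + \<gamma> * (r * A) / 4"
proof -
  define B where "B = sqrt (x * y * ((2 - \<gamma> * x) * (2 - \<gamma> * y)))"
  have gx: "\<gamma> * x < 2" "\<gamma> * y < 2"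
    using assms mult_strict_mono[of \<gamma> 1 x 2] mult_strict_mono[of \<gamma> 1 y 2] by auto
  have "sqrt (\<gamma> * x / 2 * (1 - \<gamma> * x / 2)) * sqrt (\<gamma> * y / 2 * (1 - \<gamma> * y / 2)) =
      sqrt ((\<gamma> / 4)\<^sup>2 * (x * y * ((2 - \<gamma> * x) * (2 - \<gamma> * y))))"
    unfolding real_sqrt_mult[symmetric] by (rule arg_cong[where f = sqrt]) (simp add: power2_eq_square field_simps)
  also have "\<dots> = \<gamma> / 4 * B" unfolding B_def using assms by (simp add: real_sqrt_mult)
  finally have 1: "sqrt (\<gamma> * x / 2 * (1 - \<gamma> * x / 2)) * sqrt (\<gamma> * y / 2 * (1 - \<gamma> * y / 2)) = \<gamma> / 4 * B" .
  have "(2 - \<gamma> * y) * (2 - x) \<le> (2 - y) * (2 - \<gamma> * x)"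
  proof -
    have "0 \<le> 2 * ((1 - \<gamma>) * (x - y))" using assms by simp
    also have "\<dots> = (2 - y) * (2 - \<gamma> * x) - (2 - \<gamma> * y) * (2 - x)" by (simp add: algebra_simps)
    finally show ?thesis by simp
  qed
  hence "(x * y * ((2 - \<gamma> * x) * (2 - x))) * ((2 - \<gamma> * y) * (2 - x)) \<le>
    (x * y * ((2 - \<gamma> * x) * (2 - x))) * ((2 - y) * (2 - \<gamma> * x))"
    using assms gx by (intro mult_left_mono) auto
  hence "sqrt ((2 - x)\<^sup>2 * (x * y * ((2 - \<gamma> * x) * (2 - \<gamma> * y)))) \<le>
    sqrt ((2 - \<gamma> * x)\<^sup>2 * (x * y * ((2 - x) * (2 - y))))"
    by (intro real_sqrt_le_mono) (simp add: power2_eq_square mult_ac)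
  hence BA: "(2 - x) * B \<le> (2 - \<gamma> * x) * A"
    unfolding A_def B_def using assms gx by (simp add: real_sqrt_mult)
  have "(2 - x) * (r * B) \<le> (2 - \<gamma> * x) * (r * A)"
    using mult_left_mono[OF BA, of r] assms by (simp add: mult_ac)
  also have "\<dots> = (2 - x) * (r * A) + (1 - \<gamma>) * x * (r * A)" by (simp add: algebra_simps)
  also have "\<dots> \<le> (2 - x) * (r * A) + (1 - \<gamma>) * x * (y * (2 - x))"
    using rA assms by (intro add_left_mono mult_left_mono) auto
  also have "\<dots> = (2 - x) * (r * A + (1 - \<gamma>) * (x * y))" by (simp add: algebra_simps)
  finally have "r * B \<le> r * A + (1 - \<gamma>) * (x * y)" using assms by simp
  hence "\<gamma> / 4 * (r * B) \<le> \<gamma> / 4 * (r * A + (1 - \<gamma>) * (x * y))"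
    using assms by (intro mult_left_mono) auto
  also have "\<gamma> / 4 * (r * A + (1 - \<gamma>) * (x * y)) = (1 - \<gamma>) * (\<gamma> * (x * y) / 4) + \<gamma> * (r * A) / 4"
    by (simp add: field_simps)
  finally show ?thesis unfolding 1 by (simp add: mult_ac)
qed

lemma square_less_2:
  fixes b :: real assumes "- 1 < b" "b < 1" shows "b\<^sup>2 < 1"
  using assms by (simp add: abs_square_less_1 abs_less_iff)

text \<open>At correlation -1 the second variable is minus the first, so the event is empty once x <
  - y.\<close>

lemma Phi2_antithetic:
  assumes "Phi x + Phi y < 1"
  shows "Phi2 (- 1) (ereal x) (ereal y) = 0"
proof -
  have "Phi x < Phi (- y)" using assms by (simp add: Phi_minus del: Phi_less_iff)
  hence "x < - y" by simp
  hence "{(z1, z2 :: real). ereal z1 \<le> ereal x \<and> ereal (- 1 * z1 + sqrt (1 - (- 1)\<^sup>2) * z2) \<le> ereal y} = {}"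
    by auto
  thus ?thesis unfolding Phi2_def by (simp only: measure_empty)
qed

lemma product_eq_square_cases:
  fixes A p q :: real
  assumes "0 < A" "A \<le> p" "A \<le> q" "A * A = p * q"
  shows "p = A" "q = A"
proof -
  have "\<not> A < p"
  proof
    assume "A < p"
    hence "A * A < p * q" using assms by (intro mult_less_le_imp_less) auto
    thus False using assms by simp
  qed
  thus "p = A" using assms by simp
  thus "q = A" using assms by simp
qed

lemma h_nonneg_correlation:
  assumes g: "0 < \<gamma>" "\<gamma> < 1" and b: "- 1 < b1" "b1 < 1" "- 1 < b2" "b2 < 1"
    and w: "0 \<le> b12 - b1 * b2" and up: "b12 \<le> 1 - \<bar>b1 - b2\<bar>"
  shows "h \<gamma> b1 b2 b12 \<ge> 1 - \<gamma>"
proof -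
  define A where "A = sqrt ((1 - b1\<^sup>2) * (1 - b2\<^sup>2))"
  define r where "r = rho b1 b2 b12"
  have A: "A > 0" using b square_less_2 by (simp add: A_def)
  hence r: "r = (b12 - b1 * b2) / A" by (simp add: r_def rho_def A_def)
  hence rA: "r * A = b12 - b1 * b2" and r0: "0 \<le> r" using A w by auto
  \<comment> \<open>The upper triangle inequality for \<open>b12\<close>, rewritten for
    \<open>r * A\<close>; the two bounds multiply to \<open>A * A\<close>.\<close>
  have le: "r * A \<le> (1 - b1) * (1 + b2)" "r * A \<le> (1 + b1) * (1 - b2)"
    using up unfolding rA by (auto simp: algebra_simps abs_if split: if_splits)
  have A2: "A * A = ((1 - b1) * (1 + b2)) * ((1 + b1) * (1 - b2))"
    using b square_less_2[of b1] square_less_2[of b2] by (simp add: A_def) (simp add: power2_eq_square algebra_simps)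
  have "(r * A) * (r * A) \<le> A * A"
    unfolding A2 by (rule mult_mono) (use le r0 A b in auto)
  hence "r * A \<le> A" using A by (auto simp: power2_eq_square intro: power2_le_imp_le)
  hence r1: "r \<le> 1" using A by simp
  have heq: "h \<gamma> b1 b2 b12 = (1 - \<gamma>) * (1 + \<gamma> * ((1 + b1) * (1 + b2)) / 4) + \<gamma> * (r * A) / 4
    - (Phi2 r (ereal (thr \<gamma> b1)) (ereal (thr \<gamma> b2)) - Phi (thr \<gamma> b1) * Phi (thr \<gamma> b2))"
  proof -
    have wr: "b1 * b2 - b12 = - (r * A)" using rA by simp
    show ?thesis
      using h_eq[OF g b(1) less_imp_le[OF b(2)] b(3) less_imp_le[OF b(4)], of b12, folded r_def, unfolded wr]
      by simp
  qed
  show ?thesis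
  proof (cases "r = 1")
    \<comment> \<open>Correlation 1 lies outside the range of Plackett's identity. Both bounds are
      then attained, which forces \<open>b1 = b2\<close>, and \<open>Phi2\<close> being at most
      \<open>Phi\<close> suffices.\<close>
    case True
    have "(1 - b1) * (1 + b2) = A"
      and "(1 + b1) * (1 - b2) = A"
    proof -
      have p: "(1 - b1) * (1 + b2) > 0" "(1 + b1) * (1 - b2) > 0" using b by auto
      have "A \<le> (1 - b1) * (1 + b2)" "A \<le> (1 + b1) * (1 - b2)" using le True by auto
      thus "(1 - b1) * (1 + b2) = A" "(1 + b1) * (1 - b2) = A"
        using product_eq_square_cases[OF A _ _ A2] by auto
    qed
    note eq = this
    have b12: "b1 = b2"
    proof -
      have "(1 - b1) * (1 + b2) = (1 + b1) * (1 - b2)" using eq by simp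
      thus ?thesis by (simp add: algebra_simps)
    qed
    hence Ab: "A = (1 - b1) * (1 + b1)" using eq by simp
    have "Phi2 r (ereal (thr \<gamma> b1)) (ereal (thr \<gamma> b2)) \<le> \<gamma> * (1 + b1) / 2"
      using Phi2_le_Phi[of r "thr \<gamma> b1" "ereal (thr \<gamma> b2)"] g b by simp
    thus ?thesis unfolding heq True Ab using g b b12 by (simp add: algebra_simps power2_eq_square) (simp add: field_simps)
  next
    case False
    define \<theta> where "\<theta> = arcsin r"
    have th: "0 \<le> \<theta>" "\<theta> < pi / 2" "sin \<theta> = r"
      using r0 r1 False arcsin_less_arcsin[of r 1] arcsin_nonneg by (auto simp: \<theta>_def)
    have "Phi2 r (ereal (thr \<gamma> b1)) (ereal (thr \<gamma> b2)) - Phi (thr \<gamma> b1) * Phi (thr \<gamma> b2) \<le>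
      r * (sqrt (\<gamma> * (1 + b1) / 2 * (1 - \<gamma> * (1 + b1) / 2)) * sqrt (\<gamma> * (1 + b2) / 2 * (1 - \<gamma> * (1 + b2) / 2)))"
      using Phi2_nonneg_correlation_le[OF th(1,2), of "thr \<gamma> b1" "thr \<gamma> b2"] g b th by simp
    also have "\<dots> \<le> (1 - \<gamma>) * (\<gamma> * ((1 + b1) * (1 + b2)) / 4) + \<gamma> * (r * A) / 4"
    proof (cases "b2 \<le> b1")
      case True
      have "A = sqrt ((1 + b1) * (1 + b2) * ((2 - (1 + b1)) * (2 - (1 + b2))))"
        unfolding A_def by (rule arg_cong[where f = sqrt]) (simp add: power2_eq_square algebra_simps)
      thus ?thesis using positive_correlation_algebra[of "1 + b1" "1 + b2" \<gamma> r] b g r0 le True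
        by (simp add: mult_ac)
    next
      case False
      have "A = sqrt ((1 + b2) * (1 + b1) * ((2 - (1 + b2)) * (2 - (1 + b1))))"
        unfolding A_def by (rule arg_cong[where f = sqrt]) (simp add: power2_eq_square algebra_simps)
      thus ?thesis using positive_correlation_algebra[of "1 + b2" "1 + b1" \<gamma> r] b g r0 le False
        by (simp add: mult_ac)
    qed
    finally show ?thesis unfolding heq by (simp add: algebra_simps)
  qed
qed

text \<open>The second alternative is the negative, nondegenerate correlation on which the rest of
  the proof works. The boundary falls under the first: a bias of -1 makes a threshold minus
  infinity, and correlation -1 makes the joint probability 0.\<close>

lemma h_classify:
  assumes g: "0 < \<gamma>" "\<gamma> < 1" and feas: "feasible b1 b2 b12"
  obtains "h \<gamma> b1 b2 b12 \<ge> 1 - \<gamma>"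
  | "- 1 < b1" "b1 < 1" "- 1 < b2" "b2 < 1" "0 < b1 * b2 - b12"
    "b1 * b2 - b12 < sqrt ((1 - b1\<^sup>2) * (1 - b2\<^sup>2))"
    "b1 * b2 - b12 \<le> (1 + b1) * (1 + b2)" "b1 * b2 - b12 \<le> (1 - b1) * (1 - b2)"
proof -
  have F: "- 1 \<le> b1" "b1 \<le> 1" "- 1 \<le> b2" "b2 \<le> 1" "-1 + \<bar>b1 + b2\<bar> \<le> b12" "b12 \<le> 1 - \<bar>b1 - b2\<bar>"
    using feas by (auto simp: feasible_def)
  consider "b1 = -1 \<or> b2 = -1" | "- 1 < b1" "- 1 < b2" "b1 = 1 \<or> b2 = 1"
    | "- 1 < b1" "b1 < 1" "- 1 < b2" "b2 < 1" using F by linarith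
  thus ?thesis
  proof cases
    case 1
    have "3 - b1 - b2 - b12 = 4" using 1 F by (auto simp: abs_if split: if_splits)
    moreover have "Phi_inv (\<gamma> * (1 + b1) / 2) = - \<infinity> \<or> Phi_inv (\<gamma> * (1 + b2) / 2) = - \<infinity>"
      using 1 by (auto simp: Phi_inv_def)
    hence "Phi2 (rho b1 b2 b12) (Phi_inv (\<gamma> * (1 + b1) / 2)) (Phi_inv (\<gamma> * (1 + b2) / 2)) = 0"
      using Phi2_minus_infinity by metis
    ultimately have "h \<gamma> b1 b2 b12 = 1 - 0 - \<gamma> * (4 / 4)"
      unfolding h_def Value_def by (simp only:)
    thus ?thesis by (intro that(1)) simp
  next
    case 2
    \<comment> \<open>At a bias of 1 feasibility leaves only \<open>b12 = b1 * b2\<close>, and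
      \<open>rho\<close> takes its default value 0, which is independence.\<close>
    have "b12 = b1 * b2" "rho b1 b2 b12 = 0" using 2 F by (auto simp: abs_if rho_def split: if_splits)
    hence "h \<gamma> b1 b2 b12 = (1 - \<gamma>) * (1 + \<gamma> * ((1 + b1) * (1 + b2)) / 4)"
      using h_eq[OF g 2(1) F(2) 2(2) F(4), of b12] by (simp add: Phi2_0)
    moreover have "0 \<le> (1 - \<gamma>) * (\<gamma> * ((1 + b1) * (1 + b2)) / 4)" using g 2 by simp
    ultimately show ?thesis by (intro that(1)) (simp add: algebra_simps)
  next
    case 3
    define A where "A = sqrt ((1 - b1\<^sup>2) * (1 - b2\<^sup>2))"
    define w where "w = b1 * b2 - b12"
    have A: "A > 0" using 3 square_less_2 by (simp add: A_def)
    have A2: "A * A = ((1 + b1) * (1 + b2)) * ((1 - b1) * (1 - b2))"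
      using 3 square_less_2[of b1] square_less_2[of b2] by (simp add: A_def) (simp add: power2_eq_square algebra_simps)
    have le: "w \<le> (1 + b1) * (1 + b2)" "w \<le> (1 - b1) * (1 - b2)"
      using F(5) unfolding w_def by (auto simp: algebra_simps abs_if split: if_splits)
    show ?thesis
    proof (cases "0 < w")
      case True
      have "w * w \<le> A * A" unfolding A2 by (rule mult_mono) (use le True 3 in auto)
      hence "w \<le> A" using True A by (metis mult_strict_mono' not_le less_imp_le)
      show ?thesis
      proof (cases "w = A")
        case False
        thus ?thesis using that(2) 3 True le \<open>w \<le> A\<close> unfolding w_def A_def by auto
      next
        \<comment> \<open>Correlation -1: both bounds on \<open>w\<close> are attained, hence
          \<open>b1 + b2 = 0\<close> and \<open>b12 = - 1\<close>.\<close>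
        case wA: True
        have p: "(1 + b1) * (1 + b2) > 0" "(1 - b1) * (1 - b2) > 0" using 3 by auto
        have "(1 + b1) * (1 + b2) = A" "(1 - b1) * (1 - b2) = A"
          using product_eq_square_cases[OF A _ _ A2] le wA by auto
        hence s: "b1 + b2 = 0" and b12: "b12 = - 1"
          using wA by (auto simp: w_def algebra_simps)
        have "b12 - b1 * b2 = - A" using wA by (simp add: w_def)
        hence "rho b1 b2 b12 = - 1" using A unfolding rho_def A_def[symmetric] by simp
        moreover have "Phi2 (- 1) (ereal (thr \<gamma> b1)) (ereal (thr \<gamma> b2)) = 0"
        proof (rule Phi2_antithetic)
          have "b2 = - b1" using s by simp
          thus "Phi (thr \<gamma> b1) + Phi (thr \<gamma> b2) < 1"
            using g 3 by (simp add: algebra_simps diff_divide_distrib add_divide_distrib)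
        qed
        ultimately have "h \<gamma> b1 b2 b12 = 1 - \<gamma> * (3 - (b1 + b2) - b12) / 4"
          using h_eq[OF g, of b1 b2 b12] 3 g by (simp add: field_simps)
        thus ?thesis using s b12 by (intro that(1)) simp
      qed
    next
      case False
      thus ?thesis using that(1) h_nonneg_correlation[OF g 3, of b12] F by (simp add: w_def)
    qed
  qed
qed

lemma h_negative_correlation:
  assumes g: "0 < \<gamma>" "\<gamma> < 1" and b: "- 1 < b1" "b1 < 1" "- 1 < b2" "b2 < 1"
    and s: "0 \<le> s" "s < 1" "b1 * b2 - b12 = s * sqrt ((1 - b1\<^sup>2) * (1 - b2\<^sup>2))"
  shows "h \<gamma> b1 b2 b12 = (1 - \<gamma>) * (1 + \<gamma> * ((1 + b1) * (1 + b2)) / 4) - \<gamma> * (b1 * b2 - b12) / 4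
    + K ((thr \<gamma> b1 + thr \<gamma> b2) / 2) ((thr \<gamma> b1 - thr \<gamma> b2) / 2) (arcsin s)"
proof -
  define A where "A = sqrt ((1 - b1\<^sup>2) * (1 - b2\<^sup>2))"
  have "0 < A" using b square_less_2 by (simp add: A_def)
  moreover have "b12 - b1 * b2 = - s * A" using s by (simp add: A_def)
  ultimately have "rho b1 b2 b12 = - s" unfolding rho_def A_def[symmetric] by simp
  moreover have "0 \<le> arcsin s" "arcsin s < pi / 2" "sin (arcsin s) = s"
    using s arcsin_less_arcsin[of s 1] arcsin_nonneg by auto
  ultimately show ?thesis
    using h_eq[OF g, of b1 b2 b12] b Phi2_nonpos_correlation[of "arcsin s" "thr \<gamma> b1" "thr \<gamma> b2"] by simp
qed

section \<open>Taylor bounds and the hazard rate\<close>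

definition exp_Taylor :: "nat \<Rightarrow> real \<Rightarrow> real" where
  "exp_Taylor n x = (\<Sum>k<n. (- x) ^ k / fact k)"

text \<open>The Lagrange remainder after N terms has the sign of \<open>(- x) ^ N\<close>, hence the
  parity rule: an even number of terms bounds from below, an odd number from above.\<close>

lemma exp_Taylor_bounds:
  assumes "0 \<le> x"
  shows "exp_Taylor (2 * n) x \<le> exp (- x)" "exp (- x) \<le> exp_Taylor (2 * n + 1) x"
proof -
  have *: "\<exists>t. \<bar>t\<bar> \<le> \<bar>- x\<bar> \<and> exp (- x) = exp_Taylor N x + exp t / fact N * (- x) ^ N" for N
    using Maclaurin_exp_le[of "- x" N] by (simp add: exp_Taylor_def)
  from *[of "2 * n"] show "exp_Taylor (2 * n) x \<le> exp (- x)"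
    by (auto simp: power_mult)
  from *[of "2 * n + 1"] assms show "exp (- x) \<le> exp_Taylor (2 * n + 1) x"
    by (auto simp: power_mult mult_nonneg_nonneg)
qed

text \<open>Antiderivative of \<open>exp_Taylor n (x\<^sup>2 / 2)\<close> vanishing at 0; times
  \<open>inv_sqrt_2pi\<close> it approximates \<open>Phi x - 1 / 2\<close>, with the same parity
  rule.\<close>

definition Phi_Taylor :: "nat \<Rightarrow> real \<Rightarrow> real" where
  "Phi_Taylor n x = (\<Sum>k<n. (- 1) ^ k * x ^ (2 * k + 1) / (2 ^ k * fact k * (2 * real k + 1)))"

lemma DERIV_Phi_Taylor: "(Phi_Taylor n has_real_derivative exp_Taylor n (x\<^sup>2 / 2)) (at x)"
proof -
  have "((\<lambda>x. (- 1) ^ k * x ^ (2 * k + 1) / (2 ^ k * fact k * (2 * real k + 1)))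
    has_real_derivative (- (x\<^sup>2 / 2)) ^ k / fact k) (at x)" for k
  proof -
    define d where "d = 2 * real k + 1"
    have nz: "d \<noteq> 0" unfolding d_def by linarith
    have "(- (x\<^sup>2 / 2)) ^ k = (- 1) ^ k * x ^ (2 * k) / 2 ^ k"
      by (subst power_minus) (simp add: power_divide power_mult)
    moreover have "((\<lambda>x. (- 1) ^ k / (2 ^ k * fact k * d) * x ^ (2 * k + 1))
      has_real_derivative (- 1) ^ k / (2 ^ k * fact k * d) * (d * x ^ (2 * k))) (at x)"
    proof (rule DERIV_cong[OF DERIV_cmult[OF DERIV_pow]])
      have "real (2 * k + 1) = d" by (simp add: d_def)
      thus "(- 1) ^ k / (2 ^ k * fact k * d) * (real (2 * k + 1) * x ^ (2 * k + 1 - Suc 0)) =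
        (- 1) ^ k / (2 ^ k * fact k * d) * (d * x ^ (2 * k))"
        by (simp only: One_nat_def[symmetric] add_diff_cancel_right')
    qed
    moreover have "(- 1) ^ k / (2 ^ k * fact k * d) * (d * x ^ (2 * k)) = (- 1) ^ k * x ^ (2 * k) / 2 ^ k / fact k"
      using nz by simp
    ultimately show ?thesis unfolding d_def by simp
  qed
  thus ?thesis unfolding Phi_Taylor_def exp_Taylor_def by (intro DERIV_sum) auto
qed

definition inv_sqrt_2pi :: real where "inv_sqrt_2pi = 1 / sqrt (2 * pi)"

lemma inv_sqrt_2pi_pos [simp]: "inv_sqrt_2pi > 0"
  by (simp add: inv_sqrt_2pi_def)

lemma inv_sqrt_2pi_nonneg [simp]: "inv_sqrt_2pi \<ge> 0" and inv_sqrt_2pi_nonzero [simp]: "inv_sqrt_2pi \<noteq> 0"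
  by (simp_all add: inv_sqrt_2pi_def)

lemma std_normal_density_eq: "\<phi> x = inv_sqrt_2pi * exp (- (x\<^sup>2 / 2))"
  by (simp add: std_normal_density_def inv_sqrt_2pi_def)

lemma inv_sqrt_2pi_bounds: "0.3989422804 \<le> inv_sqrt_2pi" "inv_sqrt_2pi \<le> 0.3989422805"
proof -
  have sq: "inv_sqrt_2pi\<^sup>2 = 1 / (2 * pi)" by (simp add: power_divide inv_sqrt_2pi_def)
  have "0.3989422804\<^sup>2 \<le> inv_sqrt_2pi\<^sup>2" "inv_sqrt_2pi\<^sup>2 \<le> 0.3989422805\<^sup>2"
    unfolding sq using pi_approx by (simp_all add: divide_simps power2_eq_square)
  thus "0.3989422804 \<le> inv_sqrt_2pi" "inv_sqrt_2pi \<le> 0.3989422805"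
    using inv_sqrt_2pi_pos by (auto intro: power2_le_imp_le simp del: inv_sqrt_2pi_pos)
qed

lemma inv_sqrt_2pi_ge: "0.39894228 \<le> inv_sqrt_2pi"
  using inv_sqrt_2pi_bounds(1) by simp

lemma inv_sqrt_2pi_le: "inv_sqrt_2pi \<le> 0.39894229"
  using inv_sqrt_2pi_bounds(2) by simp

lemma Phi_minus_half_mono:
  assumes "0 \<le> x" and f: "\<And>u. (f has_real_derivative f' u) (at u)"
    and f': "\<And>u. 0 \<le> u \<Longrightarrow> u \<le> x \<Longrightarrow> f' u \<le> exp (- (u\<^sup>2 / 2))"
  shows "f x - f 0 \<le> (Phi x - 1 / 2) / inv_sqrt_2pi"
proof -
  have "Phi 0 / inv_sqrt_2pi - f 0 \<le> Phi x / inv_sqrt_2pi - f x"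
  proof (rule DERIV_nonneg_imp_nondecreasing[OF assms(1)])
    fix u assume "0 \<le> u" "u \<le> x"
    thus "\<exists>y. ((\<lambda>u. Phi u / inv_sqrt_2pi - f u) has_real_derivative y) (at u) \<and> 0 \<le> y"
      using f' by (intro exI[of _ "\<phi> u / inv_sqrt_2pi - f' u"])
        (auto intro!: derivative_eq_intros f simp: std_normal_density_eq)
  qed
  moreover have "(Phi x - 1 / 2) / inv_sqrt_2pi = Phi x / inv_sqrt_2pi - Phi 0 / inv_sqrt_2pi"
    by (simp only: diff_divide_distrib Phi_0)
  ultimately show ?thesis by linarith
qed

lemma Phi_bounds_Taylor:
  assumes "0 \<le> x"
  shows "1 / 2 + inv_sqrt_2pi * Phi_Taylor (2 * n) x \<le> Phi x"
    "Phi x \<le> 1 / 2 + inv_sqrt_2pi * Phi_Taylor (2 * n + 1) x"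
proof -
  have T0: "Phi_Taylor n 0 = 0" for n by (simp add: Phi_Taylor_def)
  have "Phi_Taylor (2 * n) x - Phi_Taylor (2 * n) 0 \<le> (Phi x - 1 / 2) / inv_sqrt_2pi"
    by (rule Phi_minus_half_mono[OF assms DERIV_Phi_Taylor]) (rule exp_Taylor_bounds, simp)
  thus "1 / 2 + inv_sqrt_2pi * Phi_Taylor (2 * n) x \<le> Phi x"
    by (simp add: T0 pos_le_divide_eq mult.commute)
  have "Phi x / inv_sqrt_2pi - Phi_Taylor (2 * n + 1) x \<le> Phi 0 / inv_sqrt_2pi - Phi_Taylor (2 * n + 1) 0"
  proof (rule DERIV_nonpos_imp_nonincreasing[OF assms])
    fix u assume "0 \<le> u" "u \<le> x"
    thus "\<exists>y. ((\<lambda>u. Phi u / inv_sqrt_2pi - Phi_Taylor (2 * n + 1) u) has_real_derivative y) (at u) \<and> y \<le> 0"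
      using exp_Taylor_bounds(2)[of "u\<^sup>2 / 2" n]
      by (intro exI[of _ "\<phi> u / inv_sqrt_2pi - exp_Taylor (2 * n + 1) (u\<^sup>2 / 2)"])
        (auto intro!: derivative_eq_intros DERIV_Phi_Taylor simp: std_normal_density_eq)
  qed
  moreover have "(Phi x - 1 / 2) / inv_sqrt_2pi = Phi x / inv_sqrt_2pi - Phi 0 / inv_sqrt_2pi"
    by (simp only: diff_divide_distrib Phi_0)
  ultimately have "(Phi x - 1 / 2) / inv_sqrt_2pi \<le> Phi_Taylor (2 * n + 1) x"
    unfolding T0 by linarith
  thus "Phi x \<le> 1 / 2 + inv_sqrt_2pi * Phi_Taylor (2 * n + 1) x"
    by (simp add: pos_divide_le_eq mult.commute)
qed

text \<open>A rational \<open>c\<close> replaces the irrational prefactor, so that each use is left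
  with inequalities between rational numbers.\<close>

lemma Phi_ge_Taylor:
  assumes "0 \<le> x" "0 \<le> Phi_Taylor (2 * n) x" "c \<le> inv_sqrt_2pi" "l \<le> 1 / 2 + c * Phi_Taylor (2 * n) x"
  shows "l \<le> Phi x"
  using Phi_bounds_Taylor(1)[OF assms(1), of n] mult_right_mono[OF assms(3,2)] assms(4) by linarith

lemma Phi_le_Taylor:
  assumes "0 \<le> x" "0 \<le> Phi_Taylor (2 * n + 1) x" "inv_sqrt_2pi \<le> c" "1 / 2 + c * Phi_Taylor (2 * n + 1) x \<le> u"
  shows "Phi x \<le> u"
  using Phi_bounds_Taylor(2)[OF assms(1), of n] mult_right_mono[OF assms(3,2)] assms(4) by linarith

lemma std_normal_density_ge_Taylor:
  assumes "0 \<le> exp_Taylor (2 * n) (x\<^sup>2 / 2)" "c \<le> inv_sqrt_2pi" "l \<le> c * exp_Taylor (2 * n) (x\<^sup>2 / 2)"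
  shows "l \<le> \<phi> x"
proof -
  have "l \<le> inv_sqrt_2pi * exp_Taylor (2 * n) (x\<^sup>2 / 2)"
    using mult_right_mono[OF assms(2,1)] assms(3) by linarith
  also have "\<dots> \<le> inv_sqrt_2pi * exp (- (x\<^sup>2 / 2))"
    by (intro mult_left_mono exp_Taylor_bounds) auto
  finally show ?thesis by (simp add: std_normal_density_eq)
qed

section \<open>The logarithmic derivative of \<open>Phi\<close> (the inverse Mills ratio at
  \<open>- t\<close>)\<close>

definition hazard :: "real \<Rightarrow> real" where
  "hazard t = \<phi> t / Phi t"

text \<open>Minus the derivative of \<open>hazard\<close>. Its monotonicity and its bounds 0 and 1
  control all second differences of the logarithm of \<open>Phi\<close>.\<close>

definition hazard_slope :: "real \<Rightarrow> real" where
  "hazard_slope t = hazard t * (t + hazard t)"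

lemma hazard_pos: "hazard t > 0"
  by (simp add: hazard_def)

lemma DERIV_hazard: "(hazard has_real_derivative - hazard_slope t) (at t)"
proof -
  have "((\<lambda>t. \<phi> t / Phi t) has_real_derivative (- t * \<phi> t * Phi t - \<phi> t * \<phi> t) / (Phi t * Phi t)) (at t)"
    by (rule DERIV_divide[OF DERIV_std_normal_density DERIV_Phi]) (use Phi_pos[of t] in linarith)
  moreover have "(- t * \<phi> t * Phi t - \<phi> t * \<phi> t) / (Phi t * Phi t) = - hazard_slope t"
    using Phi_pos[of t] by (simp add: hazard_slope_def hazard_def field_simps del: Phi_pos)
  ultimately show ?thesis unfolding hazard_def[abs_def] by simp
qed

lemmas DERIV_hazard_compose [derivative_intros] = DERIV_chain2[OF DERIV_hazard]

lemma mono_limit_at_bot_nonneg: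
  fixes f :: "real \<Rightarrow> real"
  assumes "\<And>u. u \<le> x \<Longrightarrow> (f has_real_derivative f' u) (at u)" "\<And>u. u \<le> x \<Longrightarrow> 0 \<le> f' u"
    and "(f \<longlongrightarrow> 0) at_bot"
  shows "0 \<le> f x"
proof (rule tendsto_upperbound[OF assms(3)])
  show "\<forall>\<^sub>F u in at_bot. f u \<le> f x"
    using eventually_le_at_bot[of x]
  proof eventually_elim
    case (elim u)
    thus ?case by (rule DERIV_nonneg_imp_nondecreasing) (use assms in blast)
  qed
qed simp

text \<open>Birnbaum's lower bound for Mills' ratio.\<close>
lemma hazard_upper: "hazard t * (t + sqrt (t\<^sup>2 + 4)) \<le> 2"
proof -
  define S where "S = (\<lambda>t::real. sqrt (t\<^sup>2 + 4))"
  \<comment> \<open>The positive root of \<open>r\<^sup>2 = 1 + t * r\<close>. The claim amounts to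
    \<open>\<phi> t * r t \<le> Phi t\<close>; both sides vanish at minus infinity, so comparing
    derivatives suffices.\<close>
  define r where "r = (\<lambda>t. (t + S t) / 2)"
  have S: "S t > 0" "S t * S t = t\<^sup>2 + 4" "S t > \<bar>t\<bar>" for t
    by (auto simp: S_def real_less_rsqrt add_pos_pos intro!: add_nonneg_pos)
  have r: "r t > 0" "r t * r t = 1 + t * r t" for t
    using S[of t] by (auto simp: r_def field_simps power2_eq_square)
  have dS: "(S has_real_derivative t / S t) (at t)" for t
  proof -
    have "t\<^sup>2 + 4 > 0" by (simp add: add_nonneg_pos)
    thus ?thesis unfolding S_def by (auto intro!: derivative_eq_intros simp: field_simps)
  qed
  have dr: "(r has_real_derivative r t / S t) (at t)" for t
    unfolding r_def using S[of t] by (auto intro!: derivative_eq_intros dS simp: field_simps)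
  have "0 \<le> Phi t - \<phi> t * r t"
  proof (rule mono_limit_at_bot_nonneg[where f = "\<lambda>t. Phi t - \<phi> t * r t"])
    fix u
    show "((\<lambda>t. Phi t - \<phi> t * r t) has_real_derivative \<phi> u * (r u * r u - r u / S u)) (at u)"
      by (rule DERIV_cong[OF DERIV_diff[OF DERIV_Phi DERIV_mult[OF DERIV_std_normal_density dr]]])
         (simp add: r(2) algebra_simps)
    have "S u = 2 * r u - u" by (simp add: r_def field_simps)
    hence "S u * r u = 2 * (r u * r u) - u * r u"
      by (simp only: left_diff_distrib mult.assoc)
    hence "S u * r u \<ge> 1" using r(2)[of u] zero_le_square[of "r u"] by linarith
    hence "r u / S u \<le> r u * r u"
      using S[of u] r(1)[of u] by (simp add: field_simps) 
    thus "0 \<le> \<phi> u * (r u * r u - r u / S u)" by simp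
  next
    have "((\<lambda>t. Phi t - \<phi> t * r t) \<longlongrightarrow> 0 - 0) at_bot"
    proof (intro tendsto_diff Phi_at_bot Lim_null_comparison[OF _ tendsto_std_normal_density_at_bot])
      show "\<forall>\<^sub>F t in at_bot. norm (\<phi> t * r t) \<le> \<phi> t"
        using eventually_le_at_bot[of 0]
      proof eventually_elim
        case (elim t)
        have "S t \<le> 2 - t" unfolding S_def using elim by (intro real_le_lsqrt) (auto simp: power2_eq_square algebra_simps)
        thus ?case using r(1)[of t] by (auto simp: r_def abs_mult intro!: mult_left_le)
      qed
    qed
    thus "((\<lambda>t. Phi t - \<phi> t * r t) \<longlongrightarrow> 0) at_bot" by simp
  qed
  thus ?thesis by (simp add: hazard_def r_def S_def field_simps)
qed

text \<open>Sampford's upper bound for Mills' ratio, which amounts to the convexity of the hazard rate.\<close>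
lemma hazard_lower:
  assumes "t < 1"
  shows "sqrt (t\<^sup>2 + 8) - 3 * t \<le> 4 * hazard t"
proof -
  define S where "S = (\<lambda>t::real. sqrt (t\<^sup>2 + 8))"
  define R where "R = (\<lambda>t. 4 / (S t - 3 * t))"
  have S: "S t > 0" "S t * S t = t\<^sup>2 + 8" for t
    by (auto simp: S_def add_nonneg_pos)
  have S3: "S t - 3 * t > 0" if "t < 1" for t
  proof -
    have "3 * t < S t"
    proof (cases "t \<le> 0")
      case False
      hence "t\<^sup>2 < 1" using that by (simp add: abs_square_less_1)
      thus ?thesis unfolding S_def by (intro real_less_rsqrt) (simp add: power_mult_distrib)
    qed (use S(1)[of t] in linarith)
    thus ?thesis by simp
  qed
  have dS: "(S has_real_derivative t / S t) (at t)" for t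
  proof -
    have "t\<^sup>2 + 8 > 0" by (simp add: add_nonneg_pos)
    thus ?thesis unfolding S_def by (auto intro!: derivative_eq_intros simp: field_simps)
  qed
  have dR: "(R has_real_derivative 4 * (3 * S t - t) / (S t * (S t - 3 * t)\<^sup>2)) (at t)" if "t < 1" for t
    unfolding R_def using S(1)[of t] S3[OF that]
    by (auto intro!: derivative_eq_intros dS simp: divide_simps power2_eq_square)
  have "0 \<le> \<phi> t * R t - Phi t"
  proof (rule mono_limit_at_bot_nonneg[where f = "\<lambda>t. \<phi> t * R t - Phi t"])
    fix u assume "u \<le> t"
    hence u: "u < 1" using assms by simp
    note S3 = S3[OF u]
    let ?D = "4 * (3 * S u - u) / (S u * (S u - 3 * u)\<^sup>2) - u * R u - 1"
    show "((\<lambda>t. \<phi> t * R t - Phi t) has_real_derivative \<phi> u * ?D) (at u)"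
      by (rule DERIV_cong[OF DERIV_diff[OF DERIV_mult[OF DERIV_std_normal_density dR[OF u]] DERIV_Phi]])
         (simp add: algebra_simps)
    \<comment> \<open>The sign of the derivative reduces to this inequality, whose two sides have
      squares differing by exactly 32.\<close>
    have "\<bar>u\<bar> * (u\<^sup>2 + 6) \<le> (2 + u\<^sup>2) * S u"
    proof (rule power2_le_imp_le)
      have "(\<bar>u\<bar> * (u\<^sup>2 + 6))\<^sup>2 = u\<^sup>2 * (u\<^sup>2 + 6)\<^sup>2" by (simp add: power_mult_distrib)
      also have "\<dots> \<le> (2 + u\<^sup>2)\<^sup>2 * (u\<^sup>2 + 8)" by (simp add: power2_eq_square algebra_simps)
      also have "\<dots> = ((2 + u\<^sup>2) * S u)\<^sup>2" by (simp add: power_mult_distrib power2_eq_square[of "S u"] S(2))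
      finally show "(\<bar>u\<bar> * (u\<^sup>2 + 6))\<^sup>2 \<le> ((2 + u\<^sup>2) * S u)\<^sup>2" .
    qed (use S(1)[of u] in simp)
    from this have "\<bar>u\<bar> * (u\<^sup>2 + 6) + (- \<bar>u\<bar>) * (u\<^sup>2 + 6) \<le> (2 + u\<^sup>2) * S u + u * (u\<^sup>2 + 6)"
      by (rule add_mono) (rule mult_right_mono, auto)
    hence key: "0 \<le> 2 * ((2 + u\<^sup>2) * S u + u * (u\<^sup>2 + 6))" by simp
    have "?D * (S u * (S u - 3 * u)\<^sup>2) = 4 * (3 * S u - u) - 4 * u * S u * (S u - 3 * u) - S u * (S u - 3 * u)\<^sup>2"
    proof -
      have "(4 * (3 * S u - u) / (S u * E\<^sup>2) - u * (4 / E) - 1) * (S u * E\<^sup>2) =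
        4 * (3 * S u - u) - 4 * u * S u * E - S u * E\<^sup>2" if "E > 0" for E
      proof -
        have "4 * (3 * S u - u) / (S u * E\<^sup>2) * (S u * E\<^sup>2) = 4 * (3 * S u - u)"
          using S(1)[of u] that by simp
        moreover have "u * (4 / E) * (S u * E\<^sup>2) = 4 * u * S u * E"
          using that by (simp add: power2_eq_square)
        ultimately show ?thesis by (simp only: left_diff_distrib mult_1)
      qed
      from this[OF S3] show ?thesis by (simp add: R_def)
    qed
    also have "\<dots> = 4 * (3 * S u - u) - S u * (S u * S u) + 2 * u * (S u * S u) + 3 * u\<^sup>2 * S u"
      by (simp add: power2_eq_square algebra_simps)
    also have "\<dots> = 2 * ((2 + u\<^sup>2) * S u + u * (u\<^sup>2 + 6))"
      unfolding S(2) by (simp add: power2_eq_square algebra_simps)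
    finally have "0 \<le> ?D * (S u * (S u - 3 * u)\<^sup>2)" using key by simp
    moreover have "S u * (S u - 3 * u)\<^sup>2 > 0" using S(1)[of u] S3 by simp
    ultimately have "0 \<le> ?D" by (simp add: zero_le_mult_iff)
    thus "0 \<le> \<phi> u * ?D" by simp
  next
    have "((\<lambda>t. \<phi> t * R t - Phi t) \<longlongrightarrow> 0 - 0) at_bot"
    proof (rule tendsto_diff[OF Lim_null_comparison[where g = "\<lambda>t. 4 * \<phi> t"] Phi_at_bot])
      show "\<forall>\<^sub>F t in at_bot. norm (\<phi> t * R t) \<le> 4 * \<phi> t"
        using eventually_le_at_bot[of 0]
      proof eventually_elim
        case (elim t)
        have "1 \<le> S t" unfolding S_def by (intro real_le_rsqrt) simp
        hence "1 \<le> S t - 3 * t" using elim by simp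
        hence "R t \<le> 4" "0 \<le> R t" by (auto simp: R_def divide_simps)
        thus ?case by (simp add: abs_mult mult.commute mult_right_mono)
      qed
      show "((\<lambda>t. 4 * \<phi> t) \<longlongrightarrow> 0) at_bot"
        using tendsto_mult_right_zero[OF tendsto_std_normal_density_at_bot] by simp
    qed
    thus "((\<lambda>t. \<phi> t * R t - Phi t) \<longlongrightarrow> 0) at_bot" by simp
  qed
  hence "Phi t \<le> 4 * \<phi> t / (S t - 3 * t)" by (simp add: R_def mult.commute)
  hence "(S t - 3 * t) * Phi t \<le> 4 * \<phi> t" using S3[OF assms] by (simp add: pos_le_divide_eq mult.commute)
  hence "S t - 3 * t \<le> 4 * \<phi> t / Phi t" by (simp add: pos_le_divide_eq)
  thus ?thesis by (simp add: hazard_def S_def)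
qed

text \<open>Convexity of the hazard rate. The derivative of \<open>hazard_slope\<close> is
  \<open>hazard t * (1 - (t + hazard t) * (t + 2 * hazard t))\<close>, and Sampford's bound,
  squared, says exactly that the inner product is at least 1 for t < 1.\<close>

lemma hazard_slope_antimono: "x \<le> y \<Longrightarrow> hazard_slope y \<le> hazard_slope x"
proof (rule DERIV_nonpos_imp_nonincreasing[where f = hazard_slope])
  fix t
  have "1 \<le> (t + hazard t) * (t + 2 * hazard t)"
  proof (cases "t < 1")
    case True
    define S where "S = sqrt (t\<^sup>2 + 8)"
    have S: "S \<ge> 0" "S\<^sup>2 = t\<^sup>2 + 8" by (auto simp: S_def)
    have "S \<le> 4 * hazard t + 3 * t" using hazard_lower[OF True] by (simp add: S_def)
    hence "S\<^sup>2 \<le> (4 * hazard t + 3 * t)\<^sup>2" using S by (intro power_mono)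
    thus ?thesis unfolding S(2) by (simp add: power2_eq_square algebra_simps)
  next
    case False
    hence "1 * 1 \<le> (t + hazard t) * (t + 2 * hazard t)"
      using hazard_pos[of t] by (intro mult_mono) auto
    thus ?thesis by simp
  qed
  hence "hazard t * (1 - (t + hazard t) * (t + 2 * hazard t)) \<le> 0"
    using hazard_pos[of t] by (simp add: mult_nonneg_nonpos)
  moreover have "(hazard_slope has_real_derivative hazard t * (1 - (t + hazard t) * (t + 2 * hazard t))) (at t)"
    unfolding hazard_slope_def[abs_def]
    by (rule DERIV_cong[OF DERIV_mult[OF DERIV_hazard DERIV_add[OF DERIV_ident DERIV_hazard]]])
       (simp add: hazard_slope_def algebra_simps)
  ultimately show "\<exists>y. (hazard_slope has_real_derivative y) (at t) \<and> y \<le> 0" by blast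
qed

text \<open>Birnbaum's bound puts \<open>hazard t\<close> below the positive root of
  \<open>x * (t + x) = 1\<close>.\<close>

lemma hazard_slope_le_1: "hazard_slope t \<le> 1"
proof -
  define S where "S = sqrt (t\<^sup>2 + 4)"
  have S: "S > \<bar>t\<bar>" "(S + t) * (S - t) = 4"
    by (auto simp: S_def real_less_rsqrt algebra_simps power2_eq_square add_nonneg_pos)
  have u: "hazard t * (t + S) \<le> 2" using hazard_upper[of t] by (simp add: S_def)
  hence "hazard t * (t + S) \<le> (S - t) / 2 * (t + S)" using S(2) by (simp add: algebra_simps)
  hence "hazard t \<le> (S - t) / 2" by (rule mult_right_le_imp_le) (use S(1) in linarith)
  hence "hazard t * (t + hazard t) \<le> hazard t * ((t + S) / 2)"
    using hazard_pos[of t] by (intro mult_left_mono) auto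
  thus ?thesis using u by (simp add: hazard_slope_def)
qed

section \<open>Numerical table for the hazard slope\<close>

lemma hazard_slope_ge:
  assumes "0 < x" "0 < f" "f \<le> \<phi> x" "Phi x \<le> hi" "lo \<le> Phi x" "hi < 1" "x \<le> f / (1 - lo)"
  shows "f / hi * (x + f / hi) \<le> hazard_slope x"
    "f / (1 - lo) * (f / (1 - lo) - x) \<le> hazard_slope (- x)"
proof -
  have hi: "0 < hi" "lo < 1" using assms Phi_pos[of x] by linarith+
  have 1: "f / hi \<le> hazard x"
    unfolding hazard_def using assms hi by (intro frac_le) auto
  have 2: "f / (1 - lo) \<le> hazard (- x)"
    unfolding hazard_def using assms hi by (intro frac_le) (auto simp: Phi_minus)
  show "f / hi * (x + f / hi) \<le> hazard_slope x"
    unfolding hazard_slope_def using 1 assms hi less_imp_le[OF hazard_pos[of x]] by (intro mult_mono add_mono) auto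
  show "f / (1 - lo) * (f / (1 - lo) - x) \<le> hazard_slope (- x)"
    unfolding hazard_slope_def using 2 assms hi less_imp_le[OF hazard_pos[of "- x"]] by (intro mult_mono) auto
qed

text \<open>First entry of a table at grid points; between grid points monotonicity takes over
  (\<open>hazard_excess_increment\<close>).\<close>

lemma hazard_slope_0_3: "0.5660 \<le> hazard_slope (0.3)" "0.6968 \<le> hazard_slope (- 0.3)"
proof -
  have "0.61791 \<le> Phi 0.3"
    by (rule Phi_ge_Taylor[where n = 2 and c = "0.39894228", OF _ _ inv_sqrt_2pi_ge])
       (simp_all add: Phi_Taylor_def lessThan_nat_numeral fact_numeral power_divide)
  moreover have "Phi 0.3 \<le> 0.61792"
    by (rule Phi_le_Taylor[where n = 2 and c = "0.39894229", OF _ _ inv_sqrt_2pi_le])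
       (simp_all add: Phi_Taylor_def lessThan_nat_numeral fact_numeral power_divide)
  moreover have "0.38138 \<le> \<phi> 0.3"
    by (rule std_normal_density_ge_Taylor[where n = 2 and c = "0.39894228", OF _ inv_sqrt_2pi_ge])
       (simp_all add: exp_Taylor_def lessThan_nat_numeral fact_numeral power_divide)
  ultimately show "0.5660 \<le> hazard_slope (0.3)" "0.6968 \<le> hazard_slope (- 0.3)"
    using hazard_slope_ge[of "0.3" "0.38138" "0.61792" "0.61791"] by simp_all
qed

lemma hazard_slope_0_6: "0.4862 \<le> hazard_slope (0.6)" "0.7471 \<le> hazard_slope (- 0.6)"
proof -
  have "0.72574 \<le> Phi 0.6"
    by (rule Phi_ge_Taylor[where n = 2 and c = "0.39894228", OF _ _ inv_sqrt_2pi_ge])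
       (simp_all add: Phi_Taylor_def lessThan_nat_numeral fact_numeral power_divide)
  moreover have "Phi 0.6 \<le> 0.72575"
    by (rule Phi_le_Taylor[where n = 2 and c = "0.39894229", OF _ _ inv_sqrt_2pi_le])
       (simp_all add: Phi_Taylor_def lessThan_nat_numeral fact_numeral power_divide)
  moreover have "0.33322 \<le> \<phi> 0.6"
    by (rule std_normal_density_ge_Taylor[where n = 3 and c = "0.39894228", OF _ inv_sqrt_2pi_ge])
       (simp_all add: exp_Taylor_def lessThan_nat_numeral fact_numeral power_divide)
  ultimately show "0.4862 \<le> hazard_slope (0.6)" "0.7471 \<le> hazard_slope (- 0.6)"
    using hazard_slope_ge[of "0.6" "0.33322" "0.72575" "0.72574"] by simp_all
qed

lemma hazard_slope_0_8: "0.4291 \<le> hazard_slope (0.8)" "0.7757 \<le> hazard_slope (- 0.8)"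
proof -
  have "0.78814 \<le> Phi 0.8"
    by (rule Phi_ge_Taylor[where n = 3 and c = "0.39894228", OF _ _ inv_sqrt_2pi_ge])
       (simp_all add: Phi_Taylor_def lessThan_nat_numeral fact_numeral power_divide)
  moreover have "Phi 0.8 \<le> 0.78815"
    by (rule Phi_le_Taylor[where n = 3 and c = "0.39894229", OF _ _ inv_sqrt_2pi_le])
       (simp_all add: Phi_Taylor_def lessThan_nat_numeral fact_numeral power_divide)
  moreover have "0.28969 \<le> \<phi> 0.8"
    by (rule std_normal_density_ge_Taylor[where n = 3 and c = "0.39894228", OF _ inv_sqrt_2pi_ge])
       (simp_all add: exp_Taylor_def lessThan_nat_numeral fact_numeral power_divide)
  ultimately show "0.4291 \<le> hazard_slope (0.8)" "0.7757 \<le> hazard_slope (- 0.8)"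
    using hazard_slope_ge[of "0.8" "0.28969" "0.78815" "0.78814"] by simp_all
qed

lemma hazard_slope_0_95: "0.3850 \<le> hazard_slope (0.95)" "0.7947 \<le> hazard_slope (- 0.95)"
proof -
  have "0.82894 \<le> Phi 0.95"
    by (rule Phi_ge_Taylor[where n = 3 and c = "0.39894228", OF _ _ inv_sqrt_2pi_ge])
       (simp_all add: Phi_Taylor_def lessThan_nat_numeral fact_numeral power_divide)
  moreover have "Phi 0.95 \<le> 0.82895"
    by (rule Phi_le_Taylor[where n = 3 and c = "0.39894229", OF _ _ inv_sqrt_2pi_le])
       (simp_all add: Phi_Taylor_def lessThan_nat_numeral fact_numeral power_divide)
  moreover have "0.25405 \<le> \<phi> 0.95"
    by (rule std_normal_density_ge_Taylor[where n = 3 and c = "0.39894228", OF _ inv_sqrt_2pi_ge])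
       (simp_all add: exp_Taylor_def lessThan_nat_numeral fact_numeral power_divide)
  ultimately show "0.3850 \<le> hazard_slope (0.95)" "0.7947 \<le> hazard_slope (- 0.95)"
    using hazard_slope_ge[of "0.95" "0.25405" "0.82895" "0.82894"] by simp_all
qed

lemma hazard_slope_1_05: "0.3555 \<le> hazard_slope (1.05)" "0.8065 \<le> hazard_slope (- 1.05)"
proof -
  have "0.85314 \<le> Phi 1.05"
    by (rule Phi_ge_Taylor[where n = 4 and c = "0.39894228", OF _ _ inv_sqrt_2pi_ge])
       (simp_all add: Phi_Taylor_def lessThan_nat_numeral fact_numeral power_divide)
  moreover have "Phi 1.05 \<le> 0.85315"
    by (rule Phi_le_Taylor[where n = 4 and c = "0.39894229", OF _ _ inv_sqrt_2pi_le])
       (simp_all add: Phi_Taylor_def lessThan_nat_numeral fact_numeral power_divide)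
  moreover have "0.22988 \<le> \<phi> 1.05"
    by (rule std_normal_density_ge_Taylor[where n = 4 and c = "0.39894228", OF _ inv_sqrt_2pi_ge])
       (simp_all add: exp_Taylor_def lessThan_nat_numeral fact_numeral power_divide)
  ultimately show "0.3555 \<le> hazard_slope (1.05)" "0.8065 \<le> hazard_slope (- 1.05)"
    using hazard_slope_ge[of "1.05" "0.22988" "0.85315" "0.85314"] by simp_all
qed

lemma hazard_slope_1_1: "0.3407 \<le> hazard_slope (1.1)" "0.8120 \<le> hazard_slope (- 1.1)"
proof -
  have "0.86433 \<le> Phi 1.1"
    by (rule Phi_ge_Taylor[where n = 3 and c = "0.39894228", OF _ _ inv_sqrt_2pi_ge])
       (simp_all add: Phi_Taylor_def lessThan_nat_numeral fact_numeral power_divide)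
  moreover have "Phi 1.1 \<le> 0.86434"
    by (rule Phi_le_Taylor[where n = 3 and c = "0.39894229", OF _ _ inv_sqrt_2pi_le])
       (simp_all add: Phi_Taylor_def lessThan_nat_numeral fact_numeral power_divide)
  moreover have "0.21785 \<le> \<phi> 1.1"
    by (rule std_normal_density_ge_Taylor[where n = 4 and c = "0.39894228", OF _ inv_sqrt_2pi_ge])
       (simp_all add: exp_Taylor_def lessThan_nat_numeral fact_numeral power_divide)
  ultimately show "0.3407 \<le> hazard_slope (1.1)" "0.8120 \<le> hazard_slope (- 1.1)"
    using hazard_slope_ge[of "1.1" "0.21785" "0.86434" "0.86433"] by simp_all
qed

lemma hazard_slope_1_2: "0.3114 \<le> hazard_slope (1.2)" "0.8226 \<le> hazard_slope (- 1.2)"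
proof -
  have "0.88493 \<le> Phi 1.2"
    by (rule Phi_ge_Taylor[where n = 4 and c = "0.39894228", OF _ _ inv_sqrt_2pi_ge])
       (simp_all add: Phi_Taylor_def lessThan_nat_numeral fact_numeral power_divide)
  moreover have "Phi 1.2 \<le> 0.88494"
    by (rule Phi_le_Taylor[where n = 4 and c = "0.39894229", OF _ _ inv_sqrt_2pi_le])
       (simp_all add: Phi_Taylor_def lessThan_nat_numeral fact_numeral power_divide)
  moreover have "0.19418 \<le> \<phi> 1.2"
    by (rule std_normal_density_ge_Taylor[where n = 4 and c = "0.39894228", OF _ inv_sqrt_2pi_ge])
       (simp_all add: exp_Taylor_def lessThan_nat_numeral fact_numeral power_divide)
  ultimately show "0.3114 \<le> hazard_slope (1.2)" "0.8226 \<le> hazard_slope (- 1.2)"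
    using hazard_slope_ge[of "1.2" "0.19418" "0.88494" "0.88493"] by simp_all
qed

lemma hazard_slope_1_36: "0.2656 \<le> hazard_slope (1.36)" "0.8378 \<le> hazard_slope (- 1.36)"
proof -
  have "0.91308 \<le> Phi 1.36"
    by (rule Phi_ge_Taylor[where n = 4 and c = "0.39894228", OF _ _ inv_sqrt_2pi_ge])
       (simp_all add: Phi_Taylor_def lessThan_nat_numeral fact_numeral power_divide)
  moreover have "Phi 1.36 \<le> 0.91309"
    by (rule Phi_le_Taylor[where n = 4 and c = "0.39894229", OF _ _ inv_sqrt_2pi_le])
       (simp_all add: Phi_Taylor_def lessThan_nat_numeral fact_numeral power_divide)
  moreover have "0.15822 \<le> \<phi> 1.36"
    by (rule std_normal_density_ge_Taylor[where n = 5 and c = "0.39894228", OF _ inv_sqrt_2pi_ge])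
       (simp_all add: exp_Taylor_def lessThan_nat_numeral fact_numeral power_divide)
  ultimately show "0.2656 \<le> hazard_slope (1.36)" "0.8378 \<le> hazard_slope (- 1.36)"
    using hazard_slope_ge[of "1.36" "0.15822" "0.91309" "0.91308"] by simp_all
qed

lemma hazard_slope_1_55: "0.2143 \<le> hazard_slope (1.55)" "0.8534 \<le> hazard_slope (- 1.55)"
proof -
  have "0.93942 \<le> Phi 1.55"
    by (rule Phi_ge_Taylor[where n = 4 and c = "0.39894228", OF _ _ inv_sqrt_2pi_ge])
       (simp_all add: Phi_Taylor_def lessThan_nat_numeral fact_numeral power_divide)
  moreover have "Phi 1.55 \<le> 0.93943"
    by (rule Phi_le_Taylor[where n = 4 and c = "0.39894229", OF _ _ inv_sqrt_2pi_le])
       (simp_all add: Phi_Taylor_def lessThan_nat_numeral fact_numeral power_divide)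
  moreover have "0.12000 \<le> \<phi> 1.55"
    by (rule std_normal_density_ge_Taylor[where n = 5 and c = "0.39894228", OF _ inv_sqrt_2pi_ge])
       (simp_all add: exp_Taylor_def lessThan_nat_numeral fact_numeral power_divide)
  ultimately show "0.2143 \<le> hazard_slope (1.55)" "0.8534 \<le> hazard_slope (- 1.55)"
    using hazard_slope_ge[of "1.55" "0.12000" "0.93943" "0.93942"] by simp_all
qed

lemma hazard_slope_1_7: "0.1770 \<le> hazard_slope (1.7)" "0.8649 \<le> hazard_slope (- 1.7)"
proof -
  have "0.95543 \<le> Phi 1.7"
    by (rule Phi_ge_Taylor[where n = 5 and c = "0.39894228", OF _ _ inv_sqrt_2pi_ge])
       (simp_all add: Phi_Taylor_def lessThan_nat_numeral fact_numeral power_divide)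
  moreover have "Phi 1.7 \<le> 0.95544"
    by (rule Phi_le_Taylor[where n = 5 and c = "0.39894229", OF _ _ inv_sqrt_2pi_le])
       (simp_all add: Phi_Taylor_def lessThan_nat_numeral fact_numeral power_divide)
  moreover have "0.09404 \<le> \<phi> 1.7"
    by (rule std_normal_density_ge_Taylor[where n = 5 and c = "0.39894228", OF _ inv_sqrt_2pi_ge])
       (simp_all add: exp_Taylor_def lessThan_nat_numeral fact_numeral power_divide)
  ultimately show "0.1770 \<le> hazard_slope (1.7)" "0.8649 \<le> hazard_slope (- 1.7)"
    using hazard_slope_ge[of "1.7" "0.09404" "0.95544" "0.95543"] by simp_all
qed

lemma hazard_slope_0: "0.6366 \<le> hazard_slope (- 0)"
proof -
  have "hazard_slope 0 = 4 * inv_sqrt_2pi\<^sup>2"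
    by (simp add: hazard_slope_def hazard_def std_normal_density_eq power2_eq_square)
  moreover have "0.39894228\<^sup>2 \<le> inv_sqrt_2pi\<^sup>2"
    by (rule power_mono[OF inv_sqrt_2pi_ge]) simp
  ultimately show ?thesis by (simp add: power2_eq_square)
qed

text \<open>The function \<open>u \<mapsto> hazard (- u) - hazard u\<close> is minus the logarithmic derivative of
  \<open>\<Phi>(u) \<Phi>(-u)\<close>; its excess over a line of slope 1.14 measures how much faster than
  \<open>exp (- 0.57 u\<^sup>2)\<close> that product decays.\<close>
definition hazard_excess :: "real \<Rightarrow> real" where
  "hazard_excess u = hazard (- u) - hazard u - 1.14 * u"

lemma hazard_excess_minus [simp]: "hazard_excess (- u) = - hazard_excess u"
  by (simp add: hazard_excess_def)

text \<open>The derivative of the excess is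
  \<open>hazard_slope u + hazard_slope (- u) - 1.14\<close>; on [l, r] the two slopes are at least
  their values at \<open>r\<close> and at \<open>- l\<close>.\<close>

lemma hazard_excess_increment:
  assumes "l \<le> x" "x \<le> y" "y \<le> r" "c \<le> hazard_slope r" "d \<le> hazard_slope (- l)"
  shows "(c + d - 1.14) * (y - x) \<le> hazard_excess y - hazard_excess x"
proof -
  have "hazard_excess x - (c + d - 1.14) * x \<le> hazard_excess y - (c + d - 1.14) * y"
  proof (rule DERIV_nonneg_imp_nondecreasing[OF assms(2), where f = "\<lambda>u. hazard_excess u - (c + d - 1.14) * u"])
    fix u assume "x \<le> u" "u \<le> y"
    hence "c \<le> hazard_slope u" "d \<le> hazard_slope (- u)"
      using assms hazard_slope_antimono[of u r] hazard_slope_antimono[of "- u" "- l"] by auto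
    moreover have "((\<lambda>u. hazard_excess u - (c + d - 1.14) * u) has_real_derivative
      hazard_slope (- u) + hazard_slope u - 1.14 - (c + d - 1.14)) (at u)"
      unfolding hazard_excess_def by (auto intro!: derivative_eq_intros)
    ultimately show "\<exists>y. ((\<lambda>u. hazard_excess u - (c + d - 1.14) * u) has_real_derivative y) (at u) \<and> 0 \<le> y"
      by (intro exI conjI) auto
  qed
  thus ?thesis using right_diff_distrib[of "c + d - 1.14" y x] by linarith
qed

text \<open>Each coefficient is a sum of two table entries minus 1.14, for instance 0.5660 + 0.6366
  - 1.14 = 0.0626. The coefficients stay positive up to 1.1; beyond, they limit the possible
  decrease.\<close>

lemma hazard_excess_increments:
  assumes "x \<le> y"
  shows "0 \<le> x \<Longrightarrow> y \<le> 0.3 \<Longrightarrow> 0.0626 * (y - x) \<le> hazard_excess y - hazard_excess x"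
    "0.3 \<le> x \<Longrightarrow> y \<le> 0.6 \<Longrightarrow> 0.043 * (y - x) \<le> hazard_excess y - hazard_excess x"
    "0.6 \<le> x \<Longrightarrow> y \<le> 0.8 \<Longrightarrow> 0.0362 * (y - x) \<le> hazard_excess y - hazard_excess x"
    "0.8 \<le> x \<Longrightarrow> y \<le> 0.95 \<Longrightarrow> 0.0207 * (y - x) \<le> hazard_excess y - hazard_excess x"
    "0.95 \<le> x \<Longrightarrow> y \<le> 1.05 \<Longrightarrow> 0.0102 * (y - x) \<le> hazard_excess y - hazard_excess x"
    "1.05 \<le> x \<Longrightarrow> y \<le> 1.1 \<Longrightarrow> 0.0072 * (y - x) \<le> hazard_excess y - hazard_excess x"
    "1.1 \<le> x \<Longrightarrow> y \<le> 1.2 \<Longrightarrow> (- 0.0166) * (y - x) \<le> hazard_excess y - hazard_excess x"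
    "1.2 \<le> x \<Longrightarrow> y \<le> 1.36 \<Longrightarrow> (- 0.0518) * (y - x) \<le> hazard_excess y - hazard_excess x"
    "1.36 \<le> x \<Longrightarrow> y \<le> 1.55 \<Longrightarrow> (- 0.0879) * (y - x) \<le> hazard_excess y - hazard_excess x"
    "1.55 \<le> x \<Longrightarrow> y \<le> 1.7 \<Longrightarrow> (- 0.1096) * (y - x) \<le> hazard_excess y - hazard_excess x"
  using hazard_excess_increment[of "0" x y "0.3", OF _ assms _ hazard_slope_0_3(1) hazard_slope_0]
    hazard_excess_increment[of "0.3" x y "0.6", OF _ assms _ hazard_slope_0_6(1) hazard_slope_0_3(2)]
    hazard_excess_increment[of "0.6" x y "0.8", OF _ assms _ hazard_slope_0_8(1) hazard_slope_0_6(2)]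
    hazard_excess_increment[of "0.8" x y "0.95", OF _ assms _ hazard_slope_0_95(1) hazard_slope_0_8(2)]
    hazard_excess_increment[of "0.95" x y "1.05", OF _ assms _ hazard_slope_1_05(1) hazard_slope_0_95(2)]
    hazard_excess_increment[of "1.05" x y "1.1", OF _ assms _ hazard_slope_1_1(1) hazard_slope_1_05(2)]
    hazard_excess_increment[of "1.1" x y "1.2", OF _ assms _ hazard_slope_1_2(1) hazard_slope_1_1(2)]
    hazard_excess_increment[of "1.2" x y "1.36", OF _ assms _ hazard_slope_1_36(1) hazard_slope_1_2(2)]
    hazard_excess_increment[of "1.36" x y "1.55", OF _ assms _ hazard_slope_1_55(1) hazard_slope_1_36(2)]
    hazard_excess_increment[of "1.55" x y "1.7", OF _ assms _ hazard_slope_1_7(1) hazard_slope_1_55(2)]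
  by simp_all

lemma hazard_excess_0 [simp]: "hazard_excess 0 = 0"
  by (simp add: hazard_excess_def)

lemma hazard_excess_mono: "0 \<le> x \<Longrightarrow> x \<le> y \<Longrightarrow> y \<le> 1.1 \<Longrightarrow> hazard_excess x \<le> hazard_excess y"
proof -
  have step: "hazard_excess x \<le> hazard_excess y" if "x \<le> y" and
    "(0 \<le> x \<and> y \<le> 0.3) \<or> (0.3 \<le> x \<and> y \<le> 0.6) \<or> (0.6 \<le> x \<and> y \<le> 0.8) \<or>
     (0.8 \<le> x \<and> y \<le> 0.95) \<or> (0.95 \<le> x \<and> y \<le> 1.05) \<or> (1.05 \<le> x \<and> y \<le> 1.1)" for x y
    using that(2) hazard_excess_increments(1-6)[OF that(1)] that(1) by (auto; linarith)
  have 1: "hazard_excess x \<le> hazard_excess y" if "0 \<le> x" "x \<le> y" "y \<le> 0.6" for x y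
    using step[of x y] step[of x "0.3"] step[of "0.3" y] that by (cases "x \<le> 0.3"; cases "y \<le> 0.3") auto
  have 2: "hazard_excess x \<le> hazard_excess y" if "0 \<le> x" "x \<le> y" "y \<le> 0.8" for x y
    using step[of x y] 1[of x y] 1[of x "0.6"] step[of "0.6" y] that by (cases "x \<le> 0.6"; cases "y \<le> 0.6") auto
  have 3: "hazard_excess x \<le> hazard_excess y" if "0 \<le> x" "x \<le> y" "y \<le> 0.95" for x y
    using step[of x y] 2[of x y] 2[of x "0.8"] step[of "0.8" y] that by (cases "x \<le> 0.8"; cases "y \<le> 0.8") auto
  have 4: "hazard_excess x \<le> hazard_excess y" if "0 \<le> x" "x \<le> y" "y \<le> 1.05" for x y
    using step[of x y] 3[of x y] 3[of x "0.95"] step[of "0.95" y] that by (cases "x \<le> 0.95"; cases "y \<le> 0.95") auto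
  show "0 \<le> x \<Longrightarrow> x \<le> y \<Longrightarrow> y \<le> 1.1 \<Longrightarrow> hazard_excess x \<le> hazard_excess y"
    using step[of x y] 4[of x y] 4[of x "1.05"] step[of "1.05" y] by (cases "x \<le> 1.05"; cases "y \<le> 1.05") auto
qed

text \<open>Accumulated growth up to 1.1. The value 0.0434 outweighs the drop of at most 0.0432 up
  to 1.7, and 0.0143 outweighs the drop of at most 0.0100 up to 1.36.\<close>

lemma hazard_excess_1_1: "0.0434 \<le> hazard_excess 1.1" "hazard_excess 0.54 + 0.0143 \<le> hazard_excess 1.1"
  using hazard_excess_increments(1)[of 0 "0.3"] hazard_excess_increments(2)[of "0.3" "0.6"]
    hazard_excess_increments(2)[of "0.54" "0.6"]
    hazard_excess_increments(3)[of "0.6" "0.8"] hazard_excess_increments(4)[of "0.8" "0.95"]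
    hazard_excess_increments(5)[of "0.95" "1.05"] hazard_excess_increments(6)[of "1.05" "1.1"]
  by (simp_all del: hazard_excess_minus)

lemma hazard_excess_drop:
  assumes "1.1 \<le> v"
  shows "v \<le> 1.36 \<Longrightarrow> hazard_excess 1.1 - 0.0100 \<le> hazard_excess v"
    "v \<le> 1.7 \<Longrightarrow> hazard_excess 1.1 - 0.0432 \<le> hazard_excess v"
proof -
  note I = hazard_excess_increments
  have A: "hazard_excess 1.1 - 0.0100 \<le> hazard_excess v" if "1.1 \<le> v" "v \<le> 1.36" for v
  proof (cases "v \<le> 1.2")
    case True
    have "(- 0.0166) * (v - 1.1) \<le> hazard_excess v - hazard_excess 1.1"
      by (rule I(7)) (use True that in auto)
    thus ?thesis using True by (simp add: field_simps)
  next
    case False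
    have "(- 0.0518) * (v - 1.2) \<le> hazard_excess v - hazard_excess 1.2"
      by (rule I(8)) (use False that in auto)
    moreover have "(- 0.0166) * (1.2 - 1.1) \<le> hazard_excess 1.2 - hazard_excess 1.1"
      by (rule I(7)) auto
    ultimately show ?thesis using that by (simp add: field_simps)
  qed
  show "hazard_excess 1.1 - 0.0100 \<le> hazard_excess v" if "v \<le> 1.36"
    by (rule A[OF assms that])
  have B: "hazard_excess 1.1 - 0.0267 \<le> hazard_excess v" if "1.36 \<le> v" "v \<le> 1.55" for v
  proof -
    have "(- 0.0879) * (v - 1.36) \<le> hazard_excess v - hazard_excess 1.36"
      by (rule I(9)) (use that in auto)
    moreover have "(- 0.0518) * (1.36 - 1.2) \<le> hazard_excess 1.36 - hazard_excess 1.2"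
      by (rule I(8)) auto
    moreover have "(- 0.0166) * (1.2 - 1.1) \<le> hazard_excess 1.2 - hazard_excess 1.1"
      by (rule I(7)) auto
    ultimately show ?thesis using that by (simp add: field_simps)
  qed
  show "hazard_excess 1.1 - 0.0432 \<le> hazard_excess v" if "v \<le> 1.7"
  proof (cases "v \<le> 1.55")
    case True
    thus ?thesis using A[OF assms] B[of v] by (cases "v \<le> 1.36") auto
  next
    case False
    have "(- 0.1096) * (v - 1.55) \<le> hazard_excess v - hazard_excess 1.55"
      by (rule I(10)) (use False that in auto)
    moreover have "hazard_excess 1.1 - 0.0267 \<le> hazard_excess 1.55" using B[of "1.55"] by simp
    ultimately show ?thesis using that by (simp add: field_simps)
  qed
qed

lemma hazard_excess_nonneg:
  assumes "0 \<le> v" "v \<le> 1.7" shows "0 \<le> hazard_excess v"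
proof (cases "v \<le> 1.1")
  case True
  thus ?thesis using hazard_excess_mono[of 0 v] assms by simp
next
  case False
  hence "hazard_excess 1.1 - 0.0432 \<le> hazard_excess v" using hazard_excess_drop(2)[of v] assms by simp
  thus ?thesis using hazard_excess_1_1(1) by simp
qed

text \<open>Applied with u = a - t and v = a + t for 0 \<le> a \<le> 0.82: once v exceeds 1.1, u = 2
  a - v is at most 0.54, where the excess is still small.\<close>

lemma hazard_excess_le:
  assumes "0 \<le> u" "u \<le> v" "v \<le> 1.36" "v \<le> 1.1 \<or> u \<le> 0.54"
  shows "hazard_excess u \<le> hazard_excess v"
proof (cases "v \<le> 1.1")
  case True
  thus ?thesis using hazard_excess_mono[of u v] assms by simp
next
  case False
  hence "hazard_excess u \<le> hazard_excess 0.54"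
    using hazard_excess_mono[of u "0.54"] assms by simp
  moreover have "hazard_excess 1.1 - 0.0100 \<le> hazard_excess v"
    using hazard_excess_drop(1)[of v] False assms by simp
  ultimately show ?thesis using hazard_excess_1_1(2) by simp
qed

text \<open>A second-difference estimate: \<open>f(a + e) f(a - e)\<close> against \<open>f(a)\<^sup>2\<close>, read off from the
  derivative in \<open>e\<close> of its logarithm.\<close>
lemma log_second_difference:
  fixes f g :: "real \<Rightarrow> real"
  assumes "0 \<le> e" "\<And>t. f t > 0" "\<And>t. (f has_real_derivative f t * g t) (at t)"
  shows "(\<And>u. 0 \<le> u \<Longrightarrow> u \<le> e \<Longrightarrow> g (a + u) - g (a - u) \<le> - 2 * c * u) \<Longrightarrow>
      f (a + e) * f (a - e) \<le> (f a)\<^sup>2 * exp (- c * e\<^sup>2)"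
    "(\<And>u. 0 \<le> u \<Longrightarrow> u \<le> e \<Longrightarrow> g (a + u) - g (a - u) \<ge> - 2 * c * u) \<Longrightarrow>
      f (a + e) * f (a - e) \<ge> (f a)\<^sup>2 * exp (- c * e\<^sup>2)"
proof -
  define L where "L = (\<lambda>u. f (a + u) * f (a - u) * exp (c * u\<^sup>2))"
  have dL: "(L has_real_derivative L u * (g (a + u) - g (a - u) + 2 * c * u)) (at u)" for u
    unfolding L_def
    by (rule derivative_eq_intros DERIV_chain2[OF assms(3)] refl)+ (simp add: algebra_simps)
  have Lpos: "L u > 0" for u using assms(2) by (simp add: L_def)
  have Le: "f (a + e) * f (a - e) = L e * exp (- c * e\<^sup>2)" and L0: "L 0 = (f a)\<^sup>2"
    by (simp_all add: L_def exp_minus power2_eq_square)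
  {
    assume *: "\<And>u. 0 \<le> u \<Longrightarrow> u \<le> e \<Longrightarrow> g (a + u) - g (a - u) \<le> - 2 * c * u"
    have "L e \<le> L 0"
    proof (rule DERIV_nonpos_imp_nonincreasing[OF assms(1)])
      fix u assume "0 \<le> u" "u \<le> e"
      hence "g (a + u) - g (a - u) + 2 * c * u \<le> 0" using * by fastforce
      thus "\<exists>y. (L has_real_derivative y) (at u) \<and> y \<le> 0"
        using dL[of u] Lpos[of u] by (auto intro!: exI mult_nonneg_nonpos)
    qed
    thus "f (a + e) * f (a - e) \<le> (f a)\<^sup>2 * exp (- c * e\<^sup>2)"
      unfolding Le L0 by (intro mult_right_mono) auto
  }
  {
    assume *: "\<And>u. 0 \<le> u \<Longrightarrow> u \<le> e \<Longrightarrow> g (a + u) - g (a - u) \<ge> - 2 * c * u"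
    have "L 0 \<le> L e"
    proof (rule DERIV_nonneg_imp_nondecreasing[OF assms(1)])
      fix u assume "0 \<le> u" "u \<le> e"
      hence "0 \<le> g (a + u) - g (a - u) + 2 * c * u" using * by fastforce
      thus "\<exists>y. (L has_real_derivative y) (at u) \<and> 0 \<le> y"
        using dL[of u] Lpos[of u] by (auto intro!: exI mult_nonneg_nonneg)
    qed
    thus "f (a + e) * f (a - e) \<ge> (f a)\<^sup>2 * exp (- c * e\<^sup>2)"
      unfolding Le L0 by (intro mult_right_mono) auto
  }
qed

section \<open>Gaussian decay of \<open>Phi (a + e) * Phi (a - e)\<close> and of its two-tailed
  version\<close>

lemma DERIV_Phi_hazard: "(Phi has_real_derivative Phi t * hazard t) (at t)"
  using DERIV_Phi[of t] Phi_pos[of t] by (simp add: hazard_def del: Phi_pos)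

lemma hazard_plus_id_mono: "x \<le> y \<Longrightarrow> hazard x + x \<le> hazard y + y"
proof (rule DERIV_nonneg_imp_nondecreasing[where f = "\<lambda>x. hazard x + x"])
  fix t
  have "((\<lambda>x. hazard x + x) has_real_derivative - hazard_slope t + 1) (at t)"
    by (intro DERIV_add DERIV_hazard DERIV_ident)
  thus "\<exists>y. ((\<lambda>x. hazard x + x) has_real_derivative y) (at t) \<and> 0 \<le> y"
    using hazard_slope_le_1[of t] by (intro exI[of _ "- hazard_slope t + 1"]) simp
qed

text \<open>The case c = 1 of \<open>log_second_difference\<close>: the hazard rate never falls
  faster than with slope 1.\<close>

lemma Phi_mult_ge: "0 \<le> e \<Longrightarrow> (Phi a)\<^sup>2 * exp (- e\<^sup>2) \<le> Phi (a + e) * Phi (a - e)"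
  using log_second_difference(2)[where f = Phi and g = hazard and a = a and e = e and c = 1, OF _ Phi_pos DERIV_Phi_hazard]
    hazard_plus_id_mono[of "a - u" "a + u" for u]
  by (fastforce simp: algebra_simps)

text \<open>For \<open>a \<le> 0\<close> convexity of the hazard rate makes its drop across
  [a - u, a + u] at least the drop across [- u, u], and there the excess over 1.14 u is nonnegative
  for u up to 1.7.\<close>

lemma Phi_mult_le:
  assumes "a \<le> 0" "0 \<le> e" "e \<le> 1.7"
  shows "Phi (a + e) * Phi (a - e) \<le> (Phi a)\<^sup>2 * exp (- 0.57 * e\<^sup>2)"
proof (rule log_second_difference(1)[OF assms(2) Phi_pos DERIV_Phi_hazard])
  fix u assume u: "0 \<le> u" "u \<le> e"
  have "hazard (0 - u) - hazard (0 + u) \<le> hazard (a - u) - hazard (a + u)"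
  proof (rule DERIV_nonpos_imp_nonincreasing[OF assms(1), where f = "\<lambda>a. hazard (a - u) - hazard (a + u)"])
    fix t
    have "((\<lambda>a. hazard (a - u) - hazard (a + u)) has_real_derivative - hazard_slope (t - u) + hazard_slope (t + u)) (at t)"
      by (auto intro!: derivative_eq_intros)
    thus "\<exists>y. ((\<lambda>a. hazard (a - u) - hazard (a + u)) has_real_derivative y) (at t) \<and> y \<le> 0"
      using hazard_slope_antimono[of "t - u" "t + u"] u
      by (intro exI[of _ "- hazard_slope (t - u) + hazard_slope (t + u)"]) simp
  qed
  moreover have "0 \<le> hazard_excess u" using u assms by (intro hazard_excess_nonneg) auto
  ultimately show "hazard (a + u) - hazard (a - u) \<le> - 2 * 0.57 * u"
    by (simp add: hazard_excess_def)
qed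

definition Phi_tails :: "real \<Rightarrow> real" where
  "Phi_tails t = Phi t * Phi (- t)"

text \<open>The logarithmic derivative of \<open>Phi_tails\<close> is
  \<open>hazard t - hazard (- t)\<close>, so what is needed is that
  \<open>hazard_excess (a + u) + hazard_excess (u - a)\<close> is nonnegative. For u < a the second
  term is minus the excess at a - u, and the two values have to be compared; the hypothesis with
  \<open>min\<close> bounds a + u in this case.\<close>

lemma Phi_tails_mult_le:
  assumes "0 \<le> e" "\<bar>a\<bar> \<le> 0.82" "\<bar>a\<bar> + min e \<bar>a\<bar> \<le> 1.36" "\<bar>a\<bar> + e \<le> 1.7"
  shows "Phi_tails (a + e) * Phi_tails (a - e) \<le> (Phi_tails a)\<^sup>2 * exp (- 1.14 * e\<^sup>2)"
proof -
  have *: "Phi_tails (a + e) * Phi_tails (a - e) \<le> (Phi_tails a)\<^sup>2 * exp (- 1.14 * e\<^sup>2)"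
    if a: "0 \<le> a" "a \<le> 0.82" "a + min e a \<le> 1.36" "a + e \<le> 1.7" for a
  proof (rule log_second_difference(1)[where g = "\<lambda>t. hazard t - hazard (- t)", OF assms(1)])
    fix t
    show "Phi_tails t > 0" by (simp add: Phi_tails_def)
    have "((\<lambda>t. Phi t * Phi (- t)) has_real_derivative \<phi> t * Phi (- t) + - \<phi> (- t) * Phi t) (at t)"
      by (auto intro!: derivative_eq_intros)
    moreover have "\<phi> t * Phi (- t) + - \<phi> (- t) * Phi t = Phi_tails t * (hazard t - hazard (- t))"
      using Phi_pos[of t] Phi_pos[of "- t"]
      by (simp add: Phi_tails_def hazard_def field_simps del: Phi_pos)
    ultimately show "(Phi_tails has_real_derivative Phi_tails t * (hazard t - hazard (- t))) (at t)"
      unfolding Phi_tails_def[abs_def] by simp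
  next
    fix u assume u: "0 \<le> u" "u \<le> e"
    have "0 \<le> hazard_excess (a + u) + hazard_excess (u - a)"
    proof (cases "a \<le> u")
      case True
      have "0 \<le> hazard_excess (a + u)" "0 \<le> hazard_excess (u - a)"
        using True u a by (auto intro!: hazard_excess_nonneg)
      thus ?thesis by simp
    next
      case False
      have "hazard_excess (a - u) \<le> hazard_excess (a + u)"
        using False u a by (intro hazard_excess_le) (auto simp: min_def split: if_splits)
      thus ?thesis using hazard_excess_minus[of "a - u"] by simp
    qed
    also have "\<dots> = hazard (- (a + u)) - hazard (a + u) + (hazard (a - u) - hazard (- (a - u))) - 2 * 1.14 * u"
      by (simp add: hazard_excess_def) (simp add: field_simps)
    finally show "hazard (a + u) - hazard (- (a + u)) - (hazard (a - u) - hazard (- (a - u))) \<le> - 2 * 1.14 * u"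
      by simp
  qed
  show ?thesis
  proof (cases "0 \<le> a")
    case True
    thus ?thesis using *[of a] assms by simp
  next
    case False
    have "Phi_tails (- t) = Phi_tails t" for t by (simp add: Phi_tails_def)
    from this[of "a + e"] this[of "a - e"] this[of a] show ?thesis
      using *[of "- a"] assms False by (simp add: mult.commute)
  qed
qed

section \<open>Reduction to symmetric configurations\<close>

definition arctan_Taylor :: "nat \<Rightarrow> real \<Rightarrow> real" where
  "arctan_Taylor n x = (\<Sum>k<n. (- 1) ^ k * x ^ (2 * k + 1) / (2 * real k + 1))"

lemma DERIV_arctan_Taylor:
  "(arctan_Taylor n has_real_derivative (1 - (- (x\<^sup>2)) ^ n) / (1 + x\<^sup>2)) (at x)"
proof -
  have "((\<lambda>x. (- 1) ^ k * x ^ (2 * k + 1) / (2 * real k + 1)) has_real_derivative (- (x\<^sup>2)) ^ k) (at x)" for k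
  proof -
    define d where "d = 2 * real k + 1"
    have d: "d \<noteq> 0" "real (2 * k + 1) = d" by (auto simp: d_def)
    have "(- (x\<^sup>2)) ^ k = (- 1) ^ k * x ^ (2 * k)"
      by (subst power_minus) (simp add: power_mult)
    moreover have "((\<lambda>x. (- 1) ^ k * x ^ (2 * k + 1) / d) has_real_derivative
        (- 1) ^ k * (real (2 * k + 1) * x ^ (2 * k + 1 - Suc 0)) / d) (at x)"
      by (rule DERIV_cdivide[OF DERIV_cmult[OF DERIV_pow]])
    moreover have "(- 1) ^ k * (real (2 * k + 1) * x ^ (2 * k + 1 - Suc 0)) / d = (- 1) ^ k * x ^ (2 * k)"
      unfolding d(2) One_nat_def[symmetric] add_diff_cancel_right' using d(1) by simp
    ultimately show ?thesis unfolding d_def by simp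
  qed
  hence "(arctan_Taylor n has_real_derivative (\<Sum>k<n. (- (x\<^sup>2)) ^ k)) (at x)"
    unfolding arctan_Taylor_def by (intro DERIV_sum) auto
  moreover have "(\<Sum>k<n. (- (x\<^sup>2)) ^ k) = (1 - (- (x\<^sup>2)) ^ n) / (1 + x\<^sup>2)"
  proof -
    have "1 + x\<^sup>2 > 0" by (simp add: add_pos_nonneg)
    thus ?thesis using one_diff_power_eq[of "- (x\<^sup>2)" n] by (simp add: field_simps)
  qed
  ultimately show ?thesis by simp
qed

lemma arctan_bounds_Taylor:
  assumes "0 \<le> x"
  shows "arctan_Taylor (2 * n) x \<le> arctan x" "arctan x \<le> arctan_Taylor (2 * n + 1) x"
proof -
  have d: "((\<lambda>u. arctan u - arctan_Taylor m u) has_real_derivative (- (u\<^sup>2)) ^ m / (1 + u\<^sup>2)) (at u)" for m u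
    by (rule DERIV_cong[OF DERIV_diff[OF DERIV_arctan DERIV_arctan_Taylor]])
       (simp add: diff_divide_distrib inverse_eq_divide)
  have T0: "arctan 0 - arctan_Taylor m 0 = 0" for m by (simp add: arctan_Taylor_def)
  have pos: "1 + u\<^sup>2 > 0" for u :: real by (simp add: add_pos_nonneg)
  have "arctan 0 - arctan_Taylor (2 * n) 0 \<le> arctan x - arctan_Taylor (2 * n) x"
    by (rule DERIV_nonneg_imp_nondecreasing[OF assms]) (use d[of "2 * n"] in \<open>auto simp: power_mult intro!: exI\<close>)
  thus "arctan_Taylor (2 * n) x \<le> arctan x" unfolding T0 by simp
  have "arctan x - arctan_Taylor (2 * n + 1) x \<le> arctan 0 - arctan_Taylor (2 * n + 1) 0"
  proof (rule DERIV_nonpos_imp_nonincreasing[OF assms])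
    fix u :: real
    have "(- (u\<^sup>2)) ^ (2 * n + 1) / (1 + u\<^sup>2) \<le> 0"
      using pos[of u] by (simp add: power_mult divide_nonpos_pos mult_nonneg_nonneg)
    thus "\<exists>y. ((\<lambda>u. arctan u - arctan_Taylor (2 * n + 1) u) has_real_derivative y) (at u) \<and> y \<le> 0"
      using d by blast
  qed
  thus "arctan x \<le> arctan_Taylor (2 * n + 1) x" unfolding T0 by simp
qed

text \<open>Concavity of arctan on the nonnegative axis.\<close>

lemma arctan_le_tangent:
  assumes "0 \<le> x" "0 \<le> y"
  shows "arctan y \<le> arctan x + (y - x) / (1 + x\<^sup>2)"
proof -
  define f where "f = (\<lambda>y. arctan y - (y - x) / (1 + x\<^sup>2))"
  have px: "1 + u\<^sup>2 > 0" for u :: real by (simp add: add_pos_nonneg)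
  have d: "(f has_real_derivative inverse (1 + u\<^sup>2) - inverse (1 + x\<^sup>2)) (at u)" for u
    unfolding f_def using px[of x] by (auto intro!: derivative_eq_intros simp: divide_inverse)
  have "f y \<le> f x"
  proof (cases "x \<le> y")
    case True
    show ?thesis
    proof (rule DERIV_nonpos_imp_nonincreasing[OF True])
      fix u assume "x \<le> u"
      hence "x\<^sup>2 \<le> u\<^sup>2" using assms by (intro power_mono)
      hence "inverse (1 + u\<^sup>2) \<le> inverse (1 + x\<^sup>2)" using px by (intro le_imp_inverse_le) auto
      thus "\<exists>y. (f has_real_derivative y) (at u) \<and> y \<le> 0" using d by (intro exI conjI) auto
    qed
  next
    case False
    show ?thesis
    proof (rule DERIV_nonneg_imp_nondecreasing[of y x f])
      fix u assume "y \<le> u" "u \<le> x"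
      hence "u\<^sup>2 \<le> x\<^sup>2" using assms by (intro power_mono) auto
      hence "inverse (1 + x\<^sup>2) \<le> inverse (1 + u\<^sup>2)" using px by (intro le_imp_inverse_le) auto
      thus "\<exists>y. (f has_real_derivative y) (at u) \<and> 0 \<le> y" using d by (intro exI conjI) auto
    qed (use False in auto)
  qed
  thus ?thesis by (simp add: f_def)
qed

text \<open>\<open>half_tan \<theta> = tan (\<pi>/4 - \<theta>/2)\<close> rationalises all integrals over \<open>\<theta>\<close>.\<close>
definition half_tan :: "real \<Rightarrow> real" where
  "half_tan \<theta> = cos \<theta> / (1 + sin \<theta>)"

lemma DERIV_half_tan:
  assumes "1 + sin \<theta> \<noteq> 0"
  shows "(half_tan has_real_derivative - 1 / (1 + sin \<theta>)) (at \<theta> within S)"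
proof -
  have *: "- sin \<theta> * (1 + sin \<theta>) - cos \<theta> * cos \<theta> = - (1 + sin \<theta>)"
    using sin_cos_squared_add[of \<theta>] by (simp add: power2_eq_square algebra_simps)
  have "(half_tan has_real_derivative (- sin \<theta> * (1 + sin \<theta>) - cos \<theta> * cos \<theta>) / ((1 + sin \<theta>) * (1 + sin \<theta>))) (at \<theta> within S)"
    unfolding half_tan_def[abs_def] using assms by (auto intro!: derivative_eq_intros)
  moreover have "- w / (w * w) = - 1 / w" if "w \<noteq> 0" for w :: real using that by simp
  note this[OF assms]
  ultimately show ?thesis unfolding * by metis
qed

lemma half_tan_sq: "1 + sin \<theta> > 0 \<Longrightarrow> 1 + (half_tan \<theta>)\<^sup>2 = 2 / (1 + sin \<theta>)"
proof -
  assume p: "1 + sin \<theta> > 0"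
  have "(1 + sin \<theta>)\<^sup>2 + (cos \<theta>)\<^sup>2 = 2 * (1 + sin \<theta>)"
    using sin_cos_squared_add[of \<theta>] by (simp add: power2_eq_square algebra_simps)
  hence "(1 + sin \<theta>) * (1 + sin \<theta>) + cos \<theta> * cos \<theta> = 2 * (1 + sin \<theta>)" by (simp add: power2_eq_square)
  thus ?thesis using p by (simp add: half_tan_def power_divide divide_simps power2_eq_square)
qed

lemma angle_half_tan:
  assumes "0 \<le> \<theta>" "\<theta> \<le> pi / 2"
  shows "\<theta> = pi / 2 - 2 * arctan (half_tan \<theta>)"
proof -
  have p: "1 + sin u > 0" if "0 \<le> u" "u \<le> \<theta>" for u
    using sin_ge_zero[of u] that assms by auto
  have "\<theta> + 2 * arctan (half_tan \<theta>) = 0 + 2 * arctan (half_tan 0)"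
  proof (cases "\<theta> = 0")
    case False
    show ?thesis
    proof (rule DERIV_isconst_end[of 0 \<theta> "\<lambda>u. u + 2 * arctan (half_tan u)"])
      have der: "((\<lambda>u. u + 2 * arctan (half_tan u)) has_real_derivative 0) (at u)" if "0 \<le> u" "u \<le> \<theta>" for u
      proof -
        have "inverse (1 + (half_tan u)\<^sup>2) * (- 1 / (1 + sin u)) = - 1 / 2"
          unfolding half_tan_sq[OF p[OF that]] using p[OF that] by simp
        hence eq0: "1 + 2 * (inverse (1 + (half_tan u)\<^sup>2) * (- 1 / (1 + sin u))) = 0" by (simp only:)
        have "(half_tan has_real_derivative - 1 / (1 + sin u)) (at u)"
          by (rule DERIV_half_tan) (use p[OF that] in simp)
        note hd = this
        show ?thesis
          by (rule DERIV_cong[OF DERIV_add[OF DERIV_ident DERIV_cmult[OF DERIV_chain2[OF DERIV_arctan hd]]]]) (rule eq0)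
      qed
      show "0 < \<theta>" using False assms by simp
      show "continuous_on {0..\<theta>} (\<lambda>u. u + 2 * arctan (half_tan u))"
        using der by (intro DERIV_continuous_on[where D = "\<lambda>_. 0"]) (auto intro: has_field_derivative_at_within)
      show "\<And>u. 0 < u \<Longrightarrow> u < \<theta> \<Longrightarrow> ((\<lambda>u. u + 2 * arctan (half_tan u)) has_real_derivative 0) (at u)"
        using der by simp
    qed
  qed simp
  thus ?thesis by (simp add: half_tan_def arctan_one)
qed

lemma half_tan_bounds:
  assumes "0 \<le> \<theta>" "\<theta> < pi / 2"
  shows "0 < half_tan \<theta>" "half_tan \<theta> \<le> 1"
proof -
  have "0 \<le> sin \<theta>" "0 < cos \<theta>" using assms by (auto intro!: sin_ge_zero cos_gt_zero_pi)
  thus "0 < half_tan \<theta>" "half_tan \<theta> \<le> 1"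
    using order_trans[OF cos_le_one[of \<theta>], of "1 + sin \<theta>"] by (simp_all add: half_tan_def divide_simps)
qed

text \<open>The left side is the integral of \<open>1 / (1 + sin u) - 0.57\<close> over
  [0, \<theta>]. As a function of k = \<open>half_tan \<theta>\<close> it is maximal at k^2 = 0.14,
  which is why arctan is replaced by its tangent at 0.374.\<close>

lemma half_tan_angle_bound:
  assumes "0 \<le> \<theta>" "\<theta> < pi / 2"
  shows "1 - half_tan \<theta> - 0.57 * \<theta> \<le> 2 * pi * 0.02208"
proof -
  define k where "k = half_tan \<theta>"
  have k: "0 < k" "k \<le> 1" unfolding k_def using half_tan_bounds assms by auto
  have "arctan 0.374 \<le> arctan_Taylor (2 * 3 + 1) 0.374"
    by (rule arctan_bounds_Taylor) simp
  also have "\<dots> \<le> 0.35790"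
    by (simp add: arctan_Taylor_def lessThan_nat_numeral power_divide)
  finally have ak: "arctan k \<le> 0.35790 + (k - 0.374) / (1 + 0.374\<^sup>2)"
    using arctan_le_tangent[of "0.374" k] k by simp
  have "\<theta> = pi / 2 - 2 * arctan k"
    unfolding k_def using assms by (intro angle_half_tan) auto
  hence "1 - k - 0.57 * \<theta> = 1 - k - 0.57 * (pi / 2) + 1.14 * arctan k" by (simp add: field_simps)
  moreover have "1.14 * arctan k \<le> 1.14 * (0.35790 + (k - 0.374) / (1 + 0.374\<^sup>2))"
    by (rule mult_left_mono[OF ak]) simp
  ultimately have "1 - k - 0.57 * \<theta> \<le> 1 - k - 0.57 * (pi / 2) + 1.14 * (0.35790 + (k - 0.374) / (1 + 0.374\<^sup>2))"
    by simp
  also have "\<dots> \<le> 2 * pi * 0.02208"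
    using pi_approx k by (simp add: power2_eq_square field_simps)
  finally show ?thesis by (simp add: k_def)
qed

section \<open>Replacing the kernel at \<open>e\<close> by the kernel at 0\<close>

lemma kern_factor: "kern a e \<theta> = kern a 0 \<theta> * exp (- (e\<^sup>2 / (1 + sin \<theta>)))"
  by (simp add: kern_def exp_add[symmetric])

text \<open>The kernel at \<open>e\<close> is \<open>lam\<close> times the kernel at 0 times
  \<open>exp (- (e\<^sup>2 * X))\<close>. Where X is positive the loss is bounded by the integral of
  X, the kernel being at most 1; where X is negative there is a gain, and the angles beyond
  \<open>\<Theta>'\<close> contribute nonnegatively.\<close>

lemma K_split:
  fixes e :: real
  assumes "0 \<le> \<Theta>'" "\<Theta>' \<le> \<Theta>" "\<Theta> < pi / 2"
  defines "lam \<equiv> exp (- 0.57 * e\<^sup>2)"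
  shows "lam * K a 0 \<Theta>' - 0.02208 * e\<^sup>2 * lam \<le> K a e \<Theta>"
proof -
  have cp: "cos u > 0" if "u \<in> {0..\<Theta>}" for u using that assms by (intro cos_gt_zero_pi) auto
  have sp: "0 \<le> sin u" if "u \<in> {0..\<Theta>}" for u using that assms by (intro sin_ge_zero) auto
  have cont: "continuous_on {u..v} (kern a e)" if "0 \<le> u" "v \<le> \<Theta>" for u v a e
    using that cp by (intro continuous_on_kern) auto
  have int: "kern a e integrable_on {u..v}" if "0 \<le> u" "v \<le> \<Theta>" for u v a e
    by (rule integrable_continuous_real[OF cont[OF that]])
  have comb: "integral {0..v} (kern a e) = integral {0..u} (kern a e) + integral {u..v} (kern a e)"
    if "0 \<le> u" "u \<le> v" "v \<le> \<Theta>" for u v a e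
    using Henstock_Kurzweil_Integration.integral_combine[OF that(1,2) int[of 0 v a e]] that by simp
  define X where "X = (\<lambda>\<theta>::real. 1 / (1 + sin \<theta>) - 0.57)"
  \<comment> \<open>The point where \<open>X\<close> changes sign,
    \<open>1 + sin m = 1 / 0.57 = 100 / 57\<close>, unless \<open>\<Theta>'\<close> comes
    first.\<close>
  define m where "m = min \<Theta>' (arcsin (43 / 57))"
  have as: "0 \<le> arcsin (43 / 57)" "sin (arcsin (43 / 57 :: real)) = 43 / 57" "arcsin (43/57) \<le> pi / 2"
    using arcsin_ubound[of "43 / 57"] by (auto intro: arcsin_nonneg)
  have m: "0 \<le> m" "m \<le> \<Theta>'" using as assms by (auto simp: m_def)
  have Xm: "0 \<le> X u" if "u \<in> {0..m}" for u
  proof -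
    have "sin u \<le> sin (arcsin (43 / 57))"
      using that as assms by (intro sin_monotone_2pi_le) (auto simp: m_def)
    thus ?thesis using sp[of u] that m assms as unfolding X_def by (simp add: field_simps)
  qed
  have Xm': "X u \<le> 0" if "u \<in> {m..\<Theta>'}" "m < \<Theta>'" for u
  proof -
    have "m = arcsin (43 / 57)" using that by (auto simp: m_def min_def split: if_splits)
    hence "sin (arcsin (43 / 57)) \<le> sin u"
      using that as assms by (intro sin_monotone_2pi_le) auto
    thus ?thesis using as unfolding X_def by (simp add: field_simps)
  qed
  have fac: "kern a e u = kern a 0 u * (lam * exp (- (e\<^sup>2 * X u)))" for u
    unfolding kern_factor[of a e] lam_def X_def exp_add[symmetric] by (simp add: algebra_simps)
  have k1: "kern a 0 u \<le> 1" if "u \<in> {0..\<Theta>}" for u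
    using cos_pos_sin[OF cp[OF that]] by (simp add: kern_def)
  have Xint: "(X has_integral (1 - half_tan m - 0.57 * m)) {0..m}"
  proof -
    have "(X has_integral (- half_tan m - 0.57 * m) - (- half_tan 0 - 0.57 * 0)) {0..m}"
    proof (rule fundamental_theorem_of_calculus[OF m(1)])
      fix u assume u: "u \<in> {0..m}"
      have nz: "1 + sin u \<noteq> 0" using sp[of u] u m assms by simp
      have "((\<lambda>u. - half_tan u - 0.57 * u) has_real_derivative X u) (at u within {0..m})"
        unfolding X_def by (rule derivative_eq_intros DERIV_half_tan[OF nz] refl | simp)+
      thus "((\<lambda>u. - half_tan u - 0.57 * u) has_vector_derivative X u) (at u within {0..m})"
        by (simp add: has_real_derivative_iff_has_vector_derivative)
    qed
    moreover have "(- half_tan m - 0.57 * m) - (- half_tan 0 - 0.57 * 0) = 1 - half_tan m - 0.57 * m"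
      by (simp add: half_tan_def)
    ultimately show ?thesis by (simp only:)
  qed
  have Xi: "X integrable_on {0..m}" "integral {0..m} X = 1 - half_tan m - 0.57 * m"
    using Xint by (auto simp only: has_integral_iff)
  have Xi': "(\<lambda>u. lam * kern a 0 u) integrable_on {0..m}" "(\<lambda>u. lam * e\<^sup>2 * X u) integrable_on {0..m}"
    using int[of 0 m a 0] Xi(1) m assms(1-3) by (auto intro!: integrable_on_mult_right)
  have "lam * integral {0..m} (kern a 0) - lam * e\<^sup>2 * (1 - half_tan m - 0.57 * m)
      = integral {0..m} (\<lambda>u. lam * kern a 0 u - lam * e\<^sup>2 * X u)"
    unfolding Xi(2)[symmetric] integral_diff[OF Xi'] by simp
  also have "\<dots> \<le> integral {0..m} (kern a e)"
  proof (rule integral_le)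
    fix u assume u: "u \<in> {0..m}"
    have "lam * kern a 0 u - lam * e\<^sup>2 * X u \<le> lam * kern a 0 u - lam * e\<^sup>2 * X u * kern a 0 u"
    proof -
      have "kern a 0 u \<le> 1" using k1[of u] u m assms(1-3) by simp
      hence "lam * e\<^sup>2 * X u * kern a 0 u \<le> lam * e\<^sup>2 * X u"
        using Xm[OF u] by (intro mult_left_le) (auto simp: lam_def)
      thus ?thesis by simp
    qed
    also have "\<dots> = kern a 0 u * (lam * (1 - e\<^sup>2 * X u))" by (simp add: algebra_simps)
    also have "\<dots> \<le> kern a e u"
      unfolding fac using exp_ge_add_one_self[of "- (e\<^sup>2 * X u)"]
      by (intro mult_left_mono) (auto simp: kern_nonneg lam_def)
    finally show "lam * kern a 0 u - lam * e\<^sup>2 * X u \<le> kern a e u" .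
  qed (use int[of 0 m] m assms(1-3) in \<open>auto intro!: integrable_diff Xi'\<close>)
  finally have 1: "lam * integral {0..m} (kern a 0) - lam * e\<^sup>2 * (1 - half_tan m - 0.57 * m) \<le> integral {0..m} (kern a e)" .
  have 2: "lam * integral {m..\<Theta>'} (kern a 0) \<le> integral {m..\<Theta>'} (kern a e)"
  proof (cases "m < \<Theta>'")
    case True
    have "lam * integral {m..\<Theta>'} (kern a 0) = integral {m..\<Theta>'} (\<lambda>u. lam * kern a 0 u)" by simp
    also have "\<dots> \<le> integral {m..\<Theta>'} (kern a e)"
    proof (rule integral_le)
      fix u assume "u \<in> {m..\<Theta>'}"
      hence "1 \<le> exp (- (e\<^sup>2 * X u))" using Xm'[OF _ True] by (simp add: mult_nonneg_nonpos)
      hence "kern a 0 u * (lam * 1) \<le> kern a e u"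
        unfolding fac by (intro mult_left_mono) (auto simp: kern_nonneg lam_def)
      thus "lam * kern a 0 u \<le> kern a e u" by (simp add: mult.commute)
    qed (use int[of m \<Theta>'] m assms in \<open>auto intro!: integrable_on_cmult_left\<close>)
    finally show ?thesis .
  next
    case False
    hence "m = \<Theta>'" using m by simp
    thus ?thesis by simp
  qed
  have 3: "0 \<le> integral {\<Theta>'..\<Theta>} (kern a e)"
    by (rule integral_nonneg) (use int assms kern_nonneg in auto)
  have "lam * integral {0..\<Theta>'} (kern a 0) - lam * e\<^sup>2 * (1 - half_tan m - 0.57 * m) \<le> integral {0..\<Theta>} (kern a e)"
    using 1 2 3 comb[of m \<Theta>' a 0] comb[of m \<Theta>' a e] comb[of \<Theta>' \<Theta> a e] m assms
    by (simp add: distrib_left)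
  moreover have "lam * e\<^sup>2 * (1 - half_tan m - 0.57 * m) \<le> lam * e\<^sup>2 * (2 * pi * 0.02208)"
    by (intro mult_left_mono half_tan_angle_bound) (use m assms in \<open>auto simp: lam_def\<close>)
  ultimately have "lam * integral {0..\<Theta>'} (kern a 0) - lam * e\<^sup>2 * (2 * pi * 0.02208) \<le> integral {0..\<Theta>} (kern a e)"
    by linarith
  hence "(lam * integral {0..\<Theta>'} (kern a 0) - lam * e\<^sup>2 * (2 * pi * 0.02208)) / (2 * pi) \<le> K a e \<Theta>"
    unfolding K_def by (rule divide_right_mono) simp
  thus ?thesis by (simp add: K_def diff_divide_distrib mult_ac)
qed

lemma hazard_slope_nonneg: "0 \<le> hazard_slope t"
proof -
  have "0 \<le> t + hazard t"
  proof (cases "t < 1")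
    case True
    have "\<bar>t\<bar> \<le> sqrt (t\<^sup>2 + 8)" by (rule real_le_rsqrt) simp
    thus ?thesis using hazard_lower[OF True] by linarith
  qed (use hazard_pos[of t] in simp)
  thus ?thesis using hazard_pos[of t] by (simp add: hazard_slope_def)
qed

lemma hazard_antimono: "x \<le> y \<Longrightarrow> hazard y \<le> hazard x"
  by (rule DERIV_nonpos_imp_nonincreasing[where f = hazard])
     (use DERIV_hazard hazard_slope_nonneg in \<open>auto intro!: exI\<close>)

text \<open>Log-concavity of \<open>Phi\<close>: the hazard rate is larger at the smaller
  argument.\<close>

lemma Phi_mult_antimono:
  assumes "0 \<le> u" "u \<le> v"
  shows "Phi (a + v) * Phi (a - v) \<le> Phi (a + u) * Phi (a - u)"
proof (rule DERIV_nonpos_imp_nonincreasing[OF assms(2), where f = "\<lambda>u. Phi (a + u) * Phi (a - u)"])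
  fix t assume t: "u \<le> t"
  have "((\<lambda>u. Phi (a + u) * Phi (a - u)) has_real_derivative
      \<phi> (a + t) * Phi (a - t) - Phi (a + t) * \<phi> (a - t)) (at t)"
    by (auto intro!: derivative_eq_intros)
  moreover have "hazard (a + t) \<le> hazard (a - t)" by (rule hazard_antimono) (use t assms in simp)
  hence "\<phi> (a + t) * Phi (a - t) - Phi (a + t) * \<phi> (a - t) \<le> 0"
    by (simp add: hazard_def divide_simps mult.commute)
  ultimately show "\<exists>y. ((\<lambda>u. Phi (a + u) * Phi (a - u)) has_real_derivative y) (at t) \<and> y \<le> 0" by blast
qed

lemma Phi_tail_values: "Phi (- 1.7) \<le> 0.0450" "Phi (- 0.82) \<le> 0.2062" "Phi (- 1.36) \<le> 0.0870"
proof -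
  have "0.955 \<le> Phi 1.7"
    by (rule Phi_ge_Taylor[where n = 5 and c = "0.39894228", OF _ _ inv_sqrt_2pi_ge])
       (simp_all add: Phi_Taylor_def lessThan_nat_numeral fact_numeral power_divide)
  moreover have "0.7938 \<le> Phi 0.82"
    by (rule Phi_ge_Taylor[where n = 3 and c = "0.39894228", OF _ _ inv_sqrt_2pi_ge])
       (simp_all add: Phi_Taylor_def lessThan_nat_numeral fact_numeral power_divide)
  moreover have "0.913 \<le> Phi 1.36"
    by (rule Phi_ge_Taylor[where n = 5 and c = "0.39894228", OF _ _ inv_sqrt_2pi_ge])
       (simp_all add: Phi_Taylor_def lessThan_nat_numeral fact_numeral power_divide)
  ultimately show "Phi (- 1.7) \<le> 0.0450" "Phi (- 0.82) \<le> 0.2062" "Phi (- 1.36) \<le> 0.0870"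
    by (simp_all add: Phi_minus)
qed

text \<open>Confines the thresholds to the range in which the decay estimates hold. The constant is
  0.91 * 0.192 / 4, from \<open>\<gamma>\<^sup>2 \<ge> 0.91\<close> and
  \<open>b1 * b2 - b12 > 0.192\<close>.\<close>

lemma threshold_range_aux:
  assumes "0 \<le> e" "0.04368 \<le> Phi (a + e) * Phi (a - e)" "0.04368 \<le> Phi (- (a + e)) * Phi (- (a - e))"
  shows "- 1.7 \<le> a - e" "- 0.82 \<le> a" "a \<le> 0 \<Longrightarrow> - a + min e (- a) \<le> 1.36"
proof -
  have le: "x * y \<le> x" if "0 < x" "y < 1" for x y :: real using that by (simp add: mult_le_cancel_left1)
  have "0.04368 \<le> Phi (- (a + e))"
    using assms(3) le[OF Phi_pos Phi_less_1, of "- (a + e)" "- (a - e)"] by linarith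
  hence "Phi (a + e) \<le> 0.95632" by (simp add: Phi_minus del: minus_add_distrib)
  hence "0.04368 \<le> 0.95632 * Phi (a - e)"
    using order_trans[OF assms(2) mult_right_mono[of "Phi (a + e)" "0.95632" "Phi (a - e)"]] by simp
  hence "Phi (- 1.7) \<le> Phi (a - e)" using Phi_tail_values(1) by (simp del: Phi_le_iff)
  thus "- 1.7 \<le> a - e" by (simp only: Phi_le_iff)
  show "- 0.82 \<le> a"
  proof (rule ccontr)
    assume "\<not> - 0.82 \<le> a"
    hence "Phi a \<le> 0.2062" using Phi_tail_values(2) Phi_le_iff[of a "- 0.82"] by (simp del: Phi_le_iff)
    hence "Phi a * Phi a \<le> 0.2062 * 0.2062" by (intro mult_mono) auto
    thus False using Phi_mult_antimono[of 0 e a] assms(1,2) by simp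
  qed
  show "- a + min e (- a) \<le> 1.36" if a: "a \<le> 0"
  proof (rule ccontr)
    define u where "u = min e (- a)"
    assume "\<not> - a + min e (- a) \<le> 1.36"
    hence u: "0 \<le> u" "u \<le> e" "a + u \<le> 0" "a - u \<le> - 1.36" using assms a by (auto simp: u_def)
    have "Phi (a + u) * Phi (a - u) \<le> 1 / 2 * 0.0870"
      using u(3,4) Phi_tail_values(3) Phi_le_iff[of "a + u" 0] Phi_le_iff[of "a - u" "- 1.36"]
      by (intro mult_mono) (auto simp del: Phi_le_iff)
    thus False using Phi_mult_antimono[OF u(1,2), of a] assms(2) by simp
  qed
qed

lemma threshold_range:
  assumes "0 \<le> e" "0.04368 \<le> Phi (a + e) * Phi (a - e)" "0.04368 \<le> Phi (- (a + e)) * Phi (- (a - e))"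
  shows "\<bar>a\<bar> \<le> 0.82" "\<bar>a\<bar> + min e \<bar>a\<bar> \<le> 1.36" "\<bar>a\<bar> + e \<le> 1.7"
proof -
  have "0.04368 \<le> Phi (- a + e) * Phi (- a - e)" "0.04368 \<le> Phi (- (- a + e)) * Phi (- (- a - e))"
    using assms(2,3) by (simp_all add: mult.commute add.commute)
  note 2 = threshold_range_aux[OF assms(1) this]
  note 1 = threshold_range_aux[OF assms]
  show "\<bar>a\<bar> \<le> 0.82" "\<bar>a\<bar> + min e \<bar>a\<bar> \<le> 1.36" "\<bar>a\<bar> + e \<le> 1.7"
    using 1 2 by (auto simp: abs_if)
qed

text \<open>Minkowski's inequality for geometric means: \<open>sqrt ((U - \<delta>) * (V -
  \<delta>)) + \<delta> \<le> sqrt (U * V)\<close>. It enters because \<open>Phi (- t)\<close>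
  exceeds \<open>\<gamma> * (1 - b) / 2\<close> by \<open>\<delta> = 1 - \<gamma>\<close>.\<close>

lemma shifted_product_le:
  fixes U V \<delta> :: real
  assumes "0 \<le> \<delta>" "\<delta> \<le> U" "\<delta> \<le> V"
  shows "(U - \<delta>) * (V - \<delta>) \<le> (sqrt (U * V) - \<delta>)\<^sup>2" "\<delta> \<le> sqrt (U * V)"
proof -
  have s: "sqrt (U * V) = sqrt U * sqrt V" "(sqrt U)\<^sup>2 = U" "(sqrt V)\<^sup>2 = V"
    using assms by (auto simp: real_sqrt_mult)
  have "0 \<le> \<delta> * (sqrt U - sqrt V)\<^sup>2" using assms by simp
  also have "\<dots> = \<delta> * (U + V - 2 * sqrt (U * V))"
    unfolding s(1) using s(2,3) by (simp add: power2_diff)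
  finally have "0 \<le> \<delta> * (U + V - 2 * sqrt (U * V))" .
  moreover have "(sqrt (U * V) - \<delta>)\<^sup>2 = U * V - 2 * \<delta> * sqrt (U * V) + \<delta>\<^sup>2"
    using assms by (simp add: power2_diff)
  ultimately show "(U - \<delta>) * (V - \<delta>) \<le> (sqrt (U * V) - \<delta>)\<^sup>2"
    by (simp add: power2_eq_square algebra_simps)
  have "\<delta> * \<delta> \<le> U * V" using assms by (intro mult_mono) auto
  thus "\<delta> \<le> sqrt (U * V)" by (intro real_le_rsqrt) (simp add: power2_eq_square)
qed

text \<open>The value of \<open>h\<close> at \<open>b1 = b2 = b\<close> when the correlation is \<open>- s\<close>.\<close>
definition hsym :: "real \<Rightarrow> real \<Rightarrow> real \<Rightarrow> real" where
  "hsym \<gamma> b s = (1 - \<gamma>) * (1 + \<gamma> * (1 + b)\<^sup>2 / 4) - \<gamma> * ((1 - b\<^sup>2) * s) / 4 + K (thr \<gamma> b) 0 (arcsin s)"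

lemma exp_ge_quadratic: "0 \<le> y \<Longrightarrow> 1 - exp (- y) \<ge> exp (- y) * (y + y\<^sup>2 / 2)" for y :: real
proof -
  assume "0 \<le> y"
  hence "exp (- y) * (1 + y + y\<^sup>2 / 2) \<le> exp (- y) * exp y"
    by (intro mult_left_mono exp_lower_Taylor_quadratic) auto
  thus ?thesis by (simp add: exp_minus algebra_simps)
qed

text \<open>The symmetric comparison point has the averaged \<^emph>\<open>threshold\<close>: then the exponent of the
  kernel changes by a pure \<open>e\<^sup>2\<close> term, and all remaining quantities decay like
  \<open>exp (- 0.57 e\<^sup>2)\<close> by log-concavity, which dominates.\<close>
lemma symmetrization:
  fixes \<gamma> b1 b2 b12 v :: real
  assumes g: "0.9539798 \<le> \<gamma>" "\<gamma> \<le> 0.95398"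
    and b: "- 1 < b1" "b1 < 1" "- 1 < b2" "b2 < 1"
  defines "w \<equiv> b1 * b2 - b12" and "A \<equiv> sqrt ((1 - b1\<^sup>2) * (1 - b2\<^sup>2))"
  assumes w: "0.192 < w" "w < A" "w \<le> (1 + b1) * (1 + b2)" "w \<le> (1 - b1) * (1 - b2)"
    and v: "v \<le> 0.000001"
  obtains b s e where "- 1 < b" "b < 1" "0 < s" "s < 1"
    "\<gamma> * (1 + b) \<le> 1 \<Longrightarrow> s * (1 - b\<^sup>2) \<le> (1 + b)\<^sup>2"
    "1 \<le> \<gamma> * (1 + b) \<Longrightarrow> s * (1 - b\<^sup>2) \<le> (1 - b)\<^sup>2"
    "0 \<le> hsym \<gamma> b s - v + e\<^sup>2 * (0.00415 - 0.00472 * (1 + b)\<^sup>2) + 0.00747 * (e\<^sup>2)\<^sup>2 \<Longrightarrow> v \<le> h \<gamma> b1 b2 b12"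
proof -
  have g01: "0 < \<gamma>" "\<gamma> < 1" using g by auto
  define P where "P = (1 + b1) * (1 + b2)"
  define P' where "P' = (1 - b1) * (1 - b2)"
  define t1 where "t1 = thr \<gamma> b1"
  define t2 where "t2 = thr \<gamma> b2"
  define a where "a = (t1 + t2) / 2"
  define e where "e = \<bar>t1 - t2\<bar> / 2"
  define \<delta> where "\<delta> = 1 - \<gamma>"
  define lam where "lam = exp (- 0.57 * e\<^sup>2)"
  \<comment> \<open>The bias whose threshold is exactly \<open>a\<close>; the biases themselves are
    not averaged.\<close>
  define b where "b = 2 * Phi a / \<gamma> - 1"
  have \<delta>: "0 \<le> \<delta>" using g by (simp add: \<delta>_def)
  have e0: "0 \<le> e" by (simp add: e_def)
  have lam: "0 < lam" "lam \<le> 1" by (auto simp: lam_def)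
  have ae: "(a + e = t1 \<and> a - e = t2) \<or> (a + e = t2 \<and> a - e = t1)"
    by (auto simp: a_def e_def abs_if field_simps)
  have Pt: "Phi t1 = \<gamma> * (1 + b1) / 2" "Phi t2 = \<gamma> * (1 + b2) / 2"
    using g01 b by (auto simp: t1_def t2_def)
  have Pm: "Phi (- t1) - \<delta> = \<gamma> * (1 - b1) / 2" "Phi (- t2) - \<delta> = \<gamma> * (1 - b2) / 2"
    by (simp_all add: Phi_minus Pt \<delta>_def field_simps)
  have PP: "Phi (a + e) * Phi (a - e) = \<gamma>\<^sup>2 / 4 * P"
  proof -
    have "Phi (a + e) * Phi (a - e) = Phi t1 * Phi t2" using ae by (metis mult.commute)
    thus ?thesis by (simp add: Pt P_def power2_eq_square)
  qed
  have UV: "\<delta> \<le> Phi (- (a + e))" "\<delta> \<le> Phi (- (a - e))"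
    "(Phi (- (a + e)) - \<delta>) * (Phi (- (a - e)) - \<delta>) = \<gamma>\<^sup>2 / 4 * P'"
  proof -
    have "0 < \<gamma> * (1 - b1) / 2" "0 < \<gamma> * (1 - b2) / 2" using g01 b by auto
    hence "\<delta> \<le> Phi (- t1)" "\<delta> \<le> Phi (- t2)" using Pm by linarith+
    thus "\<delta> \<le> Phi (- (a + e))" "\<delta> \<le> Phi (- (a - e))" using ae by auto
    show "(Phi (- (a + e)) - \<delta>) * (Phi (- (a - e)) - \<delta>) = \<gamma>\<^sup>2 / 4 * P'"
    proof -
      have "(Phi (- (a + e)) - \<delta>) * (Phi (- (a - e)) - \<delta>) = (Phi (- t1) - \<delta>) * (Phi (- t2) - \<delta>)"
        using ae by (metis mult.commute)
      thus ?thesis by (simp add: Pm P'_def power2_eq_square)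
    qed
  qed
  have Ppos: "0 < P" "0 < P'" using b by (auto simp: P_def P'_def)
  have g2: "0.9100 \<le> \<gamma>\<^sup>2" using power_mono[OF g(1), of 2] by (simp add: power2_eq_square)
  have lowP: "0.04368 \<le> Phi (a + e) * Phi (a - e)"
    using mult_mono[OF g2, of "0.192" P] w by (simp add: PP P_def)
  have lowP': "0.04368 \<le> Phi (- (a + e)) * Phi (- (a - e))"
  proof -
    have "0.04368 \<le> \<gamma>\<^sup>2 / 4 * P'" using mult_mono[OF g2, of "0.192" P'] w by (simp add: P'_def)
    also have "\<dots> \<le> Phi (- (a + e)) * Phi (- (a - e))"
      unfolding UV(3)[symmetric] using UV(1,2) \<delta> by (intro mult_mono) auto
    finally show ?thesis .
  qed
  note range = threshold_range[OF e0 lowP lowP']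
  define W where "W = Phi (- a)"
  have Phia: "\<gamma> / 2 * (1 + b) = Phi a" "\<gamma> / 2 * (1 - b) = W - \<delta>"
    using g01 by (auto simp: b_def W_def \<delta>_def Phi_minus field_simps)
  have "\<delta> < W"
  proof -
    have "0 < \<gamma> * (1 - b1) / 2" "0 < \<gamma> * (1 - b2) / 2" using g01 b by auto
    hence "\<delta> < Phi (- t1)" "\<delta> < Phi (- t2)" using Pm by linarith+
    hence "\<delta> < Phi (- (a + e))" using ae by auto
    also have "\<dots> \<le> W" using e0 by (simp add: W_def)
    finally show ?thesis .
  qed
  have "0 < 2 * Phi a / \<gamma>" using g01 by simp
  hence b1: "- 1 < b" unfolding b_def by linarith
  have "0 < \<gamma> / 2 * (1 - b)" unfolding Phia(2) using \<open>\<delta> < W\<close> by simp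
  hence b2: "b < 1" using g01 by (simp add: zero_less_mult_iff)
  have thr_b: "thr \<gamma> b = a"
    using Phia(1) by (simp add: thr_def)
  have Phi_le: "Phi (a + e) * Phi (a - e) \<le> (Phi a)\<^sup>2 * lam" if "a \<le> 0"
    unfolding lam_def using that e0 range by (intro Phi_mult_le) auto
  have W_le: "Phi (- (a + e)) * Phi (- (a - e)) \<le> W\<^sup>2 * lam" if "0 \<le> a"
    using Phi_mult_le[of "- a" e] that e0 range unfolding lam_def W_def by (simp add: mult.commute)
  have c1: "P \<le> lam * (1 + b)\<^sup>2" if "a \<le> 0"
  proof -
    have "\<gamma>\<^sup>2 / 4 * P \<le> \<gamma>\<^sup>2 / 4 * (lam * (1 + b)\<^sup>2)"
      using Phi_le[OF that] unfolding PP Phia(1)[symmetric] by (simp add: power_mult_distrib power_divide mult_ac)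
    thus ?thesis using g01 by simp
  qed
  have c2: "P' \<le> lam * (1 - b)\<^sup>2" if "0 \<le> a"
  proof -
    define S where "S = sqrt (Phi (- (a + e)) * Phi (- (a - e)))"
    have S: "\<gamma>\<^sup>2 / 4 * P' \<le> (S - \<delta>)\<^sup>2" "\<delta> \<le> S"
      using shifted_product_le[OF \<delta> UV(1,2)] unfolding UV(3) S_def by auto
    have "S \<le> sqrt (W\<^sup>2 * lam)" unfolding S_def by (intro real_sqrt_le_mono W_le that)
    also have "\<dots> = sqrt lam * W" by (simp add: real_sqrt_mult W_def)
    finally have "S - \<delta> \<le> sqrt lam * W - \<delta>" by simp
    also have "\<dots> \<le> sqrt lam * (W - \<delta>)"
      using \<delta> lam mult_right_mono[of "sqrt lam" 1 \<delta>] by (simp add: algebra_simps)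
    finally have "(S - \<delta>)\<^sup>2 \<le> (sqrt lam * (W - \<delta>))\<^sup>2" using S by (intro power_mono) auto
    hence "\<gamma>\<^sup>2 / 4 * P' \<le> \<gamma>\<^sup>2 / 4 * (lam * (1 - b)\<^sup>2)"
      using S(1) lam unfolding Phia(2)[symmetric] by (simp add: power_mult_distrib power_divide mult_ac)
    thus ?thesis using g01 by simp
  qed
  have P_ge: "exp (- e\<^sup>2) * (1 + b)\<^sup>2 \<le> P"
  proof -
    have "\<gamma>\<^sup>2 / 4 * (exp (- e\<^sup>2) * (1 + b)\<^sup>2) \<le> \<gamma>\<^sup>2 / 4 * P"
      using Phi_mult_ge[OF e0, of a] unfolding PP Phia(1)[symmetric] by (simp add: power_mult_distrib power_divide mult_ac)
    thus ?thesis using g01 by simp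
  qed
  \<comment> \<open>\<open>A\<close> is the geometric mean of \<open>P\<close> and
    \<open>P'\<close>. The product \<open>R * S\<close> decays like \<open>lam\<close> by the
    estimate for \<open>Phi_tails\<close>, while the negative term with \<delta> needs the opposite
    bound \<open>lam * Phi a \<le> R\<close>, which follows from
    \<open>lam\<^sup>2 \<le> exp (- e\<^sup>2)\<close>.\<close>
  have c3: "A \<le> lam * (1 - b\<^sup>2)"
  proof -
    define S where "S = sqrt (Phi (- (a + e)) * Phi (- (a - e)))"
    define R where "R = sqrt (Phi (a + e) * Phi (a - e))"
    have S: "\<gamma>\<^sup>2 / 4 * P' \<le> (S - \<delta>)\<^sup>2" "\<delta> \<le> S"
      using shifted_product_le[OF \<delta> UV(1,2)] unfolding UV(3) S_def by auto
    have R: "R\<^sup>2 = \<gamma>\<^sup>2 / 4 * P" "0 \<le> R" using PP Ppos by (auto simp: R_def)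
    have PP': "P * P' = (1 - b1\<^sup>2) * (1 - b2\<^sup>2)"
      by (simp add: P_def P'_def power2_eq_square algebra_simps)
    have "(\<gamma>\<^sup>2 / 4)\<^sup>2 * (P * P') = (\<gamma>\<^sup>2 / 4 * P) * (\<gamma>\<^sup>2 / 4 * P')" by (simp add: power2_eq_square)
    also have "\<dots> \<le> R\<^sup>2 * (S - \<delta>)\<^sup>2" unfolding R(1) using S(1) Ppos by (intro mult_left_mono) auto
    finally have "sqrt ((\<gamma>\<^sup>2 / 4)\<^sup>2 * (P * P')) \<le> sqrt ((R * (S - \<delta>))\<^sup>2)"
      by (intro real_sqrt_le_mono) (simp add: power_mult_distrib)
    hence "\<gamma>\<^sup>2 / 4 * A \<le> R * (S - \<delta>)"
      using R S by (simp add: real_sqrt_mult A_def PP')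
    also have "\<dots> = R * S - \<delta> * R" by (simp add: algebra_simps)
    also have "\<dots> \<le> lam * (Phi a * W) - \<delta> * (lam * Phi a)"
    proof (intro diff_mono mult_left_mono)
      have "R * S = sqrt (Phi_tails (a + e) * Phi_tails (a - e))"
        by (simp add: R_def S_def Phi_tails_def real_sqrt_mult mult_ac)
      also have "\<dots> \<le> sqrt ((Phi_tails a)\<^sup>2 * exp (- 1.14 * e\<^sup>2))"
        by (intro real_sqrt_le_mono Phi_tails_mult_le e0 range)
      also have "exp (- 1.14 * e\<^sup>2) = lam\<^sup>2"
        by (simp add: lam_def exp_double[symmetric])
      finally show "R * S \<le> lam * (Phi a * W)"
        using lam by (simp add: Phi_tails_def W_def real_sqrt_mult mult_ac)
      have "lam * Phi a = sqrt ((Phi a)\<^sup>2 * lam\<^sup>2)" using lam by (simp add: real_sqrt_mult mult_ac)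
      also have "\<dots> \<le> sqrt ((Phi a)\<^sup>2 * exp (- e\<^sup>2))"
        by (intro real_sqrt_le_mono mult_left_mono) (auto simp: lam_def exp_double[symmetric])
      also have "\<dots> \<le> R" unfolding R_def by (intro real_sqrt_le_mono Phi_mult_ge e0)
      finally show "lam * Phi a \<le> R" .
    qed (use \<delta> in auto)
    also have "\<dots> = lam * (Phi a * (W - \<delta>))" by (simp add: algebra_simps)
    also have "\<dots> = \<gamma>\<^sup>2 / 4 * (lam * (1 - b\<^sup>2))"
      unfolding Phia[symmetric] by (simp add: power2_eq_square algebra_simps)
    finally show ?thesis using g01 by simp
  qed
  have bb: "0 < 1 - b\<^sup>2" using square_less_2[OF b1 b2] by simp
  \<comment> \<open>Chosen so that \<open>w = lam * ((1 - b\<^sup>2) * s)\<close>. By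
    \<open>c3\<close> it is at most \<open>s0\<close>, the absolute value of the original
    correlation, so the angle only shrinks.\<close>
  define s where "s = w / (lam * (1 - b\<^sup>2))"
  define s0 where "s0 = w / A"
  have A: "0 < A" using w(1,2) by simp
  have ws: "w = lam * ((1 - b\<^sup>2) * s)" using lam bb by (simp add: s_def)
  have s0: "0 < s0" "s0 < 1" "w = s0 * A" using w A by (auto simp: s0_def)
  have ss: "s \<le> s0" unfolding s_def s0_def using w A c3 by (intro divide_left_mono) (auto intro: mult_pos_pos lam bb)
  have s: "0 < s" "s < 1"
  proof -
    show "0 < s" unfolding s_def using s0 A lam bb by (intro divide_pos_pos mult_pos_pos) auto
    show "s < 1" using ss s0 by linarith
  qed
  have hK: "h \<gamma> b1 b2 b12 = (1 - \<gamma>) * (1 + \<gamma> * P / 4) - \<gamma> * w / 4 + K a ((t1 - t2) / 2) (arcsin s0)"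
    unfolding P_def w_def a_def t1_def t2_def
    by (rule h_negative_correlation[OF g01 b]) (use s0 in \<open>auto simp: A_def w_def\<close>)
  have "lam * K a 0 (arcsin s) - 0.02208 * e\<^sup>2 * lam \<le> K a e (arcsin s0)"
    unfolding lam_def
    by (rule K_split) (use s s0 ss arcsin_less_arcsin[of s0 1] in \<open>auto intro: arcsin_nonneg arcsin_le_arcsin\<close>)
  also have "K a e (arcsin s0) = K a ((t1 - t2) / 2) (arcsin s0)"
    by (simp add: K_def kern_def[abs_def] e_def power_divide)
  finally have Kge: "lam * K a 0 (arcsin s) - 0.02208 * e\<^sup>2 * lam \<le> K a ((t1 - t2) / 2) (arcsin s0)" .
  show thesis
  proof (rule that[OF b1 b2 s])
    assume "\<gamma> * (1 + b) \<le> 1"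
    hence "Phi a \<le> Phi 0" using Phia(1) by simp
    hence "a \<le> 0" by (simp del: Phi_0)
    hence "lam * ((1 - b\<^sup>2) * s) \<le> lam * (1 + b)\<^sup>2" using c1 w unfolding ws[symmetric] P_def by linarith
    thus "s * (1 - b\<^sup>2) \<le> (1 + b)\<^sup>2" using lam by (simp add: mult.commute)
  next
    assume "1 \<le> \<gamma> * (1 + b)"
    hence "Phi 0 \<le> Phi a" using Phia(1) by simp
    hence "0 \<le> a" by (simp del: Phi_0)
    hence "lam * ((1 - b\<^sup>2) * s) \<le> lam * (1 - b)\<^sup>2" using c2 w unfolding ws[symmetric] P'_def by linarith
    thus "s * (1 - b\<^sup>2) \<le> (1 - b)\<^sup>2" using lam by (simp add: mult.commute)
  next
    define X where "X = (1 + b)\<^sup>2"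
    define y where "y = 0.57 * e\<^sup>2"
    assume *: "0 \<le> hsym \<gamma> b s - v + e\<^sup>2 * (0.00415 - 0.00472 * (1 + b)\<^sup>2) + 0.00747 * (e\<^sup>2)\<^sup>2"
    have X: "0 \<le> X" by (simp add: X_def)
    have y: "0 \<le> y" "lam = exp (- y)" by (auto simp: y_def lam_def)
    \<comment> \<open>The gain from the factor \<open>1 - lam\<close>; 0.046019 = 1 - 0.95398 -
      0.000001.\<close>
    have 1: "0.046019 * (lam * (y + y\<^sup>2 / 2)) \<le> (1 - \<gamma> - v) * (1 - lam)"
      using exp_ge_quadratic[OF y(1)] g v y lam by (intro mult_mono) auto
    \<comment> \<open>The exponent 0.43 is 1 - 0.57, the gap between the two decay rates; times
      0.0109765, which bounds \<open>(1 - \<gamma>) * \<gamma> / 4\<close>, it yields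
      0.00472.\<close>
    have "lam * X - P \<le> lam * X - exp (- e\<^sup>2) * X" using P_ge by (simp add: X_def)
    also have "exp (- e\<^sup>2) = lam * exp (- 0.43 * e\<^sup>2)" by (simp add: lam_def exp_add[symmetric])
    also have "lam * X - lam * exp (- 0.43 * e\<^sup>2) * X = lam * X * (1 - exp (- 0.43 * e\<^sup>2))" by (simp add: algebra_simps)
    also have "\<dots> \<le> lam * X * (0.43 * e\<^sup>2)"
      using exp_ge_add_one_self[of "- 0.43 * e\<^sup>2"] lam X by (intro mult_left_mono) auto
    finally have "(1 - \<gamma>) * \<gamma> / 4 * (lam * X - P) \<le> (1 - \<gamma>) * \<gamma> / 4 * (lam * X * (0.43 * e\<^sup>2))"
      using g by (intro mult_left_mono) auto
    also have "\<dots> \<le> 0.0109765 * (lam * X * (0.43 * e\<^sup>2))"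
    proof (rule mult_right_mono)
      have "(1 - \<gamma>) * \<gamma> \<le> 0.0460202 * 0.95398" using g by (intro mult_mono) auto
      thus "(1 - \<gamma>) * \<gamma> / 4 \<le> 0.0109765" by (simp add: mult.commute)
    qed (use lam X in auto)
    also have "0.0109765 * (lam * X * (0.43 * e\<^sup>2)) = 0.004719895 * (lam * X * e\<^sup>2)" by simp
    also have "\<dots> \<le> 0.00472 * (lam * X * e\<^sup>2)"
      by (rule mult_right_mono) (use lam X in auto)
    finally have 2: "(1 - \<gamma>) * \<gamma> / 4 * (lam * X - P) \<le> 0.00472 * (lam * X * e\<^sup>2)" .
    \<comment> \<open>The budget: 0.046019 * 0.57 covers 0.00415 + 0.02208, the latter being the
      loss in \<open>K_split\<close>, and 0.046019 * 0.57^2 / 2 covers 0.00747.\<close>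
    have 3: "lam * e\<^sup>2 * 0.00415 + lam * (0.00747 * (e\<^sup>2)\<^sup>2) + 0.02208 * e\<^sup>2 * lam \<le> 0.046019 * (lam * (y + y\<^sup>2 / 2))"
    proof -
      have e4: "0 \<le> e ^ 4" by (rule zero_le_even_power) simp
      have "e\<^sup>2 * 0.00415 + 0.00747 * (e\<^sup>2)\<^sup>2 + 0.02208 * e\<^sup>2 \<le> 0.046019 * (y + y\<^sup>2 / 2)"
        by (simp add: y_def power_mult_distrib power_divide)
          (insert zero_le_power2[of e] e4, linarith)
      from mult_left_mono[OF this, of lam] lam show ?thesis by (simp add: algebra_simps)
    qed
    have "0 \<le> lam * (hsym \<gamma> b s - v + e\<^sup>2 * (0.00415 - 0.00472 * X) + 0.00747 * (e\<^sup>2)\<^sup>2)"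
      using * lam unfolding X_def by simp
    also have "\<dots> = lam * ((1 - \<gamma>) * (1 + \<gamma> * X / 4)) - \<gamma> * w / 4 + lam * K a 0 (arcsin s) - lam * v
      + (lam * e\<^sup>2 * 0.00415 + lam * (0.00747 * (e\<^sup>2)\<^sup>2)) - 0.00472 * (lam * X * e\<^sup>2)"
      unfolding hsym_def thr_b ws X_def[symmetric] by (simp add: algebra_simps)
    also have "\<dots> \<le> h \<gamma> b1 b2 b12 - v"
    proof -
      have "lam * ((1 - \<gamma>) * (1 + \<gamma> * X / 4)) = (1 - \<gamma>) * (1 + \<gamma> * P / 4) - (1 - \<gamma>) * (1 - lam) + (1 - \<gamma>) * \<gamma> / 4 * (lam * X - P)"
        by (simp add: field_simps)
      moreover have "(1 - \<gamma> - v) * (1 - lam) = (1 - \<gamma>) * (1 - lam) - v + lam * v" by (simp add: algebra_simps)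
      moreover have "L - gw + lk - lv + (T1 + T2) - Q \<le> B - gw + KK - v"
        if "L = B - D + E" "D' = D - v + lv" "S \<le> D'" "E \<le> Q" "T1 + T2 + T3 \<le> S" "lk - T3 \<le> KK"
        for L B D E D' lv S Q T1 T2 T3 lk KK gw :: real
        using that by linarith
      ultimately show ?thesis using 1 2 3 Kge unfolding hK by blast
    qed
    finally show "v \<le> h \<gamma> b1 b2 b12" by simp
  qed
qed

section \<open>Symmetric configurations\<close>

lemma DERIV_inverse_half_tan:
  assumes "0 < cos u"
  shows "((\<lambda>u. 1 / half_tan u) has_real_derivative 1 / (1 - sin u)) (at u within S)"
proof -
  note s = cos_pos_sin[OF assms]
  have ht: "half_tan u \<noteq> 0" "1 + sin u \<noteq> 0" using assms s by (auto simp: half_tan_def)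
  have "(half_tan u)\<^sup>2 = (1 - sin u) / (1 + sin u)"
    using half_tan_sq[of u] s by (simp add: field_simps)
  hence "- (- 1 / (1 + sin u)) / (half_tan u * half_tan u) = 1 / (1 - sin u)"
    using ht(2) s by (simp add: power2_eq_square)
  thus ?thesis
    by (intro DERIV_cong[OF DERIV_divide[OF DERIV_const DERIV_half_tan[OF ht(2)] ht(1)]]) simp
qed

text \<open>Integrates \<open>exp (- x) \<ge> 1 - x\<close>; a primitive of
  \<open>1 / (1 - sin u)\<close> is \<open>1 / half_tan u\<close>.\<close>

lemma K_tangent:
  assumes "0 \<le> \<Theta>" "\<Theta> < pi / 2"
  shows "(\<Theta> - a\<^sup>2 * (1 / half_tan \<Theta> - 1)) / (2 * pi) \<le> K a 0 \<Theta>"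
proof -
  have cp: "cos u > 0" if "u \<in> {0..\<Theta>}" for u using that assms by (intro cos_gt_zero_pi) auto
  have "((\<lambda>u. 1 - a\<^sup>2 / (1 - sin u)) has_integral (\<Theta> - a\<^sup>2 * (1 / half_tan \<Theta>)) - (0 - a\<^sup>2 * (1 / half_tan 0))) {0..\<Theta>}"
  proof (rule fundamental_theorem_of_calculus[OF assms(1)])
    fix u assume u: "u \<in> {0..\<Theta>}"
    have "((\<lambda>u. u - a\<^sup>2 * (1 / half_tan u)) has_real_derivative 1 - a\<^sup>2 * (1 / (1 - sin u))) (at u within {0..\<Theta>})"
      by (intro DERIV_diff DERIV_ident DERIV_cmult DERIV_inverse_half_tan cp u)
    thus "((\<lambda>u. u - a\<^sup>2 * (1 / half_tan u)) has_vector_derivative 1 - a\<^sup>2 / (1 - sin u)) (at u within {0..\<Theta>})"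
      by (simp add: has_real_derivative_iff_has_vector_derivative)
  qed
  hence I: "((\<lambda>u. 1 - a\<^sup>2 / (1 - sin u)) has_integral (\<Theta> - a\<^sup>2 * (1 / half_tan \<Theta> - 1))) {0..\<Theta>}"
    by (simp add: half_tan_def algebra_simps)
  have "\<Theta> - a\<^sup>2 * (1 / half_tan \<Theta> - 1) \<le> integral {0..\<Theta>} (kern a 0)"
  proof (rule has_integral_le[OF I integrable_integral])
    show "kern a 0 integrable_on {0..\<Theta>}"
      by (intro integrable_continuous_real continuous_on_kern cp)
    fix u
    show "1 - a\<^sup>2 / (1 - sin u) \<le> kern a 0 u"
      using exp_ge_add_one_self[of "- (a\<^sup>2 / (1 - sin u))"] by (simp add: kern_def)
  qed
  thus ?thesis unfolding K_def by (intro divide_right_mono) auto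
qed

lemma K_mono:
  assumes "0 \<le> \<Theta>'" "\<Theta>' \<le> \<Theta>" "\<Theta> < pi / 2"
  shows "K a e \<Theta>' \<le> K a e \<Theta>"
proof -
  have "kern a e integrable_on {0..v}" if "v \<le> \<Theta>" for v
    by (intro integrable_continuous_real continuous_on_kern cos_gt_zero_pi) (use that assms in auto)
  thus ?thesis unfolding K_def using assms
    by (intro divide_right_mono integral_subset_le) (auto simp: kern_nonneg)
qed

text \<open>Half-angle substitution: \<open>s\<close> becomes rational in \<open>k\<close> and the
  angle becomes an arctangent.\<close>

lemma half_tan_param:
  assumes "0 < s" "s < 1"
  obtains k where "0 < k" "k < 1" "s = (1 - k\<^sup>2) / (1 + k\<^sup>2)" "k\<^sup>2 = (1 - s) / (1 + s)"
    "half_tan (arcsin s) = k" "arcsin s = pi / 2 - 2 * arctan k" "0 \<le> arcsin s" "arcsin s < pi / 2"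
proof -
  define k where "k = half_tan (arcsin s)"
  have as: "0 \<le> arcsin s" "arcsin s < pi / 2" "sin (arcsin s) = s"
    using assms arcsin_less_arcsin[of s 1] arcsin_nonneg by auto
  have k: "0 < k" "k \<le> 1" using half_tan_bounds[OF as(1,2)] by (auto simp: k_def)
  have "1 + k\<^sup>2 = 2 / (1 + s)" using half_tan_sq[of "arcsin s"] as assms by (simp add: k_def)
  hence k2: "k\<^sup>2 = (1 - s) / (1 + s)" using assms by (simp add: field_simps)
  hence "s * (1 + k\<^sup>2) = 1 - k\<^sup>2" using assms by (simp add: field_simps)
  moreover have "1 + k\<^sup>2 > 0" by (simp add: add_pos_nonneg)
  ultimately have s: "s = (1 - k\<^sup>2) / (1 + k\<^sup>2)" by (simp add: eq_divide_eq)
  have "k \<noteq> 1" using s assms by auto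
  hence "k < 1" using k by simp
  show ?thesis
    by (rule that[OF k(1) \<open>k < 1\<close> s k2])
       (use as(1,2) angle_half_tan[OF as(1) less_imp_le[OF as(2)]] in \<open>simp_all add: k_def\<close>)
qed

text \<open>Concavity of \<open>Phi\<close> on the nonnegative axis: its graph lies above the chord
  from 0 to \<open>U\<close>. With the symmetry of \<open>Phi\<close> this bounds a threshold
  linearly by the distance of its probability from 1/2.\<close>

lemma abs_le_of_Phi:
  assumes "\<bar>Phi a - 1 / 2\<bar> \<le> q" "q \<le> Phi U - 1 / 2" "0 < q" "0 \<le> U"
  shows "\<bar>a\<bar> \<le> U / q * \<bar>Phi a - 1 / 2\<bar>"
proof -
  have *: "u \<le> U / q * (Phi u - 1 / 2)" if "0 < u" "Phi u - 1 / 2 \<le> q" for u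
  proof -
    have "Phi u \<le> Phi U" using that assms by linarith
    hence uU: "u \<le> U" by simp
    have "\<exists>x>0. x < u \<and> Phi u - Phi 0 = (u - 0) * \<phi> x"
      by (rule MVT2) (use that DERIV_Phi in auto)
    then obtain x where x: "0 < x" "x < u" "Phi u - Phi 0 = (u - 0) * \<phi> x" by blast
    have "Phi U - Phi u \<le> (U - u) * \<phi> x"
    proof (cases "u = U")
      case False
      have "\<exists>y>u. y < U \<and> Phi U - Phi u = (U - u) * \<phi> y"
        by (rule MVT2) (use False uU DERIV_Phi in auto)
      then obtain y where y: "u < y" "y < U" "Phi U - Phi u = (U - u) * \<phi> y" by blast
      have "\<phi> y \<le> \<phi> x" using x y by (intro std_normal_density_abs_mono) auto
      thus ?thesis unfolding y(3) using uU by (intro mult_left_mono) auto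
    qed simp
    hence "u * (Phi U - Phi u) \<le> u * ((U - u) * \<phi> x)" using that by (intro mult_left_mono) auto
    moreover have "Phi u - 1 / 2 = u * \<phi> x" using x(3) by simp
    ultimately have "u * (Phi U - 1 / 2) \<le> U * (Phi u - 1 / 2)" by (simp add: algebra_simps)
    moreover have "u * q \<le> u * (Phi U - 1 / 2)" using assms that by (intro mult_left_mono) auto
    ultimately show ?thesis using assms(3) by (simp add: field_simps)
  qed
  consider "a = 0" | "0 < a" | "a < 0" by linarith
  thus ?thesis
  proof cases
    case 2
    hence "Phi 0 < Phi a" by (simp del: Phi_0)
    thus ?thesis using *[of a] assms 2 by simp
  next
    case 3
    hence "Phi a < Phi 0" by (simp del: Phi_0)
    thus ?thesis using *[of "- a"] assms 3 by (simp add: Phi_minus abs_if)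
  qed simp
qed

lemma abs_ge_of_Phi: "\<bar>Phi a - 1 / 2\<bar> \<le> inv_sqrt_2pi * \<bar>a\<bar>"
proof -
  have *: "Phi u - 1 / 2 \<le> inv_sqrt_2pi * u" if "0 \<le> u" for u
    using Phi_bounds_Taylor(2)[OF that, of 0] by (simp add: Phi_Taylor_def)
  show ?thesis
  proof (cases "0 \<le> a")
    case True
    hence "Phi 0 \<le> Phi a" by (simp del: Phi_0)
    thus ?thesis using *[of a] True by simp
  next
    case False
    hence "Phi a \<le> Phi 0" by (simp del: Phi_0)
    thus ?thesis using *[of "- a"] False by (simp add: Phi_minus abs_if)
  qed
qed

text \<open>In terms of the angle this is
  \<open>\<theta> / (2 * pi) - 0.238495 * sin \<theta>\<close>, with 0.238495 = 0.95398 / 4. The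
  minimum lies near k = 0.38, whence the tangent to arctan there.\<close>

lemma angle_profile_ge:
  assumes "0 < k" "k \<le> 1"
  shows "(pi / 2 - 2 * arctan k) / (2 * pi) - 0.238495 * ((1 - k\<^sup>2) / (1 + k\<^sup>2)) \<ge> - 0.0440"
proof -
  have "arctan 0.38 \<le> arctan_Taylor (2 * 3 + 1) 0.38"
    by (rule arctan_bounds_Taylor) simp
  also have "\<dots> \<le> 0.36315"
    by (simp add: arctan_Taylor_def lessThan_nat_numeral power_divide)
  finally have "arctan k \<le> 0.36315 + (k - 0.38) / (1 + 0.38\<^sup>2)"
    using arctan_le_tangent[of "0.38" k] assms by simp
  also have "\<dots> \<le> 0.03111 + 0.87382 * k"
    using assms by (simp add: power2_eq_square field_simps)
  finally have "arctan k / pi \<le> (0.03111 + 0.87382 * k) / pi" by (intro divide_right_mono) auto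
  also have "\<dots> \<le> 0.318311 * (0.03111 + 0.87382 * k)"
  proof -
    have "1 / pi \<le> 0.318311" using pi_approx by (simp add: divide_simps)
    from mult_right_mono[OF this, of "0.03111 + 0.87382 * k"] assms show ?thesis by simp
  qed
  finally have 1: "arctan k / pi \<le> 0.00991 + 0.27815 * k" using assms by simp
  \<comment> \<open>What remains is a cubic inequality in \<open>k\<close>; around 0.38 it follows
    with the help of the nonnegative expressions in \<open>N1\<close> and \<open>N2\<close>.\<close>
  define t where "t = k - 0.38"
  have t: "t \<le> 0.62" using assms by (simp add: t_def)
  have N1: "0 \<le> 0.033 * (t - 0.0224)\<^sup>2" by simp
  have N2: "0 \<le> t\<^sup>2 * (0.172494 - 0.27815 * t)" using t by (intro mult_nonneg_nonneg) auto
  have p: "0.476990 \<le> (0.522585 - 0.27815 * k) * (1 + k\<^sup>2)"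
    using N1 N2 assms unfolding t_def
    by (simp add: power2_eq_square algebra_simps add_divide_distrib diff_divide_distrib)
  have px: "1 + k\<^sup>2 > 0" by (simp add: add_pos_nonneg)
  define D where "D = inverse (1 + k\<^sup>2)"
  have D: "0 < D" "(1 + k\<^sup>2) * D = 1" using px by (auto simp: D_def)
  have "0.476990 * D \<le> (0.522585 - 0.27815 * k) * (1 + k\<^sup>2) * D"
    by (rule mult_right_mono[OF p]) (use D in simp)
  also have "\<dots> = 0.522585 - 0.27815 * k" unfolding mult.assoc D(2) by simp
  finally have "0.476990 * D \<le> 0.522585 - 0.27815 * k" .
  moreover have "(1 - k\<^sup>2) / (1 + k\<^sup>2) = 2 * D - 1"
    using D(2) by (simp add: D_def[symmetric] divide_inverse algebra_simps)
  ultimately have 2: "0.238495 * ((1 - k\<^sup>2) / (1 + k\<^sup>2)) \<le> 0.25 - 0.00991 - 0.27815 * k + 0.0440"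
    by simp
  have "(pi / 2 - 2 * arctan k) / (2 * pi) = 0.25 - arctan k / pi"
    by (simp add: field_simps)
  thus ?thesis using 1 2 by simp
qed

section \<open>Lower bounds for \<open>hsym\<close> on ranges of \<open>b\<close>\<close>

lemma hsym_ge:
  fixes \<gamma> b s :: real
  assumes g: "0.9539798 \<le> \<gamma>" "\<gamma> \<le> 0.95398"
    and b: "- 1 < b" "b < 1" and s: "0 < s" "s < 1"
  obtains k where "0 < k" "k < 1" "s = (1 - k\<^sup>2) / (1 + k\<^sup>2)" "k\<^sup>2 = (1 - s) / (1 + s)"
    "(1 - \<gamma>) * (1 + \<gamma> * (1 + b)\<^sup>2 / 4) - \<gamma> * ((1 - b\<^sup>2) * s) / 4 +
      (pi / 2 - 2 * arctan k - (thr \<gamma> b)\<^sup>2 * (1 / k - 1)) / (2 * pi) \<le> hsym \<gamma> b s"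
proof -
  obtain k where k: "0 < k" "k < 1" "s = (1 - k\<^sup>2) / (1 + k\<^sup>2)" "k\<^sup>2 = (1 - s) / (1 + s)"
    "half_tan (arcsin s) = k" "arcsin s = pi / 2 - 2 * arctan k" "0 \<le> arcsin s" "arcsin s < pi / 2"
    using half_tan_param[OF s] by blast
  show ?thesis
    by (rule that[OF k(1-4)]) (use K_tangent[OF k(7,8), of "thr \<gamma> b"] k(5,6) in \<open>simp add: hsym_def\<close>)
qed

lemma hsym_base_ge:
  fixes \<gamma> X :: real
  assumes "0.9539798 \<le> \<gamma>" "\<gamma> \<le> 0.95398" "0 \<le> X"
  shows "0.04602 * (1 + 0.23849 * X) \<le> (1 - \<gamma>) * (1 + \<gamma> * X / 4)"
proof (rule mult_mono)
  show "1 + 0.23849 * X \<le> 1 + \<gamma> * X / 4"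
    using mult_right_mono[of "0.95396" \<gamma> X] assms by simp
qed (use assms in auto)

text \<open>Used when \<open>s\<close> is not small: the maximal angle does not enter, only a lower bound for its \<open>half_tan\<close>.\<close>
lemma hsym_ge_quadratic:
  fixes \<gamma> b s k0 y :: real
  assumes g: "0.9539798 \<le> \<gamma>" "\<gamma> \<le> 0.95398"
    and b: "- 1 < b" "b < 1" and s: "0 < s" "s < 1"
    and y: "\<bar>\<gamma> * (1 + b) / 2 - 1 / 2\<bar> \<le> y" "y \<le> 0.0729" and k0: "0 < k0" "k0\<^sup>2 \<le> (1 - s) / (1 + s)"
  shows "0.04602 * (1 + 0.23849 * (1 + b)\<^sup>2) - 0.0440 + 0.23849 * (b\<^sup>2 * s) - 1.014 * (y\<^sup>2 * (1 / k0 - 1)) \<le> hsym \<gamma> b s"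
proof -
  obtain k where k: "0 < k" "k < 1" "s = (1 - k\<^sup>2) / (1 + k\<^sup>2)" "k\<^sup>2 = (1 - s) / (1 + s)"
    "(1 - \<gamma>) * (1 + \<gamma> * (1 + b)\<^sup>2 / 4) - \<gamma> * ((1 - b\<^sup>2) * s) / 4 +
      (pi / 2 - 2 * arctan k - (thr \<gamma> b)\<^sup>2 * (1 / k - 1)) / (2 * pi) \<le> hsym \<gamma> b s"
    by (rule hsym_ge[OF g b s])
  have "k0\<^sup>2 \<le> k\<^sup>2" unfolding k(4) by (rule k0(2))
  hence k0k: "k0 \<le> k" by (rule power2_le_imp_le) (use k(1) in simp)
  define a where "a = thr \<gamma> b"
  have Pa: "Phi a = \<gamma> * (1 + b) / 2" using g b by (simp add: a_def)
  \<comment> \<open>Probabilities within 0.0729 of 1/2 have thresholds within 0.184 of 0; (0.184 /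
    0.0729)^2 is below 6.3707, and 6.3707 / (2 pi) is below 1.014.\<close>
  have "0.0729 \<le> Phi 0.184 - 1 / 2"
  proof -
    have "0.5729 \<le> Phi 0.184"
      by (rule Phi_ge_Taylor[where n = 1 and c = "0.39894228", OF _ _ inv_sqrt_2pi_ge])
         (simp_all add: Phi_Taylor_def lessThan_nat_numeral fact_numeral power_divide)
    thus ?thesis by simp
  qed
  hence "\<bar>a\<bar> \<le> 0.184 / 0.0729 * \<bar>Phi a - 1 / 2\<bar>"
    using y by (intro abs_le_of_Phi) (auto simp: Pa)
  also have "\<dots> \<le> 0.184 / 0.0729 * y" using y by (simp add: Pa)
  finally have "\<bar>a\<bar> \<le> 0.184 / 0.0729 * y" .
  hence "\<bar>a\<bar>\<^sup>2 \<le> (0.184 / 0.0729 * y)\<^sup>2" by (intro power_mono) auto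
  hence "a\<^sup>2 \<le> (0.184 / 0.0729)\<^sup>2 * y\<^sup>2" by (simp only: power2_abs power_mult_distrib)
  also have "\<dots> \<le> 6.3707 * y\<^sup>2" by (intro mult_right_mono) (simp_all add: power_divide)
  finally have a2: "a\<^sup>2 \<le> 6.3707 * y\<^sup>2" .
  have "a\<^sup>2 * (1 / k - 1) \<le> (6.3707 * y\<^sup>2) * (1 / k0 - 1)"
    using a2 k(1,2) k0(1) k0k by (intro mult_mono diff_mono divide_left_mono) auto
  hence "a\<^sup>2 * (1 / k - 1) / (2 * pi) \<le> (6.3707 * y\<^sup>2) * (1 / k0 - 1) / (2 * pi)"
    by (intro divide_right_mono) auto
  also have "\<dots> = (6.3707 / (2 * pi)) * (y\<^sup>2 * (1 / k0 - 1))" by simp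
  also have "\<dots> \<le> 1.014 * (y\<^sup>2 * (1 / k0 - 1))"
  proof (rule mult_right_mono)
    show "6.3707 / (2 * pi) \<le> 1.014" using pi_approx by (simp add: divide_simps)
    show "0 \<le> y\<^sup>2 * (1 / k0 - 1)" using k0(1) k0k k(1,2) by simp
  qed
  finally have pen: "a\<^sup>2 * (1 / k - 1) / (2 * pi) \<le> 1.014 * (y\<^sup>2 * (1 / k0 - 1))" .
  have u: "- 0.0440 \<le> (pi / 2 - 2 * arctan k) / (2 * pi) - 0.238495 * s"
    using angle_profile_ge[of k] k(1,2) unfolding k(3)[symmetric] by simp
  have gs: "\<gamma> * ((1 - b\<^sup>2) * s) / 4 \<le> 0.238495 * s - 0.23849 * (b\<^sup>2 * s)"
  proof -
    have "\<gamma> * s \<le> 0.95398 * s" by (rule mult_right_mono) (use g s in auto)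
    moreover have "0.95396 * (b\<^sup>2 * s) \<le> \<gamma> * (b\<^sup>2 * s)" by (rule mult_right_mono) (use g s in auto)
    moreover have "\<gamma> * ((1 - b\<^sup>2) * s) / 4 = \<gamma> * s / 4 - \<gamma> * (b\<^sup>2 * s) / 4"
      by (simp add: left_diff_distrib right_diff_distrib diff_divide_distrib)
    moreover have "x / 4 - y / 4 \<le> 0.238495 * u - 0.23849 * z" if "x \<le> 0.95398 * u" "0.95396 * z \<le> y"
      for x y z u :: real using that by (simp add: field_simps)
    ultimately show ?thesis by metis
  qed
  have split: "(pi / 2 - 2 * arctan k - a\<^sup>2 * (1 / k - 1)) / (2 * pi) =
      (pi / 2 - 2 * arctan k) / (2 * pi) - a\<^sup>2 * (1 / k - 1) / (2 * pi)"
    by (rule diff_divide_distrib)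
  have "L - P + Q - R \<le> H"
    if "base - p + (q - r) \<le> H" "L \<le> base" "r \<le> R" "- P \<le> q - S" "p \<le> S - Q"
    for L P Q R S H base p q r :: real using that by linarith
  thus ?thesis
    using k(5) hsym_base_ge[OF g zero_le_power2] pen u gs unfolding a_def[symmetric] split by blast
qed

text \<open>Used when \<open>b\<close> is far from 0, where \<open>s\<close> is small: here \<open>s \<le> arcsin s\<close> is sharp enough and
  the bound becomes linear in \<open>s\<close>.\<close>
lemma hsym_ge_linear:
  fixes \<gamma> b s s0 k0 r y C :: real
  assumes g: "0.9539798 \<le> \<gamma>" "\<gamma> \<le> 0.95398"
    and b: "- 1 < b" "b < 1" and s: "0 < s" "s < 1" "s \<le> s0"
    and a: "(thr \<gamma> b)\<^sup>2 \<le> C" and r: "1 + k0\<^sup>2 \<le> r * (k0 + k0\<^sup>2)" "1 \<le> r"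
    and k0: "0 < k0" "k0\<^sup>2 * (1 + s0) \<le> 1 - s0" and Cr: "C * r \<le> 1"
    and F: "v \<le> 0.04602 * (1 + 0.23849 * (1 + b)\<^sup>2) - 0.238495 * ((1 - b\<^sup>2) * s0) + 0.159154 * (s0 * (1 - C * r))"
    and v: "v \<le> 0.046"
  shows "v \<le> hsym \<gamma> b s"
proof -
  obtain k where k: "0 < k" "k < 1" "s = (1 - k\<^sup>2) / (1 + k\<^sup>2)" "k\<^sup>2 = (1 - s) / (1 + s)"
    "(1 - \<gamma>) * (1 + \<gamma> * (1 + b)\<^sup>2 / 4) - \<gamma> * ((1 - b\<^sup>2) * s) / 4 +
      (pi / 2 - 2 * arctan k - (thr \<gamma> b)\<^sup>2 * (1 / k - 1)) / (2 * pi) \<le> hsym \<gamma> b s"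
    by (rule hsym_ge[OF g b s(1,2)])
  have "k0\<^sup>2 * (1 + s) \<le> k0\<^sup>2 * (1 + s0)" using s by (intro mult_left_mono) auto
  hence "k0\<^sup>2 * (1 + s) \<le> 1 - s" using k0(2) s by linarith
  hence "k0\<^sup>2 \<le> k\<^sup>2" unfolding k(4) using s by (simp add: pos_le_divide_eq)
  hence k0k: "k0 \<le> k" by (rule power2_le_imp_le) (use k(1) in simp)
  \<comment> \<open>\<open>(1 / k - 1) / s\<close> equals
    \<open>(1 + k\<^sup>2) / (k + k\<^sup>2)\<close>; the bound \<open>r\<close>, assumed at
    \<open>k0\<close>, persists for larger k because r is at least 1.\<close>
  have "r * k0 + (r - 1) * k0\<^sup>2 \<le> r * k + (r - 1) * k\<^sup>2"
    using k0k k0 r by (intro add_mono mult_left_mono power_mono) auto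
  hence rk: "1 + k\<^sup>2 \<le> r * (k + k\<^sup>2)" using r(1) by (simp add: algebra_simps)
  have "1 / k - 1 \<le> s * r"
  proof -
    have p: "0 < k * (1 + k\<^sup>2)" using k(1) by (intro mult_pos_pos add_pos_nonneg) auto
    have "(1 / k - 1) * (k * (1 + k\<^sup>2)) = (1 - k) * (1 + k\<^sup>2)"
      using k(1) by (simp add: field_simps)
    also have "\<dots> \<le> (1 - k) * (r * (k + k\<^sup>2))" using rk k(2) by (intro mult_left_mono) auto
    also have "\<dots> = r * k * (1 - k\<^sup>2)" by (simp add: power2_eq_square algebra_simps)
    also have "1 - k\<^sup>2 = s * (1 + k\<^sup>2)"
    proof -
      have "1 + k\<^sup>2 > 0" by (simp add: add_pos_nonneg)
      thus ?thesis using arg_cong[OF k(3), of "\<lambda>z. z * (1 + k\<^sup>2)"] by simp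
    qed
    also have "r * k * (s * (1 + k\<^sup>2)) = s * r * (k * (1 + k\<^sup>2))" by simp
    finally show ?thesis using p by (rule mult_right_le_imp_le)
  qed
  moreover have "0 \<le> 1 / k - 1" using k(1,2) by simp
  ultimately have "(thr \<gamma> b)\<^sup>2 * (1 / k - 1) \<le> C * (s * r)" using a order_trans[OF zero_le_power2 a] by (intro mult_mono) auto
  moreover have "s \<le> pi / 2 - 2 * arctan k"
  proof -
    obtain k' where k': "0 < k'" "k'\<^sup>2 = (1 - s) / (1 + s)" "arcsin s = pi / 2 - 2 * arctan k'"
      by (rule half_tan_param[OF s(1,2)])
    have "k' = k" by (rule power2_eq_imp_eq) (use k(1,4) k'(1,2) in auto)
    moreover have "s \<le> arcsin s"
      using sin_x_le_x[of "arcsin s"] s by (simp add: arcsin_nonneg)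
    ultimately show ?thesis unfolding k'(3) by simp
  qed
  ultimately have "s - C * (s * r) \<le> pi / 2 - 2 * arctan k - (thr \<gamma> b)\<^sup>2 * (1 / k - 1)" by linarith
  hence "(s - C * (s * r)) / (2 * pi) \<le> (pi / 2 - 2 * arctan k - (thr \<gamma> b)\<^sup>2 * (1 / k - 1)) / (2 * pi)"
    by (rule divide_right_mono) simp
  moreover have "0.159154 * (s * (1 - C * r)) \<le> (s - C * (s * r)) / (2 * pi)"
  proof -
    have "0.159154 \<le> 1 / (2 * pi)" using pi_approx by (simp add: divide_simps)
    moreover have "0 \<le> s * (1 - C * r)" using s Cr by simp
    ultimately have "0.159154 * (s * (1 - C * r)) \<le> 1 / (2 * pi) * (s * (1 - C * r))" by (rule mult_right_mono)
    also have "\<dots> = (s - C * (s * r)) / (2 * pi)" by (simp add: algebra_simps)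
    finally show ?thesis .
  qed
  moreover have "\<gamma> * ((1 - b\<^sup>2) * s) / 4 \<le> 0.238495 * ((1 - b\<^sup>2) * s)"
  proof -
    have "0 \<le> (1 - b\<^sup>2) * s" using square_less_2[OF b] s by simp
    from mult_right_mono[OF g(2) this] show ?thesis by (simp add: mult.commute)
  qed
  moreover have "L - P + Q \<le> H" if "base - p + q \<le> H" "L \<le> base" "Q \<le> q'" "q' \<le> q" "p \<le> P"
    for L P Q H base p q q' :: real using that by linarith
  ultimately have "0.04602 * (1 + 0.23849 * (1 + b)\<^sup>2) - 0.238495 * ((1 - b\<^sup>2) * s) + 0.159154 * (s * (1 - C * r)) \<le> hsym \<gamma> b s"
    using k(5) hsym_base_ge[OF g zero_le_power2] by blast
  hence G: "0.04602 * (1 + 0.23849 * (1 + b)\<^sup>2) + s * (0.159154 * (1 - C * r) - 0.238495 * (1 - b\<^sup>2)) \<le> hsym \<gamma> b s"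
    by (rule order_trans[OF eq_refl, rotated]) (simp add: algebra_simps)
  \<comment> \<open>The bound is affine in \<open>s\<close>, so it is smallest at an end of [0, s0]:
    at 0 it exceeds 0.046, and at \<open>s0\<close> it is the hypothesis \<open>F\<close>.\<close>
  define B where "B = 0.159154 * (1 - C * r) - 0.238495 * (1 - b\<^sup>2)"
  show ?thesis
  proof (cases "0 \<le> B")
    case True
    hence "0 \<le> s * B" using s by simp
    moreover have "0 \<le> (1 + b)\<^sup>2" by simp
    moreover have "v \<le> H" if "0.04602 * (1 + 0.23849 * X) + p \<le> H" "0 \<le> p" "0 \<le> X" for X p H :: real
      using that v by (simp add: field_simps)
    ultimately show ?thesis using G unfolding B_def[symmetric] by blast
  next
    case False
    hence "s0 * B \<le> s * B" using s by (intro mult_right_mono_neg) auto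
    moreover have "s0 * B = 0.159154 * (s0 * (1 - C * r)) - 0.238495 * ((1 - b\<^sup>2) * s0)"
      by (simp add: B_def algebra_simps)
    ultimately show ?thesis using G F unfolding B_def[symmetric] by linarith
  qed
qed

lemma thr_sq_le:
  fixes \<gamma> b y :: real
  assumes g: "0.9539798 \<le> \<gamma>" "\<gamma> \<le> 0.95398" and b: "- 1 < b" "b < 1"
    and y: "\<bar>\<gamma> * (1 + b) / 2 - 1 / 2\<bar> \<le> y" "y \<le> q" "q \<le> Phi U - 1 / 2" "0 < q" "0 \<le> U"
  shows "(thr \<gamma> b)\<^sup>2 \<le> (U / q)\<^sup>2 * y\<^sup>2"
proof -
  have Pa: "Phi (thr \<gamma> b) = \<gamma> * (1 + b) / 2" using g b by simp
  have "\<bar>thr \<gamma> b\<bar> \<le> U / q * \<bar>Phi (thr \<gamma> b) - 1 / 2\<bar>"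
    using y by (intro abs_le_of_Phi) (auto simp: Pa)
  also have "\<dots> \<le> U / q * y" using y by (intro mult_left_mono) (auto simp: Pa)
  finally have "\<bar>thr \<gamma> b\<bar>\<^sup>2 \<le> (U / q * y)\<^sup>2" by (intro power_mono) auto
  thus ?thesis by (simp only: power2_abs power_mult_distrib)
qed

text \<open>\<open>K\<close> is dropped altogether, which works since 0.04602 - 0.95398 * 0.19185 /
  4 exceeds 0.00026. For biases of modulus at least 0.562 the constraint gives at most 0.438^2, just
  below 0.19185.\<close>

lemma hsym_ge_product:
  fixes \<gamma> b s w :: real
  assumes g: "0.9539798 \<le> \<gamma>" "\<gamma> \<le> 0.95398" and b: "- 1 < b" "b < 1" and s: "0 < s" "s < 1"
    and w: "(1 - b\<^sup>2) * s \<le> 0.19185"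
  shows "0.00026 + 0.01 * (1 + b)\<^sup>2 \<le> hsym \<gamma> b s"
proof -
  have "0 \<le> K (thr \<gamma> b) 0 (arcsin s)"
    using K_mono[of 0 "arcsin s" "thr \<gamma> b" 0] s arcsin_less_arcsin[of s 1] arcsin_nonneg[of s] by (simp add: K_def)
  moreover have "\<gamma> * ((1 - b\<^sup>2) * s) \<le> 0.95398 * 0.19185"
    using g w square_less_2[OF b] s by (intro mult_mono) auto
  moreover note hsym_base_ge[OF g, of "(1 + b)\<^sup>2"]
  moreover have "0 \<le> (1 + b)\<^sup>2" by simp
  moreover have "0.00026 + 0.01 * Y \<le> base - p / 4 + q"
    if "0 \<le> q" "p \<le> 0.95398 * 0.19185" "0.04602 * (1 + 0.23849 * Y) \<le> base" "0 \<le> Y" for q p base Y :: real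
    using that by (simp add: field_simps)
  ultimately show ?thesis unfolding hsym_def by blast
qed

lemma hsym_ge_left:
  fixes \<gamma> b s :: real
  assumes g: "0.9539798 \<le> \<gamma>" "\<gamma> \<le> 0.95398" and b: "- 0.562 \<le> b" "b \<le> - 0.45" and s: "0 < s" "s < 1"
    and c: "s * (1 - b\<^sup>2) \<le> (1 + b)\<^sup>2"
  shows "0.000001 \<le> hsym \<gamma> b s"
proof -
  define t where "t = b + 0.562"
  have bt: "b = t - 0.562" and t: "0 \<le> t" "t \<le> 0.112" using b by (auto simp: t_def)
  define s0 where "s0 = (1 + b) / (1 - b)"
  have b1: "0 < 1 - b" "0 < 1 + b" using b by auto
  have s0: "s0 * (1 - b) = 1 + b" using b1 by (simp add: s0_def)
  have "s * (1 - b) * (1 + b) \<le> (1 + b) * (1 + b)" using c by (simp add: power2_eq_square algebra_simps)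
  hence "s * (1 - b) \<le> 1 + b" using b1 by simp
  hence ss0: "s \<le> s0" using b1 by (simp add: s0_def pos_le_divide_eq)
  define y where "y = 0.5 - 0.476985 * (1 + b)"
  have gb: "0.476985 * (1 + b) \<le> \<gamma> / 2 * (1 + b)" "\<gamma> / 2 * (1 + b) \<le> 0.47699 * (1 + b)"
    by (rule mult_right_mono; use g b in simp)+
  have y: "\<bar>\<gamma> * (1 + b) / 2 - 1 / 2\<bar> \<le> y" "y \<le> 0.2912" "0 \<le> y"
    using gb b by (auto simp: y_def abs_if field_simps)
  have U: "0.7912 \<le> Phi 0.8125"
    by (rule Phi_ge_Taylor[where n = 3 and c = "0.39894228", OF _ _ inv_sqrt_2pi_ge])
       (simp_all add: Phi_Taylor_def lessThan_nat_numeral fact_numeral power_divide)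
  have "(thr \<gamma> b)\<^sup>2 \<le> (0.8125 / 0.2912)\<^sup>2 * y\<^sup>2"
    by (rule thr_sq_le[OF g _ _ y(1,2)]) (use b U in auto)
  also have "\<dots> \<le> 7.7853 * y\<^sup>2" by (intro mult_right_mono) (simp_all add: power_divide)
  finally have C: "(thr \<gamma> b)\<^sup>2 \<le> 7.7853 * y\<^sup>2" .
  have "y\<^sup>2 \<le> 0.2912\<^sup>2" using y by (intro power_mono) auto
  hence Cr: "7.7853 * y\<^sup>2 * 1.295 \<le> 1" by (simp add: power2_eq_square)
  define B where "B = 0.159154 * (1 - 7.7853 * y\<^sup>2 * 1.295) - 0.238495 * (1 - b\<^sup>2)"
  \<comment> \<open>Multiplying by \<open>1 - b\<close> clears the denominator of \<open>s0\<close>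
    and leaves a polynomial inequality in the distance \<open>t\<close> from the left end.\<close>
  have "0.000001 * (1 - b) \<le> 0.04602 * (1 + 0.23849 * (1 + b)\<^sup>2) * (1 - b) + (1 + b) * B"
  proof -
    have "0 \<le> t\<^sup>2 * (0.12 - 0.138 * t)" using t by (intro mult_nonneg_nonneg) auto
    moreover have "0 \<le> (t - 0.01)\<^sup>2" by simp
    ultimately show ?thesis using t
      unfolding B_def y_def bt by (simp add: power2_eq_square algebra_simps add_divide_distrib diff_divide_distrib)
  qed
  also have "\<dots> = (0.04602 * (1 + 0.23849 * (1 + b)\<^sup>2) + s0 * B) * (1 - b)"
    unfolding s0[symmetric] by (simp only: ring_distribs mult.assoc mult.commute mult.left_commute)
  finally have "0.000001 \<le> 0.04602 * (1 + 0.23849 * (1 + b)\<^sup>2) + s0 * B"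
    using b1(1) by (rule mult_right_le_imp_le)
  also have "\<dots> = 0.04602 * (1 + 0.23849 * (1 + b)\<^sup>2) - 0.238495 * ((1 - b\<^sup>2) * s0) + 0.159154 * (s0 * (1 - 7.7853 * y\<^sup>2 * 1.295))"
    unfolding B_def by (simp add: algebra_simps add_divide_distrib diff_divide_distrib)
  finally have F: "0.000001 \<le> 0.04602 * (1 + 0.23849 * (1 + b)\<^sup>2) - 0.238495 * ((1 - b\<^sup>2) * s0) + 0.159154 * (s0 * (1 - 7.7853 * y\<^sup>2 * 1.295))" .
  \<comment> \<open>At \<open>s0\<close> the squared half-angle tangent is \<open>- b\<close>, here
    at least 0.45, so 0.67 is an admissible \<open>k0\<close>; 1.295 is
    \<open>(1 + k0\<^sup>2) / (k0 + k0\<^sup>2)\<close> rounded up.\<close>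
  have "0.67\<^sup>2 * (1 + s0) \<le> 1 - s0"
  proof -
    have "1.4489 * (1 + b) \<le> 0.5511 * (1 - b)" using b by simp
    hence "s0 * 1.4489 \<le> 0.5511" using b1 by (simp add: s0_def field_simps)
    thus ?thesis by (simp add: power2_eq_square)
  qed
  from hsym_ge_linear[OF g _ _ s ss0 C _ _ _ this Cr F] show ?thesis
    using b by (simp add: power2_eq_square)
qed

text \<open>Mirror image of \<open>hsym_ge_left\<close> under the other constraint: the squared
  half-angle tangent at \<open>s0\<close> is now \<open>b\<close>, and 0.447 lies just below the
  root of 0.2.\<close>

lemma hsym_ge_right:
  fixes \<gamma> b s :: real
  assumes g: "0.9539798 \<le> \<gamma>" "\<gamma> \<le> 0.95398" and b: "0.2 \<le> b" "b \<le> 0.562" and s: "0 < s" "s < 1"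
    and c: "s * (1 - b\<^sup>2) \<le> (1 - b)\<^sup>2"
  shows "0.002 \<le> hsym \<gamma> b s"
proof -
  define t where "t = b - 0.2"
  have bt: "b = t + 0.2" and t: "0 \<le> t" "t \<le> 0.362" using b by (auto simp: t_def)
  define s0 where "s0 = (1 - b) / (1 + b)"
  have b1: "0 < 1 - b" "0 < 1 + b" using b by auto
  have s0: "s0 * (1 + b) = 1 - b" using b1 by (simp add: s0_def)
  have "s * (1 + b) * (1 - b) \<le> (1 - b) * (1 - b)" using c by (simp add: power2_eq_square algebra_simps)
  hence "s * (1 + b) \<le> 1 - b" using b1 by simp
  hence ss0: "s \<le> s0" using b1 by (simp add: s0_def pos_le_divide_eq)
  define y where "y = 0.47699 * (1 + b) - 0.5"
  have gb: "0.476985 * (1 + b) \<le> \<gamma> / 2 * (1 + b)" "\<gamma> / 2 * (1 + b) \<le> 0.47699 * (1 + b)"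
    by (rule mult_right_mono; use g b in simp)+
  have y: "\<bar>\<gamma> * (1 + b) / 2 - 1 / 2\<bar> \<le> y" "y \<le> 0.2451" "0 \<le> y"
    using gb b by (auto simp: y_def abs_if field_simps)
  have U: "0.7451 \<le> Phi 0.66"
    by (rule Phi_ge_Taylor[where n = 3 and c = "0.39894228", OF _ _ inv_sqrt_2pi_ge])
       (simp_all add: Phi_Taylor_def lessThan_nat_numeral fact_numeral power_divide)
  have "(thr \<gamma> b)\<^sup>2 \<le> (0.66 / 0.2451)\<^sup>2 * y\<^sup>2"
    by (rule thr_sq_le[OF g _ _ y(1,2)]) (use b U in auto)
  also have "\<dots> \<le> 7.2512 * y\<^sup>2" by (intro mult_right_mono) (simp_all add: power_divide)
  finally have C: "(thr \<gamma> b)\<^sup>2 \<le> 7.2512 * y\<^sup>2" .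
  have "y\<^sup>2 \<le> 0.2451\<^sup>2" using y by (intro power_mono) auto
  hence Cr: "7.2512 * y\<^sup>2 * 1.855 \<le> 1" by (simp add: power2_eq_square)
  define B where "B = 0.159154 * (1 - 7.2512 * y\<^sup>2 * 1.855) - 0.238495 * (1 - b\<^sup>2)"
  have "0.002 * (1 + b) \<le> 0.04602 * (1 + 0.23849 * (1 + b)\<^sup>2) * (1 + b) + (1 - b) * B"
  proof -
    have "0 \<le> t * (0.362 - t)" "0 \<le> t * (t - 0.01)\<^sup>2" using t by (auto intro!: mult_nonneg_nonneg)
    thus ?thesis using t
      unfolding B_def y_def bt by (simp add: power2_eq_square algebra_simps add_divide_distrib diff_divide_distrib)
  qed
  also have "\<dots> = (0.04602 * (1 + 0.23849 * (1 + b)\<^sup>2) + s0 * B) * (1 + b)"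
    unfolding s0[symmetric] by (simp only: ring_distribs mult.assoc mult.commute mult.left_commute)
  finally have "0.002 \<le> 0.04602 * (1 + 0.23849 * (1 + b)\<^sup>2) + s0 * B"
    using b1(2) by (rule mult_right_le_imp_le)
  also have "\<dots> = 0.04602 * (1 + 0.23849 * (1 + b)\<^sup>2) - 0.238495 * ((1 - b\<^sup>2) * s0) + 0.159154 * (s0 * (1 - 7.2512 * y\<^sup>2 * 1.855))"
    unfolding B_def by (simp add: algebra_simps add_divide_distrib diff_divide_distrib)
  finally have F: "0.002 \<le> 0.04602 * (1 + 0.23849 * (1 + b)\<^sup>2) - 0.238495 * ((1 - b\<^sup>2) * s0) + 0.159154 * (s0 * (1 - 7.2512 * y\<^sup>2 * 1.855))" .
  have "0.447\<^sup>2 * (1 + s0) \<le> 1 - s0"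
  proof -
    have "1.2 * (1 - b) \<le> 0.8 * (1 + b)" using b by simp
    hence "s0 * 1.2 \<le> 0.8" using b1 by (simp add: s0_def field_simps)
    thus ?thesis by (simp add: power2_eq_square)
  qed
  from hsym_ge_linear[OF g _ _ s ss0 C _ _ _ this Cr F] show ?thesis
    using b by (simp add: power2_eq_square)
qed

text \<open>All quantities enter monotonically; on a small cell of biases they are replaced by
  rational end values, and only a numerical inequality is left.\<close>

lemma hsym_ge_chunk:
  fixes \<gamma> b s m y v X z :: real
  assumes g: "0.9539798 \<le> \<gamma>" "\<gamma> \<le> 0.95398"
    and b: "- 1 < b" "b < 1" and s: "0 < s" "s < 1"
    and m: "m\<^sup>2 \<le> (1 - s) / (1 + s)" and y: "\<bar>\<gamma> * (1 + b) / 2 - 1 / 2\<bar> \<le> y"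
    and X: "X \<le> 1 + b" and z: "z \<le> b\<^sup>2 * s"
    and n: "y \<le> 0.0729" "0 < m" "0 \<le> X"
      "v \<le> 0.04602 * (1 + 0.23849 * X\<^sup>2) - 0.0440 + 0.23849 * z - 1.014 * (y\<^sup>2 * (1 / m - 1))"
  shows "v \<le> hsym \<gamma> b s"
proof -
  have "X\<^sup>2 \<le> (1 + b)\<^sup>2" using X n by (intro power_mono) auto
  moreover have "v \<le> 0.04602 * (1 + 0.23849 * Y) - 0.0440 + 0.23849 * z' - 1.014 * p"
    if "v \<le> 0.04602 * (1 + 0.23849 * Y') - 0.0440 + 0.23849 * z - 1.014 * p" "Y' \<le> Y" "z \<le> z'" for Y Y' z' p
    using that by (simp add: field_simps)
  ultimately have "v \<le> 0.04602 * (1 + 0.23849 * (1 + b)\<^sup>2) - 0.0440 + 0.23849 * (b\<^sup>2 * s) - 1.014 * (y\<^sup>2 * (1 / m - 1))"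
    using n(4) z by blast
  also have "\<dots> \<le> hsym \<gamma> b s" by (rule hsym_ge_quadratic[OF g b s y n(1,2) m])
  finally show ?thesis .
qed

text \<open>The right side is the square of the half-angle tangent, so the constraint keeps that
  tangent above \<open>sqrt \<bar>b\<bar>\<close> and the penalty factor \<open>1 / k - 1\<close>
  bounded.\<close>

lemma constraint_half_tan:
  fixes b s :: real
  assumes "\<bar>b\<bar> < 1" "0 < s" "s * (1 - b\<^sup>2) \<le> (1 - \<bar>b\<bar>)\<^sup>2"
  shows "\<bar>b\<bar> \<le> (1 - s) / (1 + s)"
proof -
  define c where "c = \<bar>b\<bar>"
  have c: "c < 1" "s * (1 - c\<^sup>2) \<le> (1 - c)\<^sup>2" using assms by (auto simp: c_def)
  have "(1 - c) * (s * (1 + c)) \<le> (1 - c) * (1 - c)"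
    using c(2) by (simp add: power2_eq_square algebra_simps)
  hence "s * (1 + c) \<le> 1 - c" using c(1) by simp
  hence "c * (1 + s) \<le> 1 - s" by (simp add: algebra_simps)
  thus ?thesis unfolding c_def[symmetric] using assms(2) by (simp add: pos_le_divide_eq)
qed

lemma hsym_ge_near_left:
  fixes \<gamma> b s :: real
  assumes g: "0.9539798 \<le> \<gamma>" "\<gamma> \<le> 0.95398" and b: "- 0.1 \<le> b" "b \<le> - 0.063" and s: "0 < s" "s < 1"
    and c: "s * (1 - b\<^sup>2) \<le> (1 + b)\<^sup>2"
  shows "0.000001 \<le> hsym \<gamma> b s"
proof -
  have b1: "- 1 < b" "b < 1" using b by auto
  have kb: "- b \<le> (1 - s) / (1 + s)" using constraint_half_tan[of b s] b s c by (simp add: abs_if)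
  have y: "\<bar>\<gamma> * (1 + b) / 2 - 1 / 2\<bar> \<le> y" if "0.02302 - 0.477 * b \<le> y" for y
  proof -
    have "0.476985 * (1 + b) \<le> \<gamma> / 2 * (1 + b)" "\<gamma> / 2 * (1 + b) \<le> 0.47699 * (1 + b)"
      by (rule mult_right_mono; use g b in simp)+
    moreover have "0.9539798 * (1 + b) \<le> \<gamma> * (1 + b)" by (rule mult_right_mono) (use g b in auto)
    ultimately show ?thesis using that b by (simp add: abs_if)
  qed
  define q where "q = (1 - s) / (1 + s)"
  note kb = kb[folded q_def]
  note ch = hsym_ge_chunk[OF g b1 s _ y, where v = "0.000001", folded q_def]
  show ?thesis
  \<comment> \<open>A half-angle tangent of at least 0.46 makes the penalty small on the whole
    range; otherwise \<open>s\<close> is at least 0.65 and the term \<open>b\<^sup>2 * s\<close>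
    becomes available.\<close>
  proof (cases "0.46\<^sup>2 \<le> q")
    case True
    show ?thesis
      by (rule ch[OF True, where y = "0.07072" and X = "0.9" and z = 0]) (use b s in \<open>auto simp: power2_eq_square\<close>)
  next
    case False
    hence "1 - s < 0.46\<^sup>2 * (1 + s)" unfolding q_def using s by (simp add: pos_le_divide_eq not_le)
    hence s65: "0.65 \<le> s" by (simp add: power2_eq_square)
    have z: "l\<^sup>2 * 0.65 \<le> b\<^sup>2 * s" if "0 \<le> l" "b \<le> - l" for l
      by (rule mult_mono) (use s65 that abs_le_square_iff[of l b] in auto)
    \<comment> \<open>In each cell \<open>m\<close> is just below the root of the smallest
      \<open>- b\<close>, while \<open>y\<close> and \<open>X\<close> belong to the largest.\<close>
    consider "b \<ge> - 0.075" | "b \<ge> - 0.085" "b \<le> - 0.075" | "b \<ge> - 0.093" "b \<le> - 0.085" | "b \<le> - 0.093"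
      by linarith
    thus ?thesis
    proof cases
      case 1
      show ?thesis
        by (rule ch[where m = "0.25" and y = "0.058795" and X = "0.925" and z = 0])
           (use b s kb 1 in \<open>auto simp: power2_eq_square\<close>)
    next
      case 2
      show ?thesis
        by (rule ch[OF _ _ _ z[of "0.075"], where m = "0.2738" and y = "0.063565" and X = "0.915"])
           (use b s kb 2 in \<open>auto simp: power2_eq_square\<close>)
    next
      case 3
      show ?thesis
        by (rule ch[OF _ _ _ z[of "0.085"], where m = "0.2915" and y = "0.067381" and X = "0.907"])
           (use b s kb 3 in \<open>auto simp: power2_eq_square\<close>)
    next
      case 4
      show ?thesis
        by (rule ch[OF _ _ _ z[of "0.093"], where m = "0.3049" and y = "0.07072" and X = "0.9"])
           (use b s kb 4 in \<open>auto simp: power2_eq_square\<close>)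
    qed
  qed
qed

text \<open>When the maximal angle is close to \<open>pi / 2\<close> the tangent bound for \<open>K\<close> degenerates;
  the integral is then truncated.\<close>
lemma hsym_ge_large_angle:
  fixes \<gamma> b s :: real
  assumes g: "0.9539798 \<le> \<gamma>" "\<gamma> \<le> 0.95398" and b: "\<bar>b\<bar> \<le> 0.05" and s: "0 < s" "s < 1"
    and y: "\<bar>\<gamma> * (1 + b) / 2 - 1 / 2\<bar> \<le> 0.0278" and k: "(1 - s) / (1 + s) \<le> 0.01"
  shows "0.002 \<le> hsym \<gamma> b s"
proof -
  \<comment> \<open>The value of \<open>s\<close> whose half-angle tangent is exactly 0.1.\<close>
  define s1 :: real where "s1 = 0.99 / 1.01"
  have "1 - s \<le> 0.01 * (1 + s)" using k s by (simp add: pos_divide_le_eq)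
  hence s1: "s1 \<le> s" "0 < s1" "s1 < 1" by (auto simp: s1_def)
  obtain k where k: "0 < k" "k\<^sup>2 = (1 - s1) / (1 + s1)" "half_tan (arcsin s1) = k"
    "arcsin s1 = pi / 2 - 2 * arctan k" "0 \<le> arcsin s1" "arcsin s1 < pi / 2"
    by (rule half_tan_param[OF s1(2,3)])
  have "k\<^sup>2 = 0.1\<^sup>2" unfolding k(2) by (simp add: s1_def power2_eq_square)
  hence k1: "k = 0.1" by (rule power2_eq_imp_eq) (use k(1) in auto)
  define a where "a = thr \<gamma> b"
  have "0.0729 \<le> Phi 0.184 - 1 / 2"
  proof -
    have "0.5729 \<le> Phi 0.184"
      by (rule Phi_ge_Taylor[where n = 1 and c = "0.39894228", OF _ _ inv_sqrt_2pi_ge])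
         (simp_all add: Phi_Taylor_def lessThan_nat_numeral fact_numeral power_divide)
    thus ?thesis by simp
  qed
  hence "a\<^sup>2 \<le> (0.184 / 0.0729)\<^sup>2 * 0.0278\<^sup>2" unfolding a_def
    by (intro thr_sq_le[OF g _ _ y]) (use b in auto)
  hence a2: "a\<^sup>2 \<le> 0.005" by (simp add: power2_eq_square)
  have "pi / 2 - 2 * arctan k - a\<^sup>2 * (1 / k - 1) \<ge> pi / 2 - 0.245"
    using arctan_le_self[of "0.1"] a2 by (simp add: k1)
  moreover have "0.2 * (2 * pi) \<le> pi / 2 - 0.245" using pi_approx by simp
  ultimately have "0.2 * (2 * pi) \<le> pi / 2 - 2 * arctan k - a\<^sup>2 * (1 / k - 1)" by (rule order_trans[rotated])
  hence "0.2 \<le> (arcsin s1 - a\<^sup>2 * (1 / half_tan (arcsin s1) - 1)) / (2 * pi)"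
    unfolding k(3) unfolding k(4) by (simp add: pos_le_divide_eq)
  also have "\<dots> \<le> K a 0 (arcsin s1)" by (rule K_tangent[OF k(5,6)])
  also have "\<dots> \<le> K a 0 (arcsin s)"
    by (rule K_mono[OF k(5)]) (use s s1 arcsin_less_arcsin[of s 1] arcsin_le_arcsin[of s1 s] in auto)
  finally have K: "0.2 \<le> K a 0 (arcsin s)" .
  have b2: "b\<^sup>2 < 1" by (rule square_less_2) (use b in \<open>auto simp: abs_le_iff\<close>)
  have "\<gamma> * ((1 - b\<^sup>2) * s) \<le> 0.95398 * (1 * 1)" by (intro mult_mono mult_nonneg_nonneg) (use g s b2 in auto)
  moreover have "0.04602 * (1 + 0.23849 * 0.9) \<le> 0.04602 * (1 + 0.23849 * (1 + b)\<^sup>2)"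
  proof -
    have "0.95\<^sup>2 \<le> (1 + b)\<^sup>2" using b by (intro power_mono) auto
    thus ?thesis by (simp add: power2_eq_square)
  qed
  moreover note hsym_base_ge[OF g zero_le_power2, of "1 + b"]
  moreover have "0.002 \<le> base - p / 4 + q"
    if "0.2 \<le> q" "p \<le> 0.95398 * (1 * 1)" "0.04602 * (1 + 0.23849 * 0.9) \<le> B" "B \<le> base" for q p base B :: real
    using that by (simp add: field_simps)
  ultimately show ?thesis using K unfolding hsym_def a_def[symmetric] by blast
qed

text \<open>The constraint switches where the threshold changes sign, at
  \<open>\<gamma> * (1 + b) = 1\<close>, that is at b about 0.048. For b from 0 to that point it is
  void, so the angle may approach pi / 2, hence the separate case of large angles.\<close>

lemma hsym_ge_centre:
  fixes \<gamma> b s :: real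
  assumes g: "0.9539798 \<le> \<gamma>" "\<gamma> \<le> 0.95398" and b: "- 0.063 \<le> b" "b \<le> 0.2" and s: "0 < s" "s < 1"
    and c1: "\<gamma> * (1 + b) \<le> 1 \<Longrightarrow> s * (1 - b\<^sup>2) \<le> (1 + b)\<^sup>2"
    and c2: "1 \<le> \<gamma> * (1 + b) \<Longrightarrow> s * (1 - b\<^sup>2) \<le> (1 - b)\<^sup>2"
  shows "0.002 \<le> hsym \<gamma> b s"
proof -
  have b1: "- 1 < b" "b < 1" using b by auto
  have gb: "0.9539798 * (1 + b) \<le> \<gamma> * (1 + b)" "\<gamma> * (1 + b) \<le> 0.95398 * (1 + b)"
    by (rule mult_right_mono; use g b in simp)+
  define q where "q = (1 - s) / (1 + s)"
  note ch = hsym_ge_chunk[OF g b1 s, where v = "0.002" and z = 0, folded q_def]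
  show ?thesis
  proof (cases "1 \<le> \<gamma> * (1 + b)")
    case True
    hence b0: "0.048 \<le> b" using gb by simp
    have kb: "b \<le> q" unfolding q_def using constraint_half_tan[of b s] b b0 s c2[OF True] by simp
    show ?thesis
    proof (cases "b \<le> 0.12")
      case True
      show ?thesis by (rule ch[where m = "0.219" and y = "0.03423" and X = 1])
        (use b b0 s kb True gb in \<open>auto simp: power2_eq_square abs_if\<close>)
    next
      case False
      show ?thesis by (rule ch[where m = "0.346" and y = "0.07239" and X = "1.12"])
        (use b b0 s kb False gb in \<open>auto simp: power2_eq_square abs_if\<close>)
    qed
  next
    case False
    hence b5: "b \<le> 0.05" using gb by simp
    have y: "\<bar>\<gamma> * (1 + b) / 2 - 1 / 2\<bar> \<le> y" if "0.02302 - 0.477 * b \<le> y" "0.02302 \<le> y" for y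
      using that gb b False by (simp add: abs_if)
    have kb: "- b \<le> q" if "b \<le> 0"
      unfolding q_def using constraint_half_tan[of b s] b s c1 False that by (simp add: abs_of_nonpos)
    consider "b \<ge> - 0.01" "q \<le> 0.01" | "b \<ge> - 0.016" "0.01 \<le> q"
      | "b \<ge> - 0.026" "b \<le> - 0.016" | "b \<ge> - 0.038" "b \<le> - 0.026"
      | "b \<ge> - 0.05" "b \<le> - 0.038" | "b \<ge> - 0.057" "b \<le> - 0.05" | "b \<le> - 0.057"
      using kb by fastforce
    thus ?thesis
    proof cases
      case 1
      show ?thesis by (rule hsym_ge_large_angle[OF g _ s y 1(2)[unfolded q_def]]) (use 1 b5 in auto)
    next
      case 2
      show ?thesis by (rule ch[OF _ y, where m = "0.1" and X = "0.984" and y = "0.03066"])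
        (use b s 2 in \<open>auto simp: power2_eq_square\<close>)
    next
      case 3
      show ?thesis by (rule ch[OF _ y, where m = "0.126" and X = "0.974" and y = "0.03543"])
        (use b s 3 kb in \<open>auto simp: power2_eq_square\<close>)
    next
      case 4
      show ?thesis by (rule ch[OF _ y, where m = "0.161" and X = "0.962" and y = "0.04115"])
        (use b s 4 kb in \<open>auto simp: power2_eq_square\<close>)
    next
      case 5
      show ?thesis by (rule ch[OF _ y, where m = "0.1949" and X = "0.95" and y = "0.04687"])
        (use b s 5 kb in \<open>auto simp: power2_eq_square\<close>)
    next
      case 6
      show ?thesis by (rule ch[OF _ y, where m = "0.2236" and X = "0.943" and y = "0.05021"])
        (use b s 6 kb in \<open>auto simp: power2_eq_square\<close>)
    next
      case 7
      show ?thesis by (rule ch[OF _ y, where m = "0.2387" and X = "0.937" and y = "0.05308"])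
        (use b s 7 kb in \<open>auto simp: power2_eq_square\<close>)
    qed
  qed
qed

section \<open>Monotonicity in \<open>s\<close>: descent to the facet\<close>

lemma arcsin_bounds:
  assumes "0 < s" "s < 1"
  shows "0 \<le> arcsin s" "arcsin s < pi / 2" "sin (arcsin s) = s"
  using assms arcsin_less_arcsin[of s 1] arcsin_nonneg by auto

text \<open>Since \<open>hsym\<close> has \<open>s\<close>-derivative \<open>- \<gamma> (1 - b\<^sup>2) / 4 + kern / (2 pi cos)\<close>, the
  hypothesis says that it decreases in \<open>s\<close>.\<close>
lemma hsym_antimono:
  fixes \<gamma> b s s1 :: real
  assumes s: "0 < s" "s \<le> s1" "s1 < 1"
    and le: "\<And>u. 0 \<le> u \<Longrightarrow> u \<le> arcsin s1 \<Longrightarrow> kern (thr \<gamma> b) 0 u \<le> pi * \<gamma> / 2 * (1 - b\<^sup>2) * cos u"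
  shows "hsym \<gamma> b s1 \<le> hsym \<gamma> b s"
proof -
  define a where "a = thr \<gamma> b"
  define C where "C = pi * \<gamma> / 2 * (1 - b\<^sup>2)"
  have as: "0 \<le> arcsin s" "arcsin s < pi / 2" "sin (arcsin s) = s"
    and as1: "0 \<le> arcsin s1" "arcsin s1 < pi / 2" "sin (arcsin s1) = s1"
    using arcsin_bounds[of s] arcsin_bounds[of s1] s by auto
  have ss: "arcsin s \<le> arcsin s1" by (rule arcsin_le_arcsin) (use s in auto)
  have cont: "continuous_on {0..arcsin s1} (kern a 0)"
    by (intro continuous_on_kern cos_gt_zero_pi) (use as1 in auto)
  have int: "kern a 0 integrable_on {u..v}" if "0 \<le> u" "v \<le> arcsin s1" for u v
    by (rule integrable_continuous_real, rule continuous_on_subset[OF cont]) (use that in auto)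
  have "integral {0..arcsin s1} (kern a 0) = integral {0..arcsin s} (kern a 0) + integral {arcsin s..arcsin s1} (kern a 0)"
    using Henstock_Kurzweil_Integration.integral_combine[OF as(1) ss int[OF order.refl order.refl]] by simp
  moreover have "integral {arcsin s..arcsin s1} (kern a 0) \<le> C * (s1 - s)"
  proof (rule has_integral_le[OF integrable_integral])
    show "((\<lambda>u. C * cos u) has_integral C * (s1 - s)) {arcsin s..arcsin s1}"
    proof -
      have "((\<lambda>u. C * cos u) has_integral C * sin (arcsin s1) - C * sin (arcsin s)) {arcsin s..arcsin s1}"
        by (rule fundamental_theorem_of_calculus[OF ss])
           (auto intro!: derivative_eq_intros simp flip: has_real_derivative_iff_has_vector_derivative)
      thus ?thesis unfolding as(3) as1(3) by (simp add: right_diff_distrib)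
    qed
  qed (use le int as in \<open>auto simp: a_def C_def\<close>)
  ultimately have "K a 0 (arcsin s1) \<le> (integral {0..arcsin s} (kern a 0) + C * (s1 - s)) / (2 * pi)"
    unfolding K_def by (intro divide_right_mono) auto
  also have "\<dots> = K a 0 (arcsin s) + \<gamma> * ((1 - b\<^sup>2) * (s1 - s)) / 4"
    unfolding K_def by (simp add: C_def add_divide_distrib)
  finally show ?thesis unfolding hsym_def a_def[symmetric] by (simp add: right_diff_distrib diff_divide_distrib)
qed

text \<open>The largest feasible \<open>s\<close> for \<open>b \<le> 0\<close>, which is the facet \<open>b12 = - 1 - 2 b\<close>.\<close>
definition face :: "real \<Rightarrow> real \<Rightarrow> real" where
  "face \<gamma> b = hsym \<gamma> b ((1 + b) / (1 - b))"

text \<open>Up to the facet \<open>cos u\<close> is at least \<open>2 * c / (1 + \<beta>)\<close>,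
  where \<open>\<beta> = - b\<close> and \<open>c\<close> is its root, so the crude bound 1 for the
  kernel suffices once \<open>(1 - \<beta>) * c\<close> exceeds
  \<open>1 / (pi * \<gamma>)\<close>.\<close>

lemma hsym_ge_face_far:
  fixes \<gamma> b s :: real
  assumes g: "0.9539798 \<le> \<gamma>" "\<gamma> \<le> 0.95398" and b: "- 0.45 \<le> b" "b \<le> - 0.16" and s: "0 < s" "s \<le> (1 + b) / (1 - b)"
  shows "face \<gamma> b \<le> hsym \<gamma> b s"
  unfolding face_def
proof (rule hsym_antimono[OF s])
  define \<beta> where "\<beta> = - b"
  have bb: "b = - \<beta>" "0.16 \<le> \<beta>" "\<beta> \<le> 0.45" using b by (auto simp: \<beta>_def)
  show s1: "(1 + b) / (1 - b) < 1" using b by simp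
  have s0: "0 < (1 + b) / (1 - b)" using b by simp
  note as = arcsin_bounds[OF s0 s1]
  fix u assume u: "0 \<le> u" "u \<le> arcsin ((1 + b) / (1 - b))"
  define c where "c = sqrt \<beta>"
  have c: "0 \<le> c" "c\<^sup>2 = \<beta>" using bb by (auto simp: c_def)
  have c4: "0.4 \<le> c" by (rule power2_le_imp_le) (use c bb in \<open>auto simp: power2_eq_square\<close>)
  have c7: "c \<le> 0.671" by (rule power2_le_imp_le) (use c bb in \<open>auto simp: power2_eq_square\<close>)
  have "0.336 \<le> (1 - \<beta>) * c"
  proof -
    \<comment> \<open>The factorisation of \<open>c - c ^ 3 - 0.336\<close>, which vanishes at
      \<beta> = 0.16.\<close>
    have "0 \<le> (c - 0.4) * (0.84 - 0.4 * c - c\<^sup>2)" using c4 c7 c(2) bb by (intro mult_nonneg_nonneg) auto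
    thus ?thesis unfolding c(2)[symmetric]
      by (simp add: power2_eq_square algebra_simps add_divide_distrib diff_divide_distrib)
  qed
  have cu: "2 * c / (1 + \<beta>) \<le> cos u"
  proof -
    have pos: "0 \<le> 2 * c / (1 + \<beta>)" using c bb by simp
    have "cos (arcsin ((1 + b) / (1 - b))) = sqrt (1 - ((1 + b) / (1 - b))\<^sup>2)"
      by (rule cos_arcsin) (use s0 s1 in auto)
    also have "1 - ((1 + b) / (1 - b))\<^sup>2 = (2 * c / (1 + \<beta>))\<^sup>2"
      unfolding power_divide power_mult_distrib c(2) unfolding bb(1) using bb
      by (simp add: divide_simps) (simp add: power2_eq_square algebra_simps)
    also have "sqrt \<dots> = 2 * c / (1 + \<beta>)" using pos by (simp only: real_sqrt_abs abs_of_nonneg)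
    finally have "cos (arcsin ((1 + b) / (1 - b))) = 2 * c / (1 + \<beta>)" .
    thus ?thesis using cos_monotone_0_pi_le[OF u(1) u(2)] as(2) pi_gt_zero by simp
  qed
  have "kern (thr \<gamma> b) 0 u \<le> 1"
  proof -
    have "0 < cos u" using u as by (intro cos_gt_zero_pi) auto
    hence "sin u < 1" using cos_pos_sin[of u] by auto
    thus ?thesis by (simp add: kern_def)
  qed
  also have "1 \<le> pi * \<gamma> * 0.336"
  proof -
    have "3.14 * 0.95 \<le> pi * \<gamma>" using pi_approx g by (intro mult_mono) auto
    hence "3.14 * 0.95 * 0.336 \<le> pi * \<gamma> * 0.336" by (rule mult_right_mono) simp
    thus ?thesis by simp
  qed
  also have "\<dots> \<le> pi * \<gamma> * ((1 - \<beta>) * c)" using \<open>0.336 \<le> _\<close> g by (intro mult_left_mono) auto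
  also have "\<dots> = pi * \<gamma> / 2 * (1 - b\<^sup>2) * (2 * c / (1 + \<beta>))"
  proof -
    have "1 - b\<^sup>2 = (1 - \<beta>) * (1 + \<beta>)" by (simp add: bb(1) power2_eq_square algebra_simps)
    thus ?thesis using bb(2) by simp
  qed
  also have "\<dots> \<le> pi * \<gamma> / 2 * (1 - b\<^sup>2) * cos u"
    using cu g square_less_2[of b] b by (intro mult_left_mono mult_nonneg_nonneg) auto
  finally show "kern (thr \<gamma> b) 0 u \<le> pi * \<gamma> / 2 * (1 - b\<^sup>2) * cos u" .
qed

text \<open>Closer to 0 the bound 1 for the kernel is too weak. The exponent
  \<open>a\<^sup>2 / (1 - sin u)\<close>, with \<open>\<bar>a\<bar>\<close> at least 0.1772, helps
  exactly where \<open>cos u\<close> is small.\<close>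

lemma hsym_ge_face_near:
  fixes \<gamma> b s :: real
  assumes g: "0.9539798 \<le> \<gamma>" "\<gamma> \<le> 0.95398" and b: "- 0.16 \<le> b" "b \<le> - 0.1" and s: "0 < s" "s \<le> (1 + b) / (1 - b)"
  shows "face \<gamma> b \<le> hsym \<gamma> b s"
  unfolding face_def
proof (rule hsym_antimono[OF s])
  show s1: "(1 + b) / (1 - b) < 1" using b by simp
  have s0: "0 < (1 + b) / (1 - b)" using b by simp
  note as = arcsin_bounds[OF s0 s1]
  define a where "a = thr \<gamma> b"
  have "0.0707 \<le> \<bar>Phi a - 1 / 2\<bar>"
  proof -
    have "\<gamma> * (1 + b) \<le> 0.95398 * 0.9" using g b by (intro mult_mono) auto
    moreover have "Phi a = \<gamma> * (1 + b) / 2" unfolding a_def using g b by simp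
    ultimately show ?thesis by (simp add: abs_if)
  qed
  also have "\<dots> \<le> inv_sqrt_2pi * \<bar>a\<bar>" by (rule abs_ge_of_Phi)
  also have "\<dots> \<le> 0.39894229 * \<bar>a\<bar>" by (intro mult_right_mono inv_sqrt_2pi_le) auto
  finally have "0.1772 \<le> \<bar>a\<bar>" by simp
  hence "0.1772\<^sup>2 \<le> \<bar>a\<bar>\<^sup>2" by (intro power_mono) auto
  hence a2: "0.03139 \<le> a\<^sup>2" by (simp add: power2_eq_square)
  fix u assume u: "0 \<le> u" "u \<le> arcsin ((1 + b) / (1 - b))"
  define r where "r = sin u"
  have r: "0 \<le> r" "r \<le> (1 + b) / (1 - b)" "0 < cos u"
  proof -
    show "0 < cos u" using u as by (intro cos_gt_zero_pi) auto
    show "0 \<le> r" unfolding r_def using u as pi_gt_zero by (intro sin_ge_zero) auto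
    have "sin u \<le> sin (arcsin ((1 + b) / (1 - b)))" using u as by (intro sin_monotone_2pi_le) auto
    thus "r \<le> (1 + b) / (1 - b)" unfolding as(3) r_def .
  qed
  have rb: "(1 - b) * r \<le> 1 + b" using r(2) b by (simp add: pos_le_divide_eq mult.commute)
  have pg: "1.498 \<le> pi * \<gamma> / 2"
  proof -
    have "3.1415 * 0.9539798 \<le> pi * \<gamma>" using pi_approx g by (intro mult_mono) auto
    thus ?thesis by simp
  qed
  \<comment> \<open>One cell \<open>l \<le> r \<le> h\<close> of r = sin u: \<open>m\<close> bounds
    \<open>- b\<close> from above, \<open>q\<close> the cosine and \<open>x\<close> the exponent
    from below, and \<open>exp x\<close> is replaced by its quadratic Taylor polynomial.\<close>
  have seg: "kern a 0 u \<le> pi * \<gamma> / 2 * (1 - b\<^sup>2) * cos u"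
    if h: "l \<le> r" "r \<le> h" "l < 1" "h < 1" "0 \<le> l" "- b \<le> m" "m \<le> 1" "0 \<le> m" "0 \<le> q" "q\<^sup>2 \<le> 1 - h\<^sup>2"
      "0 \<le> x" "x * (1 - l) \<le> 0.03139" "1 \<le> 1.498 * (1 - m\<^sup>2) * q * (1 + x + x\<^sup>2 / 2)" for l h m q x :: real
  proof -
    have "x \<le> 0.03139 / (1 - l)" using h(3,12) by (intro mult_imp_le_div_pos) auto
    also have "\<dots> \<le> a\<^sup>2 / (1 - r)" using h a2 by (intro frac_le) auto
    finally have "kern a 0 u \<le> exp (- x)" by (simp add: kern_def r_def)
    also have "\<dots> \<le> exp (- x) * (1.498 * (1 - m\<^sup>2) * q * (1 + x + x\<^sup>2 / 2))" using h by simp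
    also have "\<dots> = 1.498 * (1 - m\<^sup>2) * q * (exp (- x) * (1 + x + x\<^sup>2 / 2))" by (simp only: ac_simps)
    also have "\<dots> \<le> 1.498 * (1 - m\<^sup>2) * q * 1"
    proof (intro mult_left_mono)
      have "exp (- x) * (1 + x + x\<^sup>2 / 2) \<le> exp (- x) * exp x"
        using h by (intro mult_left_mono exp_lower_Taylor_quadratic) auto
      thus "exp (- x) * (1 + x + x\<^sup>2 / 2) \<le> 1" by (simp add: exp_minus)
      have "m\<^sup>2 \<le> 1" using h by (simp add: power_le_one)
      thus "0 \<le> 1.498 * (1 - m\<^sup>2) * q" using h by simp
    qed
    also have "\<dots> = 1.498 * (1 - m\<^sup>2) * q" by simp
    also have "\<dots> \<le> pi * \<gamma> / 2 * (1 - b\<^sup>2) * cos u"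
    proof (intro mult_mono pg diff_left_mono)
      have "\<bar>b\<bar>\<^sup>2 \<le> m\<^sup>2" using h b by (intro power_mono) auto
      thus bm: "b\<^sup>2 \<le> m\<^sup>2" by simp
      have m1: "m\<^sup>2 \<le> 1" using h by (simp add: power_le_one)
      thus "0 \<le> 1 - m\<^sup>2" by simp
      show "0 \<le> pi * \<gamma> / 2 * (1 - b\<^sup>2)" using g m1 bm by simp
      show "0 \<le> pi * \<gamma> / 2" using g by simp
      have "r\<^sup>2 \<le> h\<^sup>2" using h r by (intro power_mono) auto
      hence "q\<^sup>2 \<le> (cos u)\<^sup>2" using h(10) unfolding cos_squared_eq r_def by simp
      thus "q \<le> cos u" by (rule power2_le_imp_le) (use r in simp)
    qed (use h in auto)
    finally show ?thesis .
  qed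
  note seg = seg[unfolded a_def]
  \<comment> \<open>Since \<open>r \<le> (1 + b) / (1 - b)\<close>, a large \<open>r\<close> forces
    a small \<open>- b\<close>, which lets \<open>m\<close> shrink as \<open>r\<close>
    grows.\<close>
  consider "r \<le> 0.72" | "0.72 \<le> r" "r \<le> 0.77" | "0.77 \<le> r" "r \<le> 0.8" | "0.8 \<le> r" "r \<le> 0.81" | "0.81 \<le> r"
    by linarith
  thus "kern (thr \<gamma> b) 0 u \<le> pi * \<gamma> / 2 * (1 - b\<^sup>2) * cos u"
  proof cases
    case 1
    show ?thesis by (rule seg[where l = 0 and h = "0.72" and m = "0.16" and q = "0.6939" and x = 0])
      (use 1 r b in \<open>auto simp: power2_eq_square\<close>)
  next
    case 2
    have "(1 - b) * 0.72 \<le> 1 + b" using order_trans[OF mult_left_mono[OF 2(1)] rb] b by simp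
    hence "- b \<le> 0.163" by simp
    show ?thesis by (rule seg[where l = "0.72" and h = "0.77" and m = "0.16" and q = "0.638" and x = "0.1121"])
      (use 2 b \<open>- b \<le> 0.163\<close> in \<open>auto simp: power2_eq_square\<close>)
  next
    case 3
    have "(1 - b) * 0.77 \<le> 1 + b" using order_trans[OF mult_left_mono[OF 3(1)] rb] b by simp
    hence "- b \<le> 0.13" by simp
    show ?thesis by (rule seg[where l = "0.77" and h = "0.8" and m = "0.13" and q = "0.6" and x = "0.1364"])
      (use 3 b \<open>- b \<le> 0.13\<close> in \<open>auto simp: power2_eq_square\<close>)
  next
    case 4
    have "(1 - b) * 0.8 \<le> 1 + b" using order_trans[OF mult_left_mono[OF 4(1)] rb] b by simp
    hence "- b \<le> 0.112" by simp
    show ?thesis by (rule seg[where l = "0.8" and h = "0.81" and m = "0.112" and q = "0.5864" and x = "0.1569"])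
      (use 4 b \<open>- b \<le> 0.112\<close> in \<open>auto simp: power2_eq_square\<close>)
  next
    case 5
    have "(1 - b) * 0.81 \<le> 1 + b" using order_trans[OF mult_left_mono[OF 5(1)] rb] b by simp
    hence m: "- b \<le> 0.105" by simp
    have "r \<le> 0.81819"
    proof (rule ccontr)
      assume "\<not> r \<le> 0.81819"
      hence "(1 - b) * 0.81819 \<le> 1 + b" using order_trans[OF mult_left_mono[of "0.81819" r "1 - b"] rb] b by simp
      thus False using b by simp
    qed
    thus ?thesis by (intro seg[where l = "0.81" and h = "0.81819" and m = "0.105" and q = "0.5749" and x = "0.1652"])
      (use 5 b m in \<open>auto simp: power2_eq_square\<close>)
  qed
qed

section \<open>Assembling the cases\<close>

lemma sqrt_product_pos:
  assumes "- 1 < b1" "b1 < 1" "- 1 < b2" "b2 < (1 :: real)"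
  shows "0 < sqrt ((1 - b1\<^sup>2) * (1 - b2\<^sup>2))"
  using square_less_2[OF assms(1,2)] square_less_2[OF assms(3,4)] by simp

text \<open>\<open>v\<close> will be the minimum over the facet. All other ranges have a fixed
  margin of at least 0.000001, which is the bound imposed on \<open>v\<close>.\<close>

lemma h_ge_of_face:
  fixes \<gamma> v b1 b2 b12 :: real
  assumes g: "0.9539798 \<le> \<gamma>" "\<gamma> \<le> 0.95398" and v: "v \<le> 0.000001"
    and face: "\<And>b. - 0.45 \<le> b \<Longrightarrow> b \<le> - 0.1 \<Longrightarrow> v \<le> face \<gamma> b"
    and feas: "feasible b1 b2 b12"
  shows "v \<le> h \<gamma> b1 b2 b12"
proof (rule h_classify[OF _ _ feas, of \<gamma>])
  show "0 < \<gamma>" "\<gamma> < 1" using g by auto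
  assume "1 - \<gamma> \<le> h \<gamma> b1 b2 b12"
  moreover have "v \<le> 1 - \<gamma>" using g v by simp
  ultimately show ?thesis by linarith
next
  assume b: "- 1 < b1" "b1 < 1" "- 1 < b2" "b2 < 1" and w0: "0 < b1 * b2 - b12"
    and w: "b1 * b2 - b12 < sqrt ((1 - b1\<^sup>2) * (1 - b2\<^sup>2))"
      "b1 * b2 - b12 \<le> (1 + b1) * (1 + b2)" "b1 * b2 - b12 \<le> (1 - b1) * (1 - b2)"
  define A where "A = sqrt ((1 - b1\<^sup>2) * (1 - b2\<^sup>2))"
  have A: "0 < A" unfolding A_def by (rule sqrt_product_pos[OF b])
  show ?thesis
  proof (cases "0.192 < b1 * b2 - b12")
    \<comment> \<open>Since 0.95398 * 0.192 / 4 is below 0.046019, nonnegativity of \<open>K\<close>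
      is enough here, without symmetrization.\<close>
    case False
    define s where "s = (b1 * b2 - b12) / A"
    have s: "0 \<le> s" "s < 1" "b1 * b2 - b12 = s * A" using w0 w A by (auto simp: s_def A_def[symmetric])
    have "0 \<le> K a e (arcsin s)" for a e
      using K_mono[of 0 "arcsin s" a e] s arcsin_less_arcsin[of s 1] arcsin_nonneg[of s] by (simp add: K_def)
    moreover have "h \<gamma> b1 b2 b12 = (1 - \<gamma>) * (1 + \<gamma> * ((1 + b1) * (1 + b2)) / 4) - \<gamma> * (b1 * b2 - b12) / 4
        + K ((thr \<gamma> b1 + thr \<gamma> b2) / 2) ((thr \<gamma> b1 - thr \<gamma> b2) / 2) (arcsin s)"
      using h_negative_correlation[of \<gamma> b1 b2 s b12] g b s by (simp add: A_def)
    moreover have "(1 - \<gamma>) * 1 \<le> (1 - \<gamma>) * (1 + \<gamma> * ((1 + b1) * (1 + b2)) / 4)"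
      using g b by (intro mult_left_mono) auto
    moreover have "\<gamma> * (b1 * b2 - b12) \<le> 0.95398 * 0.192"
      using g w0 False by (intro mult_mono) auto
    moreover have "v \<le> base - p / 4 + k" if "0 \<le> k" "(1 - \<gamma>) * 1 \<le> base" "p \<le> 0.95398 * 0.192" for base p k
      using that g v by simp
    ultimately show ?thesis by simp
  next
    case True
    obtain b s e where bs: "- 1 < b" "b < 1" "0 < s" "s < 1"
      "\<gamma> * (1 + b) \<le> 1 \<Longrightarrow> s * (1 - b\<^sup>2) \<le> (1 + b)\<^sup>2"
      "1 \<le> \<gamma> * (1 + b) \<Longrightarrow> s * (1 - b\<^sup>2) \<le> (1 - b)\<^sup>2"
      "0 \<le> hsym \<gamma> b s - v + e\<^sup>2 * (0.00415 - 0.00472 * (1 + b)\<^sup>2) + 0.00747 * (e\<^sup>2)\<^sup>2 \<Longrightarrow> v \<le> h \<gamma> b1 b2 b12"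
      by (rule symmetrization[OF g b True w v]) (rule that; blast)
    have gb: "0.9539798 * (1 + b) \<le> \<gamma> * (1 + b)" "\<gamma> * (1 + b) \<le> 0.95398 * (1 + b)"
      by (rule mult_right_mono; use g bs in simp)+
    have neg: "s * (1 - b\<^sup>2) \<le> (1 + b)\<^sup>2" if "b \<le> 0" using bs(5) gb that by simp
    have pos: "s * (1 - b\<^sup>2) \<le> (1 - b)\<^sup>2" if "0.2 \<le> b" using bs(6) gb that by simp
    define E where "E = e\<^sup>2"
    have E: "0 \<le> E" by (simp add: E_def)
    \<comment> \<open>For \<open>b \<le> - 0.063\<close> the coefficient of \<open>e\<^sup>2\<close>
      is nonnegative, because 0.00472 * 0.937^2 < 0.00415. For larger b it can be negative, and the
      larger margin of \<open>hsym\<close> together with the term in \<open>e\<^sup>4\<close>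
      compensates.\<close>
    consider "b \<le> - 0.063" | "- 0.063 \<le> b" "b \<le> 0.562" | "0.562 \<le> b" by linarith
    thus ?thesis
    proof cases
      case 1
      have "v \<le> hsym \<gamma> b s"
      proof -
        consider "b \<le> - 0.562" | "- 0.562 \<le> b" "b \<le> - 0.45" | "- 0.45 \<le> b" "b \<le> - 0.16"
          | "- 0.16 \<le> b" "b \<le> - 0.1" | "- 0.1 \<le> b" using 1 by linarith
        thus ?thesis
        proof cases
          case 1
          have "(1 + b)\<^sup>2 \<le> 0.438\<^sup>2" using bs 1 by (intro power_mono) auto
          hence "(1 - b\<^sup>2) * s \<le> 0.19185" using neg 1 by (simp add: power2_eq_square mult.commute)
          moreover have "v \<le> H" if "0.00026 + 0.01 * X \<le> H" "0 \<le> X" for X H using that v by simp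
          ultimately show ?thesis using hsym_ge_product[OF g bs(1-4)] zero_le_power2[of "1 + b"] by blast
        next
          case 2
          from hsym_ge_left[OF g 2 bs(3,4) neg] 2 v show ?thesis by simp
        next
          case 3
          have "s * (1 - b) * (1 + b) \<le> (1 + b) * (1 + b)" using neg 3 by (simp add: power2_eq_square algebra_simps)
          hence "s \<le> (1 + b) / (1 - b)" using bs by (simp add: pos_le_divide_eq)
          from hsym_ge_face_far[OF g 3 bs(3) this] face[of b] 3 show ?thesis by simp
        next
          case 4
          have "s * (1 - b) * (1 + b) \<le> (1 + b) * (1 + b)" using neg 4 by (simp add: power2_eq_square algebra_simps)
          hence "s \<le> (1 + b) / (1 - b)" using bs by (simp add: pos_le_divide_eq)
          from hsym_ge_face_near[OF g 4 bs(3) this] face[of b] 4 show ?thesis by simp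
        next
          case 5
          from hsym_ge_near_left[OF g 5 \<open>b \<le> - 0.063\<close> bs(3,4) neg] 1 v show ?thesis by simp
        qed
      qed
      moreover have "0 \<le> E * (0.00415 - 0.00472 * (1 + b)\<^sup>2)"
      proof -
        have "(1 + b)\<^sup>2 \<le> 0.937\<^sup>2" using bs 1 by (intro power_mono) auto
        thus ?thesis using E by (simp add: power2_eq_square)
      qed
      moreover have "0 \<le> 0.00747 * E\<^sup>2" by simp
      ultimately have "0 \<le> hsym \<gamma> b s - v + E * (0.00415 - 0.00472 * (1 + b)\<^sup>2) + 0.00747 * E\<^sup>2" by linarith
      thus ?thesis by (intro bs(7)) (simp add: E_def)
    next
      case 2
      have H: "0.002 \<le> hsym \<gamma> b s"
        using hsym_ge_centre[OF g 2(1) _ bs(3,4) bs(5,6)] hsym_ge_right[OF g _ 2(2) bs(3,4) pos] by fastforce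
      have "(1 + b)\<^sup>2 \<le> 1.562\<^sup>2" using bs 2 by (intro power_mono) auto
      hence "E * (0.00415 - 0.00472 * 1.562\<^sup>2) \<le> E * (0.00415 - 0.00472 * (1 + b)\<^sup>2)"
        using E by (intro mult_left_mono) auto
      \<comment> \<open>0.494 is close to the vertex of this quadratic in \<open>E\<close>.\<close>
      moreover have "0 \<le> 0.0019 + E * (0.00415 - 0.00472 * 1.562\<^sup>2) + 0.00747 * E\<^sup>2"
        using zero_le_power2[of "E - 0.494"] E by (simp add: power2_eq_square algebra_simps)
      moreover have "0 \<le> x - v + p + q" if "0.002 \<le> x" "p' \<le> p" "0 \<le> 0.0019 + p' + q" for x p p' q
        using that v by simp
      ultimately have "0 \<le> hsym \<gamma> b s - v + E * (0.00415 - 0.00472 * (1 + b)\<^sup>2) + 0.00747 * E\<^sup>2"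
        using H by blast
      thus ?thesis by (intro bs(7)) (simp add: E_def)
    next
      case 3
      have "(1 - b)\<^sup>2 \<le> 0.438\<^sup>2" using bs 3 by (intro power_mono) auto
      hence "(1 - b\<^sup>2) * s \<le> 0.19185" using pos 3 by (simp add: power2_eq_square mult.commute)
      note H = hsym_ge_product[OF g bs(1-4) this]
      have "1.562\<^sup>2 \<le> (1 + b)\<^sup>2" "(1 + b)\<^sup>2 \<le> 2\<^sup>2"
        by (rule power_mono; use bs(1,2) 3 in simp)+
      hence X: "2.4 \<le> (1 + b)\<^sup>2" "(1 + b)\<^sup>2 \<le> 4" by (simp_all add: power2_eq_square)
      have "E * (0.00415 - 0.00472 * 4) \<le> E * (0.00415 - 0.00472 * (1 + b)\<^sup>2)"
        using E X by (intro mult_left_mono) auto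
      moreover have "0 \<le> 0.02 + E * (0.00415 - 0.00472 * 4) + 0.00747 * E\<^sup>2"
        using zero_le_power2[of "E - 1"] E by (simp add: power2_eq_square algebra_simps)
      moreover have "0 \<le> x - v + p + q" if "0.00026 + 0.01 * Y \<le> x" "2.4 \<le> Y" "p' \<le> p" "0 \<le> 0.02 + p' + q" for x p p' q Y
        using that v by simp
      ultimately have "0 \<le> hsym \<gamma> b s - v + E * (0.00415 - 0.00472 * (1 + b)\<^sup>2) + 0.00747 * E\<^sup>2"
        using H X by blast
      thus ?thesis by (intro bs(7)) (simp add: E_def)
    qed
  qed
qed

section \<open>The slope along the facet\<close>

text \<open>A chain rule that asks for a derivative in the first argument, continuous at the point,
  and for a derivative in the second along one line only. The mean value theorem in the first
  argument supplies the intermediate point \<open>z\<close>.\<close>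

lemma DERIV_two_arguments:
  fixes F D :: "real \<Rightarrow> real \<Rightarrow> real" and u :: "real \<Rightarrow> real"
  assumes F: "\<And>x y. y \<in> S \<Longrightarrow> ((\<lambda>x. F x y) has_real_derivative D x y) (at x)"
    and S: "open S" "b \<in> S" and D: "isCont (\<lambda>p. D (fst p) (snd p)) (u b, b)"
    and u: "(u has_real_derivative u') (at b)"
    and E: "((\<lambda>y. F (u b) y) has_real_derivative E) (at b)"
  shows "((\<lambda>y. F (u y) y) has_real_derivative D (u b) b * u' + E) (at b)"
proof -
  have ex: "\<exists>z. \<bar>z - u b\<bar> \<le> \<bar>x - u b\<bar> \<and> F x y - F (u b) y = (x - u b) * D z y" if y: "y \<in> S" for x y
  proof -
    consider "x = u b" | "x < u b" | "u b < x" by linarith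
    thus ?thesis
    proof cases
      case 2
      then obtain z where "x < z" "z < u b" "F (u b) y - F x y = (u b - x) * D z y"
        using MVT2[of x "u b" "\<lambda>x. F x y" "\<lambda>x. D x y"] F[OF y] by blast
      thus ?thesis by (intro exI[of _ z]) (auto simp: algebra_simps)
    next
      case 3
      then obtain z where "u b < z" "z < x" "F x y - F (u b) y = (x - u b) * D z y"
        using MVT2[of "u b" x "\<lambda>x. F x y" "\<lambda>x. D x y"] F[OF y] by blast
      thus ?thesis by (intro exI[of _ z]) auto
    qed auto
  qed
  define z where "z x y = (SOME z. \<bar>z - u b\<bar> \<le> \<bar>x - u b\<bar> \<and> F x y - F (u b) y = (x - u b) * D z y)" for x y
  have z: "\<bar>z x y - u b\<bar> \<le> \<bar>x - u b\<bar>" "F x y - F (u b) y = (x - u b) * D (z x y) y" if "y \<in> S" for x y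
    unfolding z_def using someI_ex[OF ex[OF that]] by auto
  have evS: "\<forall>\<^sub>F y in at b. y \<in> S" using eventually_at_in_open'[OF S] by simp
  have "(u \<longlongrightarrow> u b) (at b)" using DERIV_isCont[OF u] by (simp add: isCont_def)
  hence "((\<lambda>y. \<bar>u y - u b\<bar>) \<longlongrightarrow> 0) (at b)" by (auto intro: tendsto_rabs_zero LIM_zero)
  hence "((\<lambda>y. z (u y) y - u b) \<longlongrightarrow> 0) (at b)"
    by (rule Lim_null_comparison[rotated]) (use eventually_mono[OF evS] z(1) in \<open>fastforce\<close>)
  hence "((\<lambda>y. z (u y) y) \<longlongrightarrow> u b) (at b)" by (rule LIM_zero_cancel)
  hence "((\<lambda>y. (z (u y) y, y)) \<longlongrightarrow> (u b, b)) (at b)" by (intro tendsto_intros)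
  hence Dz: "((\<lambda>y. D (z (u y) y) y) \<longlongrightarrow> D (u b) b) (at b)"
    using isCont_tendsto_compose[OF D] by fastforce
  have "((\<lambda>y. D (z (u y) y) y * ((u y - u b) / (y - b)) + (F (u b) y - F (u b) b) / (y - b))
      \<longlongrightarrow> D (u b) b * u' + E) (at b)"
    using u E by (intro tendsto_add tendsto_mult Dz) (auto simp: has_field_derivative_iff)
  moreover have "\<forall>\<^sub>F y in at b. D (z (u y) y) y * ((u y - u b) / (y - b)) + (F (u b) y - F (u b) b) / (y - b)
      = (F (u y) y - F (u b) b) / (y - b)"
    using evS
  proof eventually_elim
    case (elim y)
    show ?case using z(2)[OF elim, of "u y"] by (simp add: add_divide_distrib[symmetric] mult.commute)
  qed
  ultimately show ?thesis unfolding has_field_derivative_iff by (rule Lim_transform_eventually)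
qed

text \<open>\<open>1 / (1 - sin u)\<close> equals \<open>(1 + 1 / (half_tan u)\<^sup>2) / 2\<close>,
  so the exponent splits into two squares.\<close>

lemma kern_eq_density:
  assumes "0 < cos u"
  shows "kern a 0 u = 2 * pi * (\<phi> a * \<phi> (a / half_tan u))"
proof -
  note s = cos_pos_sin[OF assms]
  have h2: "(half_tan u)\<^sup>2 = (1 - sin u) / (1 + sin u)"
    using half_tan_sq[of u] s by (simp add: field_simps)
  have "a\<^sup>2 / 2 + (a / half_tan u)\<^sup>2 / 2 = a\<^sup>2 / (1 - sin u)"
    unfolding power_divide h2 using s by (simp add: field_simps)
  hence e: "exp (- (a\<^sup>2 / 2)) * exp (- ((a / half_tan u)\<^sup>2 / 2)) = kern a 0 u"
    by (simp add: kern_def flip: exp_add)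
  have "2 * pi * (inv_sqrt_2pi * inv_sqrt_2pi) = 1" by (simp add: inv_sqrt_2pi_def)
  hence "2 * pi * (inv_sqrt_2pi * inv_sqrt_2pi) * (exp (- (a\<^sup>2 / 2)) * exp (- ((a / half_tan u)\<^sup>2 / 2))) = kern a 0 u"
    unfolding e by (simp only: mult_1_left)
  thus ?thesis unfolding std_normal_density_eq by (simp only: ac_simps)
qed

text \<open>The derivative of the kernel in \<open>a\<close> is a total derivative in the angle,
  with a multiple of \<open>\<phi> a * Phi (a / half_tan u)\<close> as primitive; this makes the
  slope along the facet explicit.\<close>

lemma DERIV_K_first:
  assumes "0 \<le> \<Theta>" "\<Theta> < pi / 2"
  shows "((\<lambda>a. K a 0 \<Theta>) has_real_derivative 2 * \<phi> a * (Phi a - Phi (a / half_tan \<Theta>))) (at a)"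
proof -
  have cp: "cos u > 0" if "u \<in> {0..\<Theta>}" for u using that assms by (intro cos_gt_zero_pi) auto
  have sp: "1 - sin u > 0" if "u \<in> {0..\<Theta>}" for u using cos_pos_sin[OF cp[OF that]] by auto
  define D where "D a u = - (2 * a / (1 - sin u)) * kern a 0 u" for a u
  have "((\<lambda>a. integral (cbox 0 \<Theta>) (kern a 0)) has_field_derivative integral (cbox 0 \<Theta>) (D a)) (at a within UNIV)"
  proof (rule leibniz_rule_field_derivative)
    fix x u :: real
    define w where "w = 1 / (1 - sin u)"
    have "((\<lambda>x. exp (- (x\<^sup>2 * w))) has_real_derivative - (2 * x * w) * exp (- (x\<^sup>2 * w))) (at x)"
      by (auto intro!: derivative_eq_intros)
    thus "((\<lambda>x. kern x 0 u) has_field_derivative D x u) (at x within UNIV)"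
      by (simp add: kern_def D_def w_def)
  next
    fix x show "kern x 0 integrable_on cbox 0 \<Theta>"
      unfolding cbox_interval by (intro integrable_continuous_real continuous_on_kern cp)
  next
    show "continuous_on (UNIV \<times> cbox 0 \<Theta>) (\<lambda>(x, u). D x u)"
      unfolding D_def kern_def case_prod_beta cbox_interval
      by (intro continuous_intros) (use cp cos_pos_sin in \<open>fastforce+\<close>)
  qed auto
  moreover have "(D a has_integral - 4 * pi * \<phi> a * Phi (a / half_tan \<Theta>) - - 4 * pi * \<phi> a * Phi (a / half_tan 0)) {0..\<Theta>}"
  proof (rule fundamental_theorem_of_calculus[OF assms(1)])
    fix u assume u: "u \<in> {0..\<Theta>}"
    have "((\<lambda>u. - 4 * pi * \<phi> a * Phi (a * (1 / half_tan u))) has_real_derivative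
        - 4 * pi * \<phi> a * (\<phi> (a * (1 / half_tan u)) * (a * (1 / (1 - sin u))))) (at u within {0..\<Theta>})"
      by (intro DERIV_cmult DERIV_chain2[OF DERIV_Phi] DERIV_inverse_half_tan cp u)
    moreover have "- 4 * pi * \<phi> a * (\<phi> (a * (1 / half_tan u)) * (a * (1 / (1 - sin u)))) = D a u"
      unfolding D_def kern_eq_density[OF cp[OF u]] by simp
    ultimately show "((\<lambda>u. - 4 * pi * \<phi> a * Phi (a / half_tan u)) has_vector_derivative D a u) (at u within {0..\<Theta>})"
      by (simp add: has_real_derivative_iff_has_vector_derivative)
  qed
  hence "integral {0..\<Theta>} (D a) = - 4 * pi * \<phi> a * Phi (a / half_tan \<Theta>) - - 4 * pi * \<phi> a * Phi (a / half_tan 0)"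
    by (rule integral_unique)
  hence "integral {0..\<Theta>} (D a) = 2 * \<phi> a * (Phi a - Phi (a / half_tan \<Theta>)) * (2 * pi)"
    by (simp add: half_tan_def algebra_simps)
  ultimately have "((\<lambda>a. integral {0..\<Theta>} (kern a 0)) has_real_derivative
      2 * \<phi> a * (Phi a - Phi (a / half_tan \<Theta>)) * (2 * pi)) (at a)" by simp
  from DERIV_cdivide[OF this, of "2 * pi"] show ?thesis unfolding K_def by (simp add: mult.assoc)
qed

lemma DERIV_K_angle:
  assumes "0 < \<Theta>" "\<Theta> < pi / 2"
  shows "((\<lambda>\<Theta>. K a e \<Theta>) has_real_derivative kern a e \<Theta> / (2 * pi)) (at \<Theta>)"
proof -
  define t where "t = (\<Theta> + pi / 2) / 2"
  have t: "\<Theta> < t" "t < pi / 2" using assms by (auto simp: t_def)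
  have "continuous_on {0..t} (kern a e)"
    by (intro continuous_on_kern cos_gt_zero_pi) (use t in auto)
  hence "((\<lambda>u. integral {0..u} (kern a e)) has_vector_derivative kern a e \<Theta>) (at \<Theta> within {0..t})"
    by (rule integral_has_vector_derivative) (use assms t in auto)
  hence "((\<lambda>u. integral {0..u} (kern a e)) has_real_derivative kern a e \<Theta>) (at \<Theta>)"
    using assms t by (simp add: has_real_derivative_iff_has_vector_derivative at_within_Icc_at)
  from DERIV_cdivide[OF this, of "2 * pi"] show ?thesis unfolding K_def .
qed

lemma face_angle:
  assumes "- 1 < b" "b < 0"
  shows "arcsin ((1 + b) / (1 - b)) = pi / 2 - 2 * arctan (sqrt (- b))"
    "half_tan (arcsin ((1 + b) / (1 - b))) = sqrt (- b)"
    "0 < arcsin ((1 + b) / (1 - b))" "arcsin ((1 + b) / (1 - b)) < pi / 2"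
proof -
  have s: "0 < (1 + b) / (1 - b)" "(1 + b) / (1 - b) < 1" using assms by auto
  obtain k where k: "0 < k" "k\<^sup>2 = (1 - (1 + b) / (1 - b)) / (1 + (1 + b) / (1 - b))"
    "half_tan (arcsin ((1 + b) / (1 - b))) = k" "arcsin ((1 + b) / (1 - b)) = pi / 2 - 2 * arctan k"
    "arcsin ((1 + b) / (1 - b)) < pi / 2"
    by (rule half_tan_param[OF s])
  have "(1 - (1 + b) / (1 - b)) / (1 + (1 + b) / (1 - b)) = - b" using assms by (simp add: field_simps)
  hence "k = sqrt (- b)" using k(1,2) by (simp add: real_sqrt_unique)
  thus "arcsin ((1 + b) / (1 - b)) = pi / 2 - 2 * arctan (sqrt (- b))"
    "half_tan (arcsin ((1 + b) / (1 - b))) = sqrt (- b)" using k by auto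
  show "0 < arcsin ((1 + b) / (1 - b))" using arcsin_less_arcsin[of 0 "(1 + b) / (1 - b)"] s by simp
  show "arcsin ((1 + b) / (1 - b)) < pi / 2" using k by simp
qed

lemma face_eq:
  assumes "- 1 < b" "b < 0"
  shows "face \<gamma> b = 1 - \<gamma> - (\<gamma> * (1 + b) / 2)\<^sup>2 + K (thr \<gamma> b) 0 (pi / 2 - 2 * arctan (sqrt (- b)))"
proof -
  have "(1 - b\<^sup>2) * ((1 + b) / (1 - b)) = (1 + b)\<^sup>2"
    using assms by (simp add: field_simps power2_eq_square)
  moreover have "(1 - \<gamma>) * (1 + \<gamma> * X / 4) - \<gamma> * X / 4 = 1 - \<gamma> - \<gamma>\<^sup>2 * X / 4" for X
    by (simp add: power2_eq_square algebra_simps add_divide_distrib diff_divide_distrib)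
  ultimately show ?thesis unfolding face_def hsym_def face_angle(1)[OF assms]
    by (simp add: power_mult_distrib power_divide)
qed

text \<open>Minus the derivative of \<open>face\<close>; see \<open>DERIV_face\<close>.\<close>

definition slope :: "real \<Rightarrow> real \<Rightarrow> real" where
  "slope \<gamma> b = \<gamma> * Phi (thr \<gamma> b / sqrt (- b)) - \<phi> (thr \<gamma> b / sqrt (- b)) * \<phi> (thr \<gamma> b) / ((1 - b) * sqrt (- b))"

lemma DERIV_thr:
  assumes "0 < \<gamma>" "\<gamma> < 1" "- 1 < b" "b < 1"
  shows "(thr \<gamma> has_real_derivative \<gamma> / (2 * \<phi> (thr \<gamma> b))) (at b)"
proof -
  have "0 < \<gamma> * (1 + b) / 2" "\<gamma> * (1 + b) / 2 < 1" using prob_range assms by auto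
  from DERIV_quantile[OF this]
  have "((\<lambda>b. quantile (\<gamma> * (1 + b) / 2)) has_real_derivative 1 / \<phi> (quantile (\<gamma> * (1 + b) / 2)) * (\<gamma> / 2)) (at b)"
    by (rule DERIV_chain2) (auto intro!: derivative_eq_intros)
  thus ?thesis unfolding thr_def[abs_def] by (simp add: mult.commute)
qed

text \<open>Two contributions cancel: the square \<open>(\<gamma> * (1 + b) / 2)\<^sup>2\<close>
  gives \<open>- \<gamma> * Phi a\<close> and the moving threshold gives
  \<open>\<gamma> * Phi a\<close>.\<close>

lemma DERIV_face:
  assumes g: "0 < \<gamma>" "\<gamma> < 1" and b: "- 1 < b" "b < 0"
  shows "(face \<gamma> has_real_derivative - slope \<gamma> b) (at b)"
proof -
  define c where "c = sqrt (- b)"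
  define T where "T y = pi / 2 - 2 * arctan (sqrt (- y))" for y
  have c: "0 < c" "c\<^sup>2 = - b" using b by (auto simp: c_def)
  have T: "0 < T y" "T y < pi / 2" "half_tan (T y) = sqrt (- y)" if "y \<in> {- 1<..<0}" for y
    using face_angle[of y] that by (auto simp: T_def)
  define a where "a = thr \<gamma> b"
  have da: "(thr \<gamma> has_real_derivative \<gamma> / (2 * \<phi> a)) (at b)" unfolding a_def by (rule DERIV_thr) (use assms in auto)
  have dT: "(T has_real_derivative 1 / ((1 - b) * c)) (at b)"
  proof -
    have "(T has_real_derivative 0 - 2 * (inverse (1 + (sqrt (- b))\<^sup>2) * (inverse (sqrt (- b)) / 2 * - 1))) (at b)"
      unfolding T_def[abs_def]
      by (intro DERIV_diff DERIV_const DERIV_cmult DERIV_chain2[OF DERIV_arctan] DERIV_chain2[OF DERIV_real_sqrt])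
         (use b in \<open>auto intro!: derivative_eq_intros\<close>)
    moreover have "0 - 2 * (inverse (1 + (sqrt (- b))\<^sup>2) * (inverse (sqrt (- b)) / 2 * - 1)) = 1 / ((1 - b) * c)"
      unfolding c_def[symmetric] c(2) using c b by (simp add: inverse_eq_divide)
    ultimately show ?thesis by simp
  qed
  have bS: "b \<in> {- 1<..<0}" using b by simp
  have "((\<lambda>y. K a 0 (T y)) has_real_derivative kern a 0 (T b) / (2 * pi) * (1 / ((1 - b) * c))) (at b)"
    by (rule DERIV_chain2[OF DERIV_K_angle[OF T(1,2)[OF bS]] dT])
  moreover have "kern a 0 (T b) / (2 * pi) = \<phi> a * \<phi> (a / c)"
  proof -
    have "0 < cos (T b)" using T[OF bS] by (intro cos_gt_zero_pi) auto
    thus ?thesis using kern_eq_density[of "T b" a] T(3)[OF bS] by (simp add: c_def)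
  qed
  ultimately have "((\<lambda>y. K a 0 (T y)) has_real_derivative \<phi> a * \<phi> (a / c) * (1 / ((1 - b) * c))) (at b)"
    by (simp only:)
  hence dE: "((\<lambda>y. K (thr \<gamma> b) 0 (T y)) has_real_derivative \<phi> a * \<phi> (a / c) / ((1 - b) * c)) (at b)"
    by (simp add: a_def)
  have D: "((\<lambda>x. K x 0 (T y)) has_real_derivative 2 * \<phi> x * (Phi x - Phi (x / sqrt (- y)))) (at x)"
    if y: "y \<in> {- 1<..<0}" for x y
    using DERIV_K_first[of "T y" x] T[OF y] by simp
  have "((\<lambda>y. K (thr \<gamma> y) 0 (T y)) has_real_derivative
      2 * \<phi> (thr \<gamma> b) * (Phi (thr \<gamma> b) - Phi (thr \<gamma> b / sqrt (- b))) * (\<gamma> / (2 * \<phi> a)) + \<phi> a * \<phi> (a / c) / ((1 - b) * c)) (at b)"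
  proof (rule DERIV_two_arguments[OF D _ bS _ da dE])
    let ?p = "(thr \<gamma> b, b)"
    have "isCont (\<lambda>p. \<phi> (fst p)) ?p"
      by (rule isCont_o2[OF _ DERIV_isCont[OF DERIV_std_normal_density]]) (intro continuous_intros)
    moreover have "isCont (\<lambda>p. Phi (fst p)) ?p"
      by (rule isCont_o2[OF _ isCont_Phi]) (intro continuous_intros)
    moreover have "isCont (\<lambda>p. fst p / sqrt (- snd p)) ?p"
      by (rule isCont_divide) (use b in \<open>auto intro!: continuous_intros\<close>)
    hence "isCont (\<lambda>p. Phi (fst p / sqrt (- snd p))) ?p"
      by (rule isCont_o2[OF _ isCont_Phi])
    ultimately show "isCont (\<lambda>p. 2 * \<phi> (fst p) * (Phi (fst p) - Phi (fst p / sqrt (- snd p)))) ?p"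
      by (intro continuous_mult continuous_diff continuous_const)
  qed auto
  moreover have "2 * \<phi> a * (Phi a - Phi (a / c)) * (\<gamma> / (2 * \<phi> a)) = \<gamma> * (Phi a - Phi (a / c))"
  proof -
    have "2 * p * x * (\<gamma> / (2 * p)) = \<gamma> * x" if "0 < p" for p x :: real using that by simp
    thus ?thesis using std_normal_density_pos by blast
  qed
  ultimately have "((\<lambda>y. 1 - \<gamma> - (\<gamma> * (1 + y) / 2)\<^sup>2 + K (thr \<gamma> y) 0 (T y)) has_real_derivative
      - (2 * (\<gamma> * (1 + b) / 2) * (\<gamma> / 2)) + (\<gamma> * (Phi a - Phi (a / c)) + \<phi> a * \<phi> (a / c) / ((1 - b) * c))) (at b)"
    unfolding a_def[symmetric] c_def[symmetric]
    by (auto intro!: derivative_eq_intros)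
  moreover have "- (2 * (\<gamma> * (1 + b) / 2) * (\<gamma> / 2)) + (\<gamma> * (Phi a - Phi (a / c)) + \<phi> a * \<phi> (a / c) / ((1 - b) * c)) = - slope \<gamma> b"
  proof -
    have "Phi a = \<gamma> * (1 + b) / 2" unfolding a_def using assms by simp
    thus ?thesis unfolding slope_def a_def[symmetric] c_def[symmetric] by (simp add: algebra_simps)
  qed
  ultimately have "((\<lambda>y. 1 - \<gamma> - (\<gamma> * (1 + y) / 2)\<^sup>2 + K (thr \<gamma> y) 0 (T y)) has_real_derivative - slope \<gamma> b) (at b)"
    by simp
  thus ?thesis
    by (rule has_field_derivative_transform_within_open[OF _ open_greaterThanLessThan bS])
       (simp add: face_eq T_def)
qed

text \<open>The ratios \<open>q\<close> and \<open>r\<close> are chosen because \<open>a / c\<close>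
  has derivative \<open>(q - r) / (2 * c)\<close>; in them the bracket is one square against two
  negative terms.\<close>

lemma DERIV_slope:
  assumes g: "0 < \<gamma>" "\<gamma> < 1" and b: "- 1 < b" "b < 0"
  defines "a \<equiv> thr \<gamma> b" and "c \<equiv> sqrt (- b)"
  defines "q \<equiv> \<gamma> / \<phi> a" and "r \<equiv> a / b"
  shows "(slope \<gamma> has_real_derivative \<phi> (a / c) * \<phi> a / (2 * c) *
    ((q - r)\<^sup>2 - r\<^sup>2 * c\<^sup>2 / (1 + c\<^sup>2) - (1 + 3 * c\<^sup>2) / (c\<^sup>2 * (1 + c\<^sup>2)\<^sup>2))) (at b)"
proof -
  have c: "0 < c" "b = - c\<^sup>2" using b by (auto simp: c_def)
  define p where "p = \<phi> a"
  define P where "P = \<phi> (a / c)"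
  have p: "0 < p" by (simp add: p_def std_normal_density_pos)
  have gq: "\<gamma> = p * q" unfolding q_def p_def[symmetric] using p by simp
  have ar: "a = - r * c\<^sup>2" using b c by (simp add: r_def)
  have da: "(thr \<gamma> has_real_derivative q / 2) (at b)"
    using DERIV_thr[of \<gamma> b] g b by (simp add: q_def a_def mult.commute)
  have dc: "((\<lambda>b. sqrt (- b)) has_real_derivative - (1 / (2 * c))) (at b)"
    using b by (auto intro!: derivative_eq_intros simp: c_def inverse_eq_divide)
  define u' where "u' = (q / 2 * c - a * - (1 / (2 * c))) / (c * c)"
  have du: "((\<lambda>b. thr \<gamma> b / sqrt (- b)) has_real_derivative u') (at b)"
    unfolding u'_def a_def c_def by (rule DERIV_divide[OF da dc[unfolded c_def]]) (use b in auto)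
  have u': "u' = (q - r) / (2 * c)"
    unfolding u'_def ar using c by (simp add: field_simps power2_eq_square)
  have dP: "((\<lambda>b. \<phi> (thr \<gamma> b / sqrt (- b))) has_real_derivative - (a / c) * P * u') (at b)"
    using DERIV_chain2[OF DERIV_std_normal_density du] by (simp add: a_def c_def P_def)
  have dp: "((\<lambda>b. \<phi> (thr \<gamma> b)) has_real_derivative - a * p * (q / 2)) (at b)"
    using DERIV_chain2[OF DERIV_std_normal_density da] by (simp add: a_def p_def)
  have dF: "((\<lambda>b. Phi (thr \<gamma> b / sqrt (- b))) has_real_derivative P * u') (at b)"
    using DERIV_chain2[OF DERIV_Phi du] by (simp add: a_def c_def P_def)
  have dM: "((\<lambda>b. (1 - b) * sqrt (- b)) has_real_derivative - 1 * c + - (1 / (2 * c)) * (1 - b)) (at b)"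
    using DERIV_mult[OF DERIV_diff[OF DERIV_const[of 1] DERIV_ident] dc] by (simp add: c_def)
  have "(slope \<gamma> has_real_derivative \<gamma> * (P * u') -
      ((- (a / c) * P * u' * p + - a * p * (q / 2) * P) * ((1 - b) * c) - P * p * (- 1 * c + - (1 / (2 * c)) * (1 - b))) / ((1 - b) * c * ((1 - b) * c))) (at b)"
    using DERIV_diff[OF DERIV_cmult[OF dF, of \<gamma>] DERIV_divide[OF DERIV_mult[OF dP dp] dM]] b c(1)
    unfolding slope_def[abs_def] a_def[symmetric] c_def[symmetric] p_def[symmetric] P_def[symmetric] by simp
  moreover have "\<gamma> * (P * u') -
      ((- (a / c) * P * u' * p + - a * p * (q / 2) * P) * ((1 - b) * c) - P * p * (- 1 * c + - (1 / (2 * c)) * (1 - b))) / ((1 - b) * c * ((1 - b) * c))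
    = P * p / (2 * c) * ((q - r)\<^sup>2 - r\<^sup>2 * c\<^sup>2 / (1 + c\<^sup>2) - (1 + 3 * c\<^sup>2) / (c\<^sup>2 * (1 + c\<^sup>2)\<^sup>2))"
  proof -
    define d where "d = 1 + c\<^sup>2"
    have d: "d > 0" by (simp add: d_def add_pos_nonneg)
    have c2: "c\<^sup>2 = d - 1" by (simp add: d_def)
    have 1: "a / c = - r * c" unfolding ar using c by (simp add: power2_eq_square)
    have 2: "1 - b = d" by (simp add: c(2) d_def)
    have 3: "- (- r * c) * P * u' * p + - a * p * (q / 2) * P = P * p * (r * (q - r) / 2 + r * c\<^sup>2 * q / 2)"
      unfolding u' ar using c by (simp add: field_simps)
    have "\<gamma> * (P * u') = P * p / (2 * c) * (q * (q - r))"
      unfolding gq u' by simp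
    moreover have "(P * p * (r * (q - r) / 2 + r * c\<^sup>2 * q / 2)) * (d * c) / (d * c * (d * c)) = P * p / (2 * c) * ((r * (q - r) + r * c\<^sup>2 * q) / d)"
      using c d by (simp add: field_simps)
    moreover have "P * p * (- 1 * c + - (1 / (2 * c)) * d) / (d * c * (d * c)) = P * p / (2 * c) * (- ((2 * c\<^sup>2 + d) / (c\<^sup>2 * d\<^sup>2)))"
      using c d by (simp add: field_simps power2_eq_square)
    moreover have "q * (q - r) - (r * (q - r) + r * c\<^sup>2 * q) / d + - ((2 * c\<^sup>2 + d) / (c\<^sup>2 * d\<^sup>2))
        = (q - r)\<^sup>2 - r\<^sup>2 * c\<^sup>2 / d - (1 + 3 * c\<^sup>2) / (c\<^sup>2 * d\<^sup>2)"
    proof -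
      have "q * (q - r) - (r * (q - r) + r * c\<^sup>2 * q) / d = (q - r)\<^sup>2 - r\<^sup>2 * c\<^sup>2 / d"
        unfolding c2 using d by (simp add: field_simps power2_eq_square)
      moreover have "2 * c\<^sup>2 + d = 1 + 3 * c\<^sup>2" by (simp add: d_def)
      ultimately show ?thesis by simp
    qed
    moreover have "x - (n - m) / w = k * t"
      if "x = k * t1" "n / w = k * t2" "m / w = k * t3" "t1 - t2 + t3 = t" for x n m w k t t1 t2 t3 :: real
      unfolding that(1) diff_divide_distrib that(2,3) that(4)[symmetric] by (simp add: algebra_simps)
    ultimately show ?thesis unfolding 1 2 3 d_def[symmetric] by blast
  qed
  ultimately show ?thesis unfolding p_def P_def by simp
qed

text \<open>Strict convexity of \<open>face\<close>. With q - r at most 2.94 - 1.323 = 1.617, the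
  bracket of \<open>DERIV_slope\<close> is bounded by an explicit rational function of
  \<beta>.\<close>

lemma slope_strict_antimono:
  assumes g: "0.9539798 \<le> \<gamma>" "\<gamma> \<le> 0.95398" and b: "- 0.45 \<le> b" "b < b'" "b' \<le> - 0.1"
  shows "slope \<gamma> b' < slope \<gamma> b"
proof (rule DERIV_neg_imp_decreasing[OF b(2)])
  fix x assume x: "b \<le> x" "x \<le> b'"
  define a where "a = thr \<gamma> x"
  define \<beta> where "\<beta> = - x"
  have \<beta>: "0.1 \<le> \<beta>" "\<beta> \<le> 0.45" using x b by (auto simp: \<beta>_def)
  have g01: "0 < \<gamma>" "\<gamma> < 1" using g by auto
  have Pa: "Phi a = \<gamma> * (1 - \<beta>) / 2" unfolding a_def \<beta>_def using g \<beta> by (simp add: \<beta>_def)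
  have gb: "0.9539798 * (1 - \<beta>) \<le> \<gamma> * (1 - \<beta>)" "\<gamma> * (1 - \<beta>) \<le> 0.95398 * (1 - \<beta>)"
    by (rule mult_right_mono; use g \<beta> in simp)+
  have y: "\<bar>Phi a - 1 / 2\<bar> \<le> 0.02302 + 0.477 * \<beta>" "0.02301 + 0.47699 * \<beta> \<le> \<bar>Phi a - 1 / 2\<bar>" "Phi a < 1 / 2"
    using gb \<beta> unfolding Pa by (auto simp: abs_if)
  have a0: "a < 0" using y(3) by (metis Phi_0 Phi_less_iff)
  have U: "0.7389 \<le> Phi 0.64"
    by (rule Phi_ge_Taylor[where n = 3 and c = "0.39894228", OF _ _ inv_sqrt_2pi_ge])
       (simp_all add: Phi_Taylor_def lessThan_nat_numeral fact_numeral power_divide)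
  have "\<bar>a\<bar> \<le> 0.64 / 0.2389 * \<bar>Phi a - 1 / 2\<bar>"
    by (rule abs_le_of_Phi) (use U y \<beta> in auto)
  also have "\<dots> \<le> 0.64 / 0.2389 * (0.02302 + 0.477 * \<beta>)" by (rule mult_left_mono[OF y(1)]) simp
  finally have a_up: "- a \<le> 0.64 / 0.2389 * (0.02302 + 0.477 * \<beta>)" using a0 by simp
  have "0.02301 + 0.47699 * \<beta> \<le> inv_sqrt_2pi * \<bar>a\<bar>" using y(2) abs_ge_of_Phi[of a] by linarith
  also have "\<dots> \<le> 0.39894229 * \<bar>a\<bar>" by (intro mult_right_mono inv_sqrt_2pi_le) auto
  finally have a_lo: "0.02301 + 0.47699 * \<beta> \<le> 0.39894229 * (- a)" using a0 by simp
  define q where "q = \<gamma> / \<phi> a"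
  define r where "r = a / x"
  have xb: "x = - \<beta>" by (simp add: \<beta>_def)
  have rb: "- a = r * \<beta>" using \<beta> by (simp add: r_def xb)
  \<comment> \<open>The linear bounds for \<open>- a\<close>, divided by \<beta>, decrease in
    \<beta>; so 1.323 comes from \<beta> = 0.45 and 1.91 from \<beta> = 0.1.\<close>
  have r: "1.323 \<le> r" "r \<le> 1.91"
  proof -
    have "1.323 * \<beta> \<le> r * \<beta>" using a_lo \<beta> unfolding rb[symmetric] by simp
    thus "1.323 \<le> r" using \<beta> by simp
    have "r * \<beta> \<le> 1.91 * \<beta>" using a_up \<beta> unfolding rb[symmetric] by simp
    thus "r \<le> 1.91" using \<beta> by simp
  qed
  have q: "2.39 \<le> q" "q \<le> 2.94"
  proof -
    have "\<phi> a \<le> inv_sqrt_2pi" using std_normal_density_eq[of a] by simp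
    hence "\<phi> a \<le> 0.39894229" using inv_sqrt_2pi_le by linarith
    moreover have p: "0 < \<phi> a" by (rule std_normal_density_pos)
    ultimately have "2.39 * \<phi> a \<le> \<gamma>" using g by simp
    thus "2.39 \<le> q" unfolding q_def using p by (simp add: pos_le_divide_eq)
    have "- a \<le> 0.64" using a_up \<beta> by simp
    hence "\<phi> 0.64 \<le> \<phi> a" using a0 by (intro std_normal_density_abs_mono) auto
    moreover have "0.325 \<le> \<phi> 0.64"
      by (rule std_normal_density_ge_Taylor[where n = 2 and c = "0.39894228", OF _ inv_sqrt_2pi_ge])
         (simp_all add: exp_Taylor_def lessThan_nat_numeral fact_numeral power_divide)
    ultimately have "\<gamma> \<le> 2.94 * \<phi> a" using g by simp
    thus "q \<le> 2.94" unfolding q_def using p by (simp add: pos_divide_le_eq)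
  qed
  have sq: "(sqrt (- x))\<^sup>2 = \<beta>" using \<beta> by (simp add: \<beta>_def)
  have "(q - r)\<^sup>2 \<le> 1.617\<^sup>2" using q r by (intro power_mono) auto
  also have "\<dots> < 1.323\<^sup>2 * \<beta> / (1 + \<beta>) + (1 + 3 * \<beta>) / (\<beta> * (1 + \<beta>)\<^sup>2)"
  proof -
    define D where "D = \<beta> * (1 + \<beta>)\<^sup>2"
    have D: "0 < D" using \<beta> by (simp add: D_def)
    have "\<beta> * \<beta> \<le> 0.45 * 0.45" "\<beta> * (\<beta> * \<beta>) \<le> 0.45 * (0.45 * 0.45)" by (intro mult_mono; use \<beta> in simp)+
    hence "1.617\<^sup>2 * D < 1.323\<^sup>2 * (\<beta> * \<beta> * (1 + \<beta>)) + (1 + 3 * \<beta>)"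
      using \<beta> unfolding D_def by (simp add: power2_eq_square algebra_simps add_divide_distrib)
    hence "1.617\<^sup>2 < (1.323\<^sup>2 * (\<beta> * \<beta> * (1 + \<beta>)) + (1 + 3 * \<beta>)) / D" using D by (simp add: pos_less_divide_eq)
    also have "\<dots> = 1.323\<^sup>2 * \<beta> / (1 + \<beta>) + (1 + 3 * \<beta>) / D"
      unfolding D_def add_divide_distrib using \<beta> by (simp add: power2_eq_square)
    finally show ?thesis unfolding D_def .
  qed
  also have "\<dots> \<le> r\<^sup>2 * \<beta> / (1 + \<beta>) + (1 + 3 * \<beta>) / (\<beta> * (1 + \<beta>)\<^sup>2)"
    using r \<beta> by (intro add_right_mono divide_right_mono mult_right_mono power_mono) auto
  finally have neg: "(q - r)\<^sup>2 - r\<^sup>2 * \<beta> / (1 + \<beta>) - (1 + 3 * \<beta>) / (\<beta> * (1 + \<beta>)\<^sup>2) < 0" by linarith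
  have "(slope \<gamma> has_real_derivative \<phi> (a / sqrt (- x)) * \<phi> a / (2 * sqrt (- x)) *
    ((q - r)\<^sup>2 - r\<^sup>2 * \<beta> / (1 + \<beta>) - (1 + 3 * \<beta>) / (\<beta> * (1 + \<beta>)\<^sup>2))) (at x)"
    using DERIV_slope[OF g01, of x] \<beta> unfolding sq a_def q_def r_def by (simp add: xb)
  moreover have "0 < \<phi> (a / sqrt (- x)) * \<phi> a / (2 * sqrt (- x))"
    using \<beta> by (simp add: std_normal_density_pos \<beta>_def)
  ultimately show "\<exists>y. (slope \<gamma> has_real_derivative y) (at x) \<and> y < 0"
    using neg mult_pos_neg by blast
qed

section \<open>Numerical enclosures\<close>

lemma slope_eq:
  assumes "- 1 < b" "b < 0"
  shows "slope \<gamma> b = \<gamma> * Phi (thr \<gamma> b / sqrt (- b)) -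
    exp (- ((thr \<gamma> b)\<^sup>2 * (1 - b) / (- 2 * b))) / (2 * pi) / ((1 - b) * sqrt (- b))"
proof -
  have "\<phi> (thr \<gamma> b / sqrt (- b)) * \<phi> (thr \<gamma> b) =
      inv_sqrt_2pi * inv_sqrt_2pi * (exp (- ((thr \<gamma> b / sqrt (- b))\<^sup>2 / 2)) * exp (- ((thr \<gamma> b)\<^sup>2 / 2)))"
    by (simp add: std_normal_density_eq)
  also note mult_exp_exp
  also have "- ((thr \<gamma> b / sqrt (- b))\<^sup>2 / 2) + - ((thr \<gamma> b)\<^sup>2 / 2) = - ((thr \<gamma> b)\<^sup>2 * (1 - b) / (- 2 * b))"
    using assms by (simp add: power_divide field_simps)
  also have "inv_sqrt_2pi * inv_sqrt_2pi = 1 / (2 * pi)" by (simp add: inv_sqrt_2pi_def)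
  finally show ?thesis unfolding slope_def by simp
qed

text \<open>Interval evaluation: \<alpha>1 and \<alpha>2 enclose the negated threshold,
  \<open>d\<close> bounds \<open>sqrt (- b)\<close>, \<open>v\<close> the argument of
  \<open>Phi\<close> and \<open>z\<close> the exponent, so that each use is left with rational
  inequalities.\<close>

lemma slope_upper:
  assumes b: "- 1 < b" "b < 0" and g: "0 \<le> \<gamma>" "\<gamma> \<le> \<gamma>2"
    and a: "\<alpha>1 \<le> - thr \<gamma> b" "- thr \<gamma> b \<le> \<alpha>2" "0 \<le> \<alpha>1"
    and c: "- b \<le> d\<^sup>2" "0 < d" and v: "v * d \<le> \<alpha>1" "0 \<le> v" and L: "L \<le> Phi v"
    and z: "\<alpha>2\<^sup>2 * (1 - b) / (- 2 * b) \<le> z" and E: "E \<le> exp (- z)" "0 \<le> E"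
    and u: "\<gamma>2 * (1 - L) - 0.159154943 * E / ((1 - b) * d) \<le> w"
  shows "slope \<gamma> b \<le> w"
proof -
  define c where "c = sqrt (- b)"
  have c': "0 < c" "c \<le> d"
  proof -
    show "0 < c" using b by (simp add: c_def)
    show "c \<le> d" unfolding c_def using c by (intro real_le_lsqrt) auto
  qed
  have "v * c \<le> v * d" using v c' by (intro mult_left_mono) auto
  hence "thr \<gamma> b / c \<le> - v" using a v c' by (simp add: divide_le_eq)
  hence "Phi (thr \<gamma> b / c) \<le> 1 - L" using L Phi_le_iff[of "thr \<gamma> b / c" "- v"] unfolding Phi_minus by linarith
  hence 1: "\<gamma> * Phi (thr \<gamma> b / c) \<le> \<gamma>2 * (1 - L)"
    using g Phi_pos[of "thr \<gamma> b / c"] by (intro mult_mono) auto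
  have "(- thr \<gamma> b)\<^sup>2 \<le> \<alpha>2\<^sup>2" using a by (intro power_mono) auto
  hence "(thr \<gamma> b)\<^sup>2 * (1 - b) / (- 2 * b) \<le> \<alpha>2\<^sup>2 * (1 - b) / (- 2 * b)"
    using b by (intro divide_right_mono mult_right_mono) auto
  hence "exp (- z) \<le> exp (- ((thr \<gamma> b)\<^sup>2 * (1 - b) / (- 2 * b)))" using z by (subst exp_le_cancel_iff) linarith
  hence "E \<le> exp (- ((thr \<gamma> b)\<^sup>2 * (1 - b) / (- 2 * b)))" using E by linarith
  moreover have "0.159154943 \<le> 1 / (2 * pi)" using pi_approx by (simp add: divide_simps)
  ultimately have "0.159154943 * E \<le> 1 / (2 * pi) * exp (- ((thr \<gamma> b)\<^sup>2 * (1 - b) / (- 2 * b)))"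
    using E by (intro mult_mono) auto
  hence "0.159154943 * E / ((1 - b) * d) \<le> 1 / (2 * pi) * exp (- ((thr \<gamma> b)\<^sup>2 * (1 - b) / (- 2 * b))) / ((1 - b) * c)"
    using E b c' by (intro frac_le mult_left_mono mult_pos_pos) auto
  thus ?thesis using 1 u unfolding slope_eq[OF b] c_def[symmetric] by simp
qed

lemma slope_lower:
  assumes b: "- 1 < b" "b < 0" and g: "0 \<le> \<gamma>1" "\<gamma>1 \<le> \<gamma>"
    and a: "\<alpha>1 \<le> - thr \<gamma> b" "- thr \<gamma> b \<le> \<alpha>2" "0 \<le> \<alpha>1"
    and c: "d\<^sup>2 \<le> - b" "0 < d" and v: "\<alpha>2 \<le> v * d" "0 \<le> v" and U: "Phi v \<le> U" "U \<le> 1"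
    and z: "z \<le> \<alpha>1\<^sup>2 * (1 - b) / (- 2 * b)" and E: "exp (- z) \<le> E"
    and u: "w \<le> \<gamma>1 * (1 - U) - 0.159154944 * E / ((1 - b) * d)"
  shows "w \<le> slope \<gamma> b"
proof -
  define c where "c = sqrt (- b)"
  have c': "0 < c" "d \<le> c"
  proof -
    show "0 < c" using b by (simp add: c_def)
    show "d \<le> c" unfolding c_def using c by (intro real_le_rsqrt) auto
  qed
  have "v * d \<le> v * c" using v c' by (intro mult_left_mono) auto
  hence "- v \<le> thr \<gamma> b / c" using a v c' by (simp add: le_divide_eq)
  hence "1 - U \<le> Phi (thr \<gamma> b / c)" using U Phi_le_iff[of "- v" "thr \<gamma> b / c"] unfolding Phi_minus by linarith
  hence 1: "\<gamma>1 * (1 - U) \<le> \<gamma> * Phi (thr \<gamma> b / c)"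
    using g U by (intro mult_mono) auto
  have "\<alpha>1\<^sup>2 \<le> (- thr \<gamma> b)\<^sup>2" using a by (intro power_mono) auto
  hence "\<alpha>1\<^sup>2 * (1 - b) / (- 2 * b) \<le> (thr \<gamma> b)\<^sup>2 * (1 - b) / (- 2 * b)"
    using b by (intro divide_right_mono mult_right_mono) auto
  hence "exp (- ((thr \<gamma> b)\<^sup>2 * (1 - b) / (- 2 * b))) \<le> exp (- z)" using z by (subst exp_le_cancel_iff) linarith
  hence "exp (- ((thr \<gamma> b)\<^sup>2 * (1 - b) / (- 2 * b))) \<le> E" using E by linarith
  moreover have E0: "0 \<le> E" using E exp_ge_zero[of "- z"] by linarith
  moreover have "1 / (2 * pi) \<le> 0.159154944" using pi_approx by (simp add: divide_simps)
  ultimately have "1 / (2 * pi) * exp (- ((thr \<gamma> b)\<^sup>2 * (1 - b) / (- 2 * b))) \<le> 0.159154944 * E"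
    by (intro mult_mono) auto
  hence "1 / (2 * pi) * exp (- ((thr \<gamma> b)\<^sup>2 * (1 - b) / (- 2 * b))) / ((1 - b) * c) \<le> 0.159154944 * E / ((1 - b) * d)"
    using b c c' E0 by (intro frac_le mult_left_mono mult_pos_pos) auto
  thus ?thesis using 1 u unfolding slope_eq[OF b] c_def[symmetric] by simp
qed

lemma thr_le:
  assumes "0 < \<gamma>" "\<gamma> < 1" "- 1 < b" "b \<le> 1" and "U \<le> Phi \<alpha>" "1 - U \<le> \<gamma> * (1 + b) / 2"
  shows "- thr \<gamma> b \<le> \<alpha>"
proof -
  have "Phi (- \<alpha>) \<le> Phi (thr \<gamma> b)" using assms by (simp add: Phi_minus del: Phi_le_iff)
  thus ?thesis by simp
qed

lemma thr_ge:
  assumes "0 < \<gamma>" "\<gamma> < 1" "- 1 < b" "b \<le> 1" and "Phi \<alpha> \<le> U" "\<gamma> * (1 + b) / 2 \<le> 1 - U"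
  shows "\<alpha> \<le> - thr \<gamma> b"
proof -
  have "Phi (thr \<gamma> b) \<le> Phi (- \<alpha>)" using assms by (simp add: Phi_minus del: Phi_le_iff)
  thus ?thesis by simp
qed

text \<open>The sign bound 0.0000006 is the delicate one and takes constants with seven to ten
  digits; the bound - 0.003 only feeds the Lipschitz estimate in
  \<open>face_minimum\<close>.\<close>

lemma slope_right:
  assumes g: "0.9539798 \<le> \<gamma>" "\<gamma> \<le> 0.95398"
  shows "- 0.003 \<le> slope \<gamma> (- 0.1824157935)" "slope \<gamma> (- 0.1824157935) \<le> - 0.0000006"
proof -
  have \<gamma>: "0 < \<gamma>" "\<gamma> < 1" using g by auto
  have a1: "0.27937248 \<le> - thr \<gamma> (- 0.1824157935)"
  proof (rule thr_ge[OF \<gamma>])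
    show "Phi 0.27937248 \<le> 0.6100205093"
      by (rule Phi_le_Taylor[where n = 2, OF _ _ inv_sqrt_2pi_bounds(2)])
         (simp_all add: Phi_Taylor_def lessThan_nat_numeral fact_numeral power_divide)
  qed (use g in auto)
  have a2: "- thr \<gamma> (- 0.1824157935) \<le> 0.27937271"
  proof (rule thr_le[OF \<gamma>])
    show "0.6100205911 \<le> Phi 0.27937271"
      by (rule Phi_ge_Taylor[where n = 3, OF _ _ inv_sqrt_2pi_bounds(1)])
         (simp_all add: Phi_Taylor_def lessThan_nat_numeral fact_numeral power_divide)
  qed (use g in auto)
  have "0.7434803 \<le> Phi 0.65411243"
    by (rule Phi_ge_Taylor[where n = 4, OF _ _ inv_sqrt_2pi_bounds(1)])
       (simp_all add: Phi_Taylor_def lessThan_nat_numeral fact_numeral power_divide)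
  moreover have "0.776501697 \<le> exp (- 0.25295645 :: real)"
    by (rule order_trans[OF _ exp_Taylor_bounds(1)[where n = 4]])
       (simp_all add: exp_Taylor_def lessThan_nat_numeral fact_numeral power_divide)
  ultimately show "slope \<gamma> (- 0.1824157935) \<le> - 0.0000006"
    by (intro slope_upper[OF _ _ _ g(2) a1 a2, where v = "0.65411243" and d = "0.42710162" and z = "0.25295645" and L = "0.7434803" and E = "0.776501697"])
       (use g in \<open>simp_all add: power2_eq_square\<close>)
  have "Phi 0.656 \<le> 0.745"
    by (rule Phi_le_Taylor[where n = 1, OF _ _ inv_sqrt_2pi_bounds(2)])
       (simp_all add: Phi_Taylor_def lessThan_nat_numeral fact_numeral power_divide)
  moreover have "exp (- 0.252 :: real) \<le> 0.7798"
    by (rule order_trans[OF exp_Taylor_bounds(2)[where n = 1]])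
       (simp_all add: exp_Taylor_def lessThan_nat_numeral fact_numeral power_divide)
  ultimately show "- 0.003 \<le> slope \<gamma> (- 0.1824157935)"
    by (intro slope_lower[OF _ _ _ g(1) a1 a2, where v = "0.656" and d = "0.427" and z = "0.252" and U = "0.745" and E = "0.7798"])
       (use g in \<open>simp_all add: power2_eq_square\<close>)
qed

lemma slope_left:
  assumes g: "0.9539798 \<le> \<gamma>" "\<gamma> \<le> 0.95398"
  shows "0.0000006 \<le> slope \<gamma> (- 0.1824177935)" "slope \<gamma> (- 0.1824177935) \<le> 0.001"
proof -
  have \<gamma>: "0 < \<gamma>" "\<gamma> < 1" using g by auto
  have a1: "0.27937497 \<le> - thr \<gamma> (- 0.1824177935)"
  proof (rule thr_ge[OF \<gamma>])
    show "Phi 0.27937497 \<le> 0.6100214633"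
      by (rule Phi_le_Taylor[where n = 2, OF _ _ inv_sqrt_2pi_bounds(2)])
         (simp_all add: Phi_Taylor_def lessThan_nat_numeral fact_numeral power_divide)
  qed (use g in auto)
  have a2: "- thr \<gamma> (- 0.1824177935) \<le> 0.27937519"
  proof (rule thr_le[OF \<gamma>])
    show "0.6100215451 \<le> Phi 0.27937519"
      by (rule Phi_ge_Taylor[where n = 3, OF _ _ inv_sqrt_2pi_bounds(1)])
         (simp_all add: Phi_Taylor_def lessThan_nat_numeral fact_numeral power_divide)
  qed (use g in auto)
  have "0.7431 \<le> Phi 0.653"
    by (rule Phi_ge_Taylor[where n = 3, OF _ _ inv_sqrt_2pi_bounds(1)])
       (simp_all add: Phi_Taylor_def lessThan_nat_numeral fact_numeral power_divide)
  moreover have "0.7755 \<le> exp (- 0.254 :: real)"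
    by (rule order_trans[OF _ exp_Taylor_bounds(1)[where n = 2]])
       (simp_all add: exp_Taylor_def lessThan_nat_numeral fact_numeral power_divide)
  ultimately show "slope \<gamma> (- 0.1824177935) \<le> 0.001"
    by (intro slope_upper[OF _ _ _ g(2) a1 a2, where v = "0.653" and d = "0.4272" and z = "0.254" and L = "0.7431" and E = "0.7755"])
       (use g in \<open>simp_all add: power2_eq_square\<close>)
  have "Phi 0.6541152 \<le> 0.74348121"
    by (rule Phi_le_Taylor[where n = 3, OF _ _ inv_sqrt_2pi_bounds(2)])
       (simp_all add: Phi_Taylor_def lessThan_nat_numeral fact_numeral power_divide)
  moreover have "exp (- 0.25295819 :: real) \<le> 0.77650036"
    by (rule order_trans[OF exp_Taylor_bounds(2)[where n = 3]])
       (simp_all add: exp_Taylor_def lessThan_nat_numeral fact_numeral power_divide)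
  ultimately show "0.0000006 \<le> slope \<gamma> (- 0.1824177935)"
    by (intro slope_lower[OF _ _ _ g(1) a1 a2, where v = "0.6541152" and d = "0.42710396" and z = "0.25295819" and U = "0.74348121" and E = "0.77650036"])
       (use g in \<open>simp_all add: power2_eq_square\<close>)
qed

text \<open>Antiderivative of \<open>(1 + y\<^sup>2)\<^sup>k\<close>, divided by \<open>y\<close> and written in terms of \<open>1 + y\<^sup>2\<close>.\<close>
primrec pow_int :: "nat \<Rightarrow> real \<Rightarrow> real" where
  "pow_int 0 w = 1"
| "pow_int (Suc k) w = (w ^ Suc k + 2 * real (Suc k) * pow_int k w) / (2 * real (Suc k) + 1)"

section \<open>Series enclosures for \<open>K\<close>\<close>

lemma pow_int_numeral:
  "pow_int (numeral v) w = (w ^ numeral v + 2 * numeral v * pow_int (pred_numeral v) w) / (2 * numeral v + 1)"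
  using pow_int.simps(2)[of "pred_numeral v" w] unfolding numeral_eq_Suc[symmetric] by simp

text \<open>Integration by parts: with \<open>w = 1 + y\<^sup>2\<close> and \<open>I k\<close> the
  integral of \<open>w ^ k\<close>,
  \<open>(2 * k + 1) * I k = y * w ^ k + 2 * k * I (k - 1)\<close>.\<close>

lemma DERIV_pow_int: "((\<lambda>y. y * pow_int k (1 + y\<^sup>2)) has_real_derivative (1 + y\<^sup>2) ^ k) (at y within S)"
proof (induction k)
  case (Suc k)
  define n where "n = real (Suc k)"
  define w where "w = 1 + y\<^sup>2"
  have n: "2 * n + 1 > 0" by (simp add: n_def)
  have pw: "((\<lambda>y. (1 + y\<^sup>2) ^ Suc k) has_real_derivative (1 + real k) * (2 * y * w ^ k)) (at y within S)"
    unfolding w_def by (rule DERIV_power_Suc) (auto intro!: derivative_eq_intros)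
  have "((\<lambda>y. y * (1 + y\<^sup>2) ^ Suc k) has_real_derivative w ^ Suc k + y * (n * (2 * y) * w ^ k)) (at y within S)"
    by (rule DERIV_cong[OF DERIV_mult[OF DERIV_ident pw]]) (simp add: n_def w_def algebra_simps)
  from DERIV_cdivide[OF DERIV_add[OF this DERIV_cmult[OF Suc, of "2 * n"]], of "2 * n + 1"]
  have "((\<lambda>y. (y * (1 + y\<^sup>2) ^ Suc k + 2 * n * (y * pow_int k (1 + y\<^sup>2))) / (2 * n + 1)) has_real_derivative
    (w ^ Suc k + y * (n * (2 * y) * w ^ k) + 2 * n * w ^ k) / (2 * n + 1)) (at y within S)"
    by (simp add: w_def)
  moreover have "(w ^ Suc k + y * (n * (2 * y) * w ^ k) + 2 * n * w ^ k) / (2 * n + 1) = w ^ Suc k"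
  proof -
    have "y * (n * (2 * y) * w ^ k) + 2 * n * w ^ k = 2 * n * w ^ Suc k"
      by (simp add: w_def power2_eq_square algebra_simps)
    thus ?thesis using n by (simp add: field_simps)
  qed
  moreover have "(\<lambda>y. (y * (1 + y\<^sup>2) ^ Suc k + 2 * n * (y * pow_int k (1 + y\<^sup>2))) / (2 * n + 1)) =
    (\<lambda>y. y * pow_int (Suc k) (1 + y\<^sup>2))"
    by (simp add: n_def fun_eq_iff algebra_simps)
  ultimately show ?case unfolding w_def by simp
qed simp

text \<open>With \<open>Y = 1 / half_tan u\<close> and \<open>A = a\<^sup>2 / 2\<close> the exponent
  \<open>a\<^sup>2 / (1 - sin u)\<close> is \<open>A * (1 + Y\<^sup>2)\<close>, and dY = (1 + Y^2) /
  2 du. The terms are those of the exponential series after the constant one, integrated and divided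
  by \<open>Y\<close>.\<close>

definition K_series :: "nat \<Rightarrow> real \<Rightarrow> real \<Rightarrow> real" where
  "K_series n A w = (\<Sum>k<n. (- A) ^ Suc k / fact (Suc k) * (2 * pow_int k w))"

text \<open>The constant term integrates to \<open>\<Theta>\<close>, so \<open>n\<close> terms of
  \<open>K_series\<close> belong to \<open>n + 1\<close> terms of \<open>exp_Taylor\<close>. The
  subtracted value is the lower limit, where \<open>half_tan 0 = 1\<close> and hence
  \<open>w = 2\<close>.\<close>

lemma has_integral_exp_Taylor:
  assumes "0 \<le> \<Theta>" "\<Theta> < pi / 2"
  defines "Y \<equiv> 1 / half_tan \<Theta>"
  shows "((\<lambda>u. exp_Taylor (Suc n) (a\<^sup>2 / (1 - sin u))) has_integral
    \<Theta> + Y * K_series n (a\<^sup>2 / 2) (1 + Y\<^sup>2) - K_series n (a\<^sup>2 / 2) 2) {0..\<Theta>}"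
proof -
  define J where "J u = u + 1 / half_tan u * K_series n (a\<^sup>2 / 2) (1 + (1 / half_tan u)\<^sup>2)" for u
  have "((\<lambda>u. exp_Taylor (Suc n) (a\<^sup>2 / (1 - sin u))) has_integral J \<Theta> - J 0) {0..\<Theta>}"
  proof (rule fundamental_theorem_of_calculus[OF assms(1)])
    fix u assume u: "u \<in> {0..\<Theta>}"
    have cu: "0 < cos u" using u assms by (intro cos_gt_zero_pi) auto
    note s = cos_pos_sin[OF cu]
    define w where "w = 1 / (1 - sin u)"
    have "(half_tan u)\<^sup>2 = (1 - sin u) / (1 + sin u)"
      using half_tan_sq[of u] s by (simp add: field_simps)
    hence "(1 / half_tan u)\<^sup>2 = (1 + sin u) / (1 - sin u)" by (simp add: power_divide)
    hence w: "1 + (1 / half_tan u)\<^sup>2 = 2 * w"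
      unfolding w_def using s by (simp only:) (simp add: field_simps)
    have summand: "((\<lambda>u. (- (a\<^sup>2 / 2)) ^ Suc k / fact (Suc k) * (2 * (1 / half_tan u * pow_int k (1 + (1 / half_tan u)\<^sup>2))))
      has_real_derivative (- (a\<^sup>2 * w)) ^ Suc k / fact (Suc k)) (at u within {0..\<Theta>})" for k
    proof (rule DERIV_cong[OF DERIV_cmult[OF DERIV_cmult[OF DERIV_chain2[OF DERIV_pow_int DERIV_inverse_half_tan[OF cu]]]]])
      have "(- (a\<^sup>2 / 2)) ^ Suc k * (2 * w) ^ Suc k = (- (a\<^sup>2 * w)) ^ Suc k"
        unfolding power_mult_distrib[symmetric] by simp
      moreover have "X / F * (2 * (V * w)) = X * (2 * w * V) / F" for X V F :: real by simp
      ultimately show "(- (a\<^sup>2 / 2)) ^ Suc k / fact (Suc k) * (2 * ((1 + (1 / half_tan u)\<^sup>2) ^ k * (1 / (1 - sin u))))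
          = (- (a\<^sup>2 * w)) ^ Suc k / fact (Suc k)"
        unfolding w unfolding w_def[symmetric] power_Suc[of "2 * w"] by (simp only:)
    qed
    have "((\<lambda>u. u + (\<Sum>k<n. (- (a\<^sup>2 / 2)) ^ Suc k / fact (Suc k) * (2 * (1 / half_tan u * pow_int k (1 + (1 / half_tan u)\<^sup>2)))))
      has_real_derivative 1 + (\<Sum>k<n. (- (a\<^sup>2 * w)) ^ Suc k / fact (Suc k))) (at u within {0..\<Theta>})"
      by (intro DERIV_add DERIV_ident DERIV_sum summand)
    moreover have "(\<lambda>u. u + (\<Sum>k<n. (- (a\<^sup>2 / 2)) ^ Suc k / fact (Suc k) * (2 * (1 / half_tan u * pow_int k (1 + (1 / half_tan u)\<^sup>2))))) = J"
      unfolding J_def K_series_def sum_distrib_left fun_eq_iff by (intro allI arg_cong2[where f = "(+)"] sum.cong) (auto simp only: ac_simps)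
    moreover have "1 + (\<Sum>k<n. (- (a\<^sup>2 * w)) ^ Suc k / fact (Suc k)) = exp_Taylor (Suc n) (a\<^sup>2 / (1 - sin u))"
      unfolding exp_Taylor_def sum.lessThan_Suc_shift by (simp add: w_def)
    ultimately show "(J has_vector_derivative exp_Taylor (Suc n) (a\<^sup>2 / (1 - sin u))) (at u within {0..\<Theta>})"
      by (simp add: has_real_derivative_iff_has_vector_derivative)
  qed
  moreover have "J \<Theta> - J 0 = \<Theta> + Y * K_series n (a\<^sup>2 / 2) (1 + Y\<^sup>2) - K_series n (a\<^sup>2 / 2) 2"
    by (simp add: J_def Y_def half_tan_def)
  ultimately show ?thesis by simp
qed

text \<open>By the shift in \<open>has_integral_exp_Taylor\<close> an odd number of series terms is
  an even number of Taylor terms, hence a lower bound.\<close>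

lemma K_bounds_series:
  assumes "0 \<le> \<Theta>" "\<Theta> < pi / 2"
  defines "Y \<equiv> 1 / half_tan \<Theta>"
  shows "(\<Theta> + Y * K_series (2 * n + 1) (a\<^sup>2 / 2) (1 + Y\<^sup>2) - K_series (2 * n + 1) (a\<^sup>2 / 2) 2) / (2 * pi) \<le> K a 0 \<Theta>"
    "K a 0 \<Theta> \<le> (\<Theta> + Y * K_series (2 * n) (a\<^sup>2 / 2) (1 + Y\<^sup>2) - K_series (2 * n) (a\<^sup>2 / 2) 2) / (2 * pi)"
proof -
  have cp: "cos u > 0" if "u \<in> {0..\<Theta>}" for u using that assms by (intro cos_gt_zero_pi) auto
  have int: "(kern a 0 has_integral integral {0..\<Theta>} (kern a 0)) {0..\<Theta>}"
    by (intro integrable_integral integrable_continuous_real continuous_on_kern cp)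
  have x: "0 \<le> a\<^sup>2 / (1 - sin u)" if "u \<in> {0..\<Theta>}" for u
    using cos_pos_sin[OF cp[OF that]] by simp
  have "\<Theta> + Y * K_series (2 * n + 1) (a\<^sup>2 / 2) (1 + Y\<^sup>2) - K_series (2 * n + 1) (a\<^sup>2 / 2) 2 \<le> integral {0..\<Theta>} (kern a 0)"
  proof (rule has_integral_le[OF has_integral_exp_Taylor[OF assms(1,2), folded Y_def] int])
    fix u assume "u \<in> {0..\<Theta>}"
    from exp_Taylor_bounds(1)[OF x[OF this], of "Suc n"]
    show "exp_Taylor (Suc (2 * n + 1)) (a\<^sup>2 / (1 - sin u)) \<le> kern a 0 u" by (simp add: kern_def)
  qed
  thus "(\<Theta> + Y * K_series (2 * n + 1) (a\<^sup>2 / 2) (1 + Y\<^sup>2) - K_series (2 * n + 1) (a\<^sup>2 / 2) 2) / (2 * pi) \<le> K a 0 \<Theta>"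
    unfolding K_def by (rule divide_right_mono) simp
  have "integral {0..\<Theta>} (kern a 0) \<le> \<Theta> + Y * K_series (2 * n) (a\<^sup>2 / 2) (1 + Y\<^sup>2) - K_series (2 * n) (a\<^sup>2 / 2) 2"
  proof (rule has_integral_le[OF int has_integral_exp_Taylor[OF assms(1,2), folded Y_def]])
    fix u assume "u \<in> {0..\<Theta>}"
    from exp_Taylor_bounds(2)[OF x[OF this], of n]
    show "kern a 0 u \<le> exp_Taylor (Suc (2 * n)) (a\<^sup>2 / (1 - sin u))" by (simp add: kern_def)
  qed
  thus "K a 0 \<Theta> \<le> (\<Theta> + Y * K_series (2 * n) (a\<^sup>2 / 2) (1 + Y\<^sup>2) - K_series (2 * n) (a\<^sup>2 / 2) 2) / (2 * pi)"
    unfolding K_def by (rule divide_right_mono) simp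
qed

lemma K_abs_antimono:
  assumes "0 \<le> \<Theta>" "\<Theta> < pi / 2" "\<bar>a\<bar> \<le> \<bar>a'\<bar>"
  shows "K a' 0 \<Theta> \<le> K a 0 \<Theta>"
proof -
  have cp: "cos u > 0" if "u \<in> {0..\<Theta>}" for u using that assms by (intro cos_gt_zero_pi) auto
  have "integral {0..\<Theta>} (kern a' 0) \<le> integral {0..\<Theta>} (kern a 0)"
  proof (intro integral_le integrable_continuous_real continuous_on_kern cp)
    fix u assume "u \<in> {0..\<Theta>}"
    hence "0 < 1 - sin u" using cos_pos_sin[OF cp] by auto
    moreover have "a\<^sup>2 \<le> a'\<^sup>2" using assms(3) by (simp add: abs_le_square_iff)
    ultimately show "kern a' 0 u \<le> kern a 0 u" by (simp add: kern_def divide_right_mono)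
  qed
  thus ?thesis unfolding K_def by (intro divide_right_mono) auto
qed

section \<open>Evaluation at \<open>b0\<close>\<close>

definition b0 :: real where "b0 = - 0.1824167935"

lemma b0_bounds: "- 1 < b0" "b0 < 0"
  by (simp_all add: b0_def)

lemma face_angle_b0:
  defines "\<Theta> \<equiv> pi / 2 - 2 * arctan (sqrt (- b0))" and "Y \<equiv> 1 / sqrt (- b0)"
  shows "0 \<le> \<Theta>" "\<Theta> < pi / 2" "half_tan \<Theta> = sqrt (- b0)" "1 + Y\<^sup>2 = 1 + 1 / 0.1824167935"
    "2.3413567475 \<le> Y" "Y \<le> 2.3413567476"
    "pi / 2 - 0.807300763 \<le> \<Theta>" "\<Theta> \<le> pi / 2 - 0.8073007606"
proof -
  have b: "- 1 < b0" "b0 < 0" by (auto simp: b0_def)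
  show "0 \<le> \<Theta>" "\<Theta> < pi / 2" "half_tan \<Theta> = sqrt (- b0)"
    using face_angle[OF b] unfolding \<Theta>_def by auto
  show "1 + Y\<^sup>2 = 1 + 1 / 0.1824167935" by (simp add: Y_def power_divide b0_def)
  have c: "0.42710279 \<le> sqrt (- b0)" "sqrt (- b0) \<le> 0.427102791"
    by (rule real_le_rsqrt real_le_lsqrt; simp add: b0_def power2_eq_square)+
  have Y: "Y\<^sup>2 = 1 / 0.1824167935" "0 \<le> Y" by (simp_all add: Y_def power_divide b0_def)
  show "2.3413567475 \<le> Y" by (rule power2_le_imp_le) (use Y in \<open>simp_all add: power2_eq_square\<close>)
  show "Y \<le> 2.3413567476" by (rule power2_le_imp_le) (use Y in \<open>simp_all add: power2_eq_square\<close>)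
  \<comment> \<open>The Taylor polynomial is evaluated at the short rational 0.4271; concavity moves
    the value to \<open>sqrt (- b0)\<close>.\<close>
  have "arctan (sqrt (- b0)) \<le> arctan 0.4271 + (sqrt (- b0) - 0.4271) / (1 + 0.4271\<^sup>2)"
    by (rule arctan_le_tangent) (use b in auto)
  also have "\<dots> \<le> arctan 0.4271 + (0.427102791 - 0.4271) / (1 + 0.4271\<^sup>2)"
    using c(2) by (intro add_left_mono divide_right_mono diff_right_mono) auto
  also have "arctan 0.4271 \<le> arctan_Taylor (2 * 5 + 1) 0.4271" by (rule arctan_bounds_Taylor) simp
  also have "\<dots> \<le> 0.403648021"
    by (simp add: arctan_Taylor_def lessThan_nat_numeral power_divide)
  also have "0.403648021 + (0.427102791 - 0.4271) / (1 + 0.4271\<^sup>2) \<le> (0.4036503815 :: real)"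
    by (simp add: power2_eq_square)
  finally show "pi / 2 - 0.807300763 \<le> \<Theta>" unfolding \<Theta>_def by simp
  have "0.4036480208 \<le> arctan_Taylor (2 * 6) 0.4271"
    by (simp add: arctan_Taylor_def lessThan_nat_numeral power_divide)
  also have "\<dots> \<le> arctan 0.4271" by (rule arctan_bounds_Taylor) simp
  also have "\<dots> \<le> arctan (sqrt (- b0)) + (0.4271 - sqrt (- b0)) / (1 + (sqrt (- b0))\<^sup>2)"
    by (rule arctan_le_tangent) (use b in auto)
  also have "\<dots> \<le> arctan (sqrt (- b0)) + (0.4271 - 0.42710279) / (1 + (sqrt (- b0))\<^sup>2)"
    using c(1) by (intro add_left_mono divide_right_mono diff_left_mono) auto
  also have "(0.4271 - 0.42710279) / (1 + (sqrt (- b0))\<^sup>2) = (0.4271 - 0.42710279) / 1.1824167935"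
    by (simp add: b0_def)
  finally have "0.4036503803 \<le> arctan (sqrt (- b0))" by simp
  thus "\<Theta> \<le> pi / 2 - 0.8073007606" unfolding \<Theta>_def by simp
qed

text \<open>\<open>K\<close> decreases in \<open>\<bar>a\<bar>\<close>, so a lower bound for
  \<open>face\<close> takes an upper bound for the negated threshold.\<close>

lemma face_b0_lower: "0.0000001 \<le> face 0.9539798 b0"
proof -
  define \<Theta> where "\<Theta> = pi / 2 - 2 * arctan (sqrt (- b0))"
  define Y where "Y = 1 / sqrt (- b0)"
  note A = face_angle_b0[folded \<Theta>_def Y_def]
  have Yh: "1 / half_tan \<Theta> = Y" by (simp add: A(3) Y_def)
  have a: "- thr 0.9539798 b0 \<le> 0.27937395" "0.2 \<le> - thr 0.9539798 b0"
  proof -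
    show "- thr 0.9539798 b0 \<le> 0.27937395"
    proof (rule thr_le)
      show "0.6100210686 \<le> Phi 0.27937395"
        by (rule Phi_ge_Taylor[where n = 3, OF _ _ inv_sqrt_2pi_bounds(1)])
           (simp_all add: Phi_Taylor_def lessThan_nat_numeral fact_numeral power_divide)
    qed (simp_all add: b0_def)
    \<comment> \<open>This bound serves to fix the sign of the threshold.\<close>
    show "0.2 \<le> - thr 0.9539798 b0"
    proof (rule thr_ge)
      show "Phi 0.2 \<le> 0.6"
        by (rule Phi_le_Taylor[where n = 0, OF _ _ inv_sqrt_2pi_bounds(2)])
           (simp_all add: Phi_Taylor_def lessThan_nat_numeral fact_numeral power_divide)
    qed (simp_all add: b0_def)
  qed
  have "(\<Theta> + Y * K_series 5 (0.27937395\<^sup>2 / 2) (1 + 1 / 0.1824167935) - K_series 5 (0.27937395\<^sup>2 / 2) 2) / (2 * pi) \<le> K 0.27937395 0 \<Theta>"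
    using K_bounds_series(1)[OF A(1,2), of 2 "0.27937395"] unfolding Yh A(4) by simp
  also have "\<dots> \<le> K (thr 0.9539798 b0) 0 \<Theta>"
    by (rule K_abs_antimono[OF A(1,2)]) (use a in simp)
  finally have K: "(\<Theta> + Y * K_series 5 (0.27937395\<^sup>2 / 2) (1 + 1 / 0.1824167935) - K_series 5 (0.27937395\<^sup>2 / 2) 2) / (2 * pi)
    \<le> K (thr 0.9539798 b0) 0 \<Theta>" .
  have s1: "- 0.07394631796 \<le> K_series 5 (0.27937395\<^sup>2 / 2) (1 + 1 / 0.1824167935)"
    by (simp add: K_series_def lessThan_nat_numeral fact_numeral power_divide pow_int_numeral)
  have s2: "K_series 5 (0.27937395\<^sup>2 / 2) 2 \<le> - 0.07605566987"
    by (simp add: K_series_def lessThan_nat_numeral fact_numeral power_divide pow_int_numeral)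
  have "2.3413567476 * (- 0.07394631796) \<le> Y * (- 0.07394631796)"
    by (rule mult_right_mono_neg[OF A(6)]) simp
  also have "\<dots> \<le> Y * K_series 5 (0.27937395\<^sup>2 / 2) (1 + 1 / 0.1824167935)"
    using s1 A(5) by (intro mult_left_mono) auto
  finally have "pi / 2 - 0.807300763 + 2.3413567476 * (- 0.07394631796) + 0.07605566987
    \<le> \<Theta> + Y * K_series 5 (0.27937395\<^sup>2 / 2) (1 + 1 / 0.1824167935) - K_series 5 (0.27937395\<^sup>2 / 2) 2"
    using A(7) s2 by simp
  hence "(pi / 2 - 0.807300763 + 2.3413567476 * (- 0.07394631796) + 0.07605566987) / (2 * pi) \<le> K (thr 0.9539798 b0) 0 \<Theta>"
    by (intro order_trans[OF divide_right_mono K]) auto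
  moreover have "0.0000001 - (1 - 0.9539798 - (0.9539798 * (1 + b0) / 2)\<^sup>2) \<le>
      (pi / 2 - 0.807300763 + 2.3413567476 * (- 0.07394631796) + 0.07605566987) / (2 * pi)"
    unfolding b0_def using pi_approx by (simp add: pos_le_divide_eq power2_eq_square)
  ultimately have "0.0000001 - (1 - 0.9539798 - (0.9539798 * (1 + b0) / 2)\<^sup>2) \<le> K (thr 0.9539798 b0) 0 \<Theta>" by (rule order_trans[rotated])
  thus ?thesis unfolding face_eq[of b0, OF b0_bounds] \<Theta>_def by linarith
qed

lemma face_b0_le:
  assumes "\<alpha> \<le> - thr \<gamma> b0" "0 \<le> \<alpha>" "0 \<le> s1"
    and "K_series 6 (\<alpha>\<^sup>2 / 2) (1 + 1 / 0.1824167935) \<le> - s1" "- s2 \<le> K_series 6 (\<alpha>\<^sup>2 / 2) 2"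
  shows "face \<gamma> b0 \<le> 1 - \<gamma> - (\<gamma> * (1 + b0) / 2)\<^sup>2 + (pi / 2 - 0.8073007606 - 2.3413567475 * s1 + s2) / (2 * pi)"
proof -
  define \<Theta> where "\<Theta> = pi / 2 - 2 * arctan (sqrt (- b0))"
  define Y where "Y = 1 / sqrt (- b0)"
  note A = face_angle_b0[folded \<Theta>_def Y_def]
  have Yh: "1 / half_tan \<Theta> = Y" by (simp add: A(3) Y_def)
  have "K (thr \<gamma> b0) 0 \<Theta> \<le> K \<alpha> 0 \<Theta>" by (rule K_abs_antimono[OF A(1,2)]) (use assms in simp)
  also have "\<dots> \<le> (\<Theta> + Y * K_series 6 (\<alpha>\<^sup>2 / 2) (1 + 1 / 0.1824167935) - K_series 6 (\<alpha>\<^sup>2 / 2) 2) / (2 * pi)"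
    using K_bounds_series(2)[OF A(1,2), of \<alpha> 3] unfolding Yh A(4) by simp
  also have "\<dots> \<le> (pi / 2 - 0.8073007606 - 2.3413567475 * s1 + s2) / (2 * pi)"
  proof (rule divide_right_mono)
    have "Y * K_series 6 (\<alpha>\<^sup>2 / 2) (1 + 1 / 0.1824167935) \<le> Y * - s1" using assms A(5) by (intro mult_left_mono) auto
    also have "\<dots> \<le> 2.3413567475 * - s1" using assms A(5) by (intro mult_right_mono_neg) auto
    finally show "\<Theta> + Y * K_series 6 (\<alpha>\<^sup>2 / 2) (1 + 1 / 0.1824167935) - K_series 6 (\<alpha>\<^sup>2 / 2) 2
      \<le> pi / 2 - 0.8073007606 - 2.3413567475 * s1 + s2" using A(8) assms by simp
  qed simp
  finally show ?thesis unfolding face_eq[of b0, OF b0_bounds] \<Theta>_def by simp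
qed

text \<open>The bound 0.000001 is what \<open>h_ge_of_face\<close> admits for its
  \<open>v\<close>.\<close>

lemma face_b0_upper: "face 0.9539798 b0 \<le> 0.000001"
proof -
  have "face 0.9539798 b0 \<le> 1 - 0.9539798 - (0.9539798 * (1 + b0) / 2)\<^sup>2 +
      (pi / 2 - 0.8073007606 - 2.3413567475 * 0.0739463006 + 0.07605566451) / (2 * pi)"
  proof (rule face_b0_le)
    show "0.27937394 \<le> - thr 0.9539798 b0"
    proof (rule thr_ge)
      show "Phi 0.27937394 \<le> 0.610021066001"
        by (rule Phi_le_Taylor[where n = 2, OF _ _ inv_sqrt_2pi_bounds(2)])
           (simp_all add: Phi_Taylor_def lessThan_nat_numeral fact_numeral power_divide)
    qed (simp_all add: b0_def)
  qed (simp_all add: K_series_def lessThan_nat_numeral fact_numeral power_divide pow_int_numeral)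
  also have "\<dots> \<le> 0.000001"
  proof -
    have "(pi / 2 - 0.8073007606 - 2.3413567475 * 0.0739463006 + 0.07605566451) / (2 * pi)
        \<le> 0.000001 - (1 - 0.9539798 - (0.9539798 * (1 + b0) / 2)\<^sup>2)"
      unfolding b0_def using pi_approx by (simp add: pos_divide_le_eq power2_eq_square)
    thus ?thesis by linarith
  qed
  finally show ?thesis .
qed

lemma face_b0_negative: "face 0.95398 b0 < 0"
proof -
  have "face 0.95398 b0 \<le> 1 - 0.95398 - (0.95398 * (1 + b0) / 2)\<^sup>2 +
      (pi / 2 - 0.8073007606 - 2.3413567475 * 0.0739461953 + 0.07605555311) / (2 * pi)"
  proof (rule face_b0_le)
    show "0.27937373 \<le> - thr 0.95398 b0"
    proof (rule thr_ge)
      show "Phi 0.27937373 \<le> 0.610020985429"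
        by (rule Phi_le_Taylor[where n = 2, OF _ _ inv_sqrt_2pi_bounds(2)])
           (simp_all add: Phi_Taylor_def lessThan_nat_numeral fact_numeral power_divide)
    qed (simp_all add: b0_def)
  qed (simp_all add: K_series_def lessThan_nat_numeral fact_numeral power_divide pow_int_numeral)
  also have "\<dots> < 0"
  proof -
    have "(pi / 2 - 0.8073007606 - 2.3413567475 * 0.0739461953 + 0.07605555311) / (2 * pi)
        < - (1 - 0.95398 - (0.95398 * (1 + b0) / 2)\<^sup>2)"
      unfolding b0_def using pi_approx by (simp add: pos_divide_less_eq power2_eq_square)
    thus ?thesis by linarith
  qed
  finally show ?thesis .
qed

section \<open>The minimum\<close>

lemma face_eq_h:
  assumes g: "0 < \<gamma>" "\<gamma> < 1" and b: "- 1 < b" "b < 0"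
  shows "h \<gamma> b b (- 1 - 2 * b) = face \<gamma> b"
proof -
  have s: "0 \<le> (1 + b) / (1 - b)" "(1 + b) / (1 - b) < 1" using b by auto
  have b2: "b\<^sup>2 < 1" using square_less_2[of b] b by simp
  have w: "b * b - (- 1 - 2 * b) = (1 + b)\<^sup>2" by (simp add: power2_eq_square algebra_simps)
  have A: "sqrt ((1 - b\<^sup>2) * (1 - b\<^sup>2)) = 1 - b\<^sup>2" using b2 by simp
  have sA: "(1 + b)\<^sup>2 = (1 + b) / (1 - b) * (1 - b\<^sup>2)"
    using b by (simp add: field_simps power2_eq_square)
  have "b * b - (- 1 - 2 * b) = (1 + b) / (1 - b) * sqrt ((1 - b\<^sup>2) * (1 - b\<^sup>2))"
    unfolding w A by (rule sA)
  note eq = h_negative_correlation[OF g _ _ _ _ s this]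
  have wA: "b * b - (- 1 - 2 * b) = (1 - b\<^sup>2) * ((1 + b) / (1 - b))"
    unfolding w sA by (rule mult.commute)
  show ?thesis
    using eq b unfolding face_def hsym_def wA by (simp add: power2_eq_square[of "1 + b"])
qed

text \<open>Gram-Schmidt coordinates of the three vectors; the last coordinate of \<open>v2\<close>
  is real because \<open>(1 + b)\<^sup>2 \<le> 1 - b\<^sup>2\<close> for
  \<open>b \<le> 0\<close>.\<close>

lemma feasible_face:
  assumes b: "- 1 < b" "b \<le> 0"
  shows "feasible b b (- 1 - 2 * b)"
proof -
  have b2: "b\<^sup>2 < 1" using square_less_2[of b] b by simp
  define p where "p = sqrt (1 - b\<^sup>2)"
  define y where "y = - (1 + b)\<^sup>2 / p"
  define z where "z = sqrt (1 - b\<^sup>2 - y\<^sup>2)"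
  have p: "0 < p" "p\<^sup>2 = 1 - b\<^sup>2" using b2 by (auto simp: p_def)
  have "((1 + b)\<^sup>2)\<^sup>2 \<le> ((1 - b\<^sup>2))\<^sup>2"
  proof (rule power_mono)
    have "(1 + b) * (1 + b) \<le> (1 + b) * (1 - b)" using b by (intro mult_left_mono) auto
    thus "(1 + b)\<^sup>2 \<le> 1 - b\<^sup>2" by (simp add: power2_eq_square algebra_simps)
  qed simp
  hence "y\<^sup>2 \<le> 1 - b\<^sup>2"
    unfolding y_def power_divide power2_minus p(2) using b2 by (simp add: pos_divide_le_eq power2_eq_square)
  hence z: "z\<^sup>2 = 1 - b\<^sup>2 - y\<^sup>2" by (simp add: z_def)
  have py: "p * y = - (1 + b)\<^sup>2" using p by (simp add: y_def)
  define v0 v1 v2 :: "real^3" where "v0 = vector [1, 0, 0]" and "v1 = vector [b, p, 0]" and "v2 = vector [b, y, z]"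
  have "norm v0 = 1" "norm v1 = 1" "norm v2 = 1"
    using p z by (simp_all add: v0_def v1_def v2_def norm_eq_sqrt_inner inner_vec_def sum_3 vector_3 power2_eq_square algebra_simps)
  moreover have "v0 \<bullet> v1 = b" "v0 \<bullet> v2 = b" "v1 \<bullet> v2 = - 1 - 2 * b"
    using py by (simp_all add: v0_def v1_def v2_def inner_vec_def sum_3 vector_3 power2_eq_square algebra_simps)
  ultimately have "\<exists>v0 v1 v2 :: real^3. norm v0 = 1 \<and> norm v1 = 1 \<and> norm v2 = 1 \<and>
        v0 \<bullet> v1 = b \<and> v0 \<bullet> v2 = b \<and> v1 \<bullet> v2 = - 1 - 2 * b" by blast
  thus ?thesis unfolding feasible_def using b by auto
qed

lemma Phi_inv_mono:
  assumes "0 \<le> p" "p \<le> q" "q < 1"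
  shows "Phi_inv p \<le> Phi_inv q"
proof (cases "p = 0")
  case False
  hence "quantile p \<le> quantile q" using assms by (subst quantile_le_iff) auto
  thus ?thesis using False assms by (simp add: Phi_inv_quantile)
qed (simp add: Phi_inv_def)

text \<open>On the facet \<open>Value\<close> is 1 for every b, so both subtracted terms of
  \<open>h\<close> grow with \<gamma>.\<close>

lemma h_face_antimono:
  assumes "0 \<le> \<gamma>" "\<gamma> \<le> \<gamma>'" "\<gamma>' \<le> 1" "- 1 \<le> b" "b < 1"
  shows "h \<gamma>' b b (- 1 - 2 * b) \<le> h \<gamma> b b (- 1 - 2 * b)"
proof -
  have "\<gamma>' * (1 + b) \<le> 1 * (1 + b)" "\<gamma> * (1 + b) \<le> \<gamma>' * (1 + b)"
    using assms by (intro mult_right_mono; simp)+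
  hence "Phi_inv (\<gamma> * (1 + b) / 2) \<le> Phi_inv (\<gamma>' * (1 + b) / 2)"
    using assms by (intro Phi_inv_mono) auto
  hence "Phi2 r (Phi_inv (\<gamma> * (1 + b) / 2)) (Phi_inv (\<gamma> * (1 + b) / 2))
      \<le> Phi2 r (Phi_inv (\<gamma>' * (1 + b) / 2)) (Phi_inv (\<gamma>' * (1 + b) / 2))" for r
    by (intro Phi2_mono)
  thus ?thesis using assms by (simp add: h_def Value_def diff_mono)
qed

text \<open>Compactness gives a minimiser on the short interval; the slope is antitone with opposite
  signs at the two ends, so \<open>face\<close> is no smaller elsewhere. The last claim is a
  Lipschitz bound: 0.003 * 0.000001 is below 0.00000001.\<close>

lemma face_minimum:
  assumes g: "0.9539798 \<le> \<gamma>" "\<gamma> \<le> 0.95398"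
  obtains b where "b \<in> {b0 - 0.000001 .. b0 + 0.000001}"
    "\<And>x. - 0.45 \<le> x \<Longrightarrow> x \<le> - 0.1 \<Longrightarrow> face \<gamma> b \<le> face \<gamma> x"
    "face \<gamma> b0 - 0.00000001 \<le> face \<gamma> b"
proof -
  have g01: "0 < \<gamma>" "\<gamma> < 1" using g by auto
  let ?l = "b0 - 0.000001" and ?r = "b0 + 0.000001"
  have r: "?r = - 0.1824157935" and l: "?l = - 0.1824177935" by (simp_all add: b0_def)
  note sr = slope_right[OF g, folded r] and sl = slope_left[OF g, folded l]
  have D: "(face \<gamma> has_real_derivative - slope \<gamma> x) (at x)" if "- 0.45 \<le> x" "x \<le> - 0.1" for x
    by (rule DERIV_face[OF g01]) (use that in auto)
  have slope_mono: "slope \<gamma> y \<le> slope \<gamma> x" if "- 0.45 \<le> x" "x \<le> y" "y \<le> - 0.1" for x y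
    using slope_strict_antimono[OF g, of x y] that by (cases "x = y") auto
  have lr: "- 0.45 \<le> ?l" "?r \<le> - 0.1" by (simp_all add: b0_def)
  have "continuous_on {?l..?r} (face \<gamma>)"
    by (rule DERIV_continuous_on[OF DERIV_subset[OF D]]) (use lr in auto)
  moreover have ne: "{?l..?r} \<noteq> {}" by simp
  ultimately obtain b where b: "b \<in> {?l..?r}" "\<And>x. x \<in> {?l..?r} \<Longrightarrow> face \<gamma> b \<le> face \<gamma> x"
    using continuous_attains_inf[OF compact_Icc ne] by blast
  show ?thesis
  proof (rule that[OF b(1)])
    fix x :: real assume x: "- 0.45 \<le> x" "x \<le> - 0.1"
    consider "x \<in> {?l..?r}" | "x < ?l" | "?r < x" by fastforce
    thus "face \<gamma> b \<le> face \<gamma> x"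
    proof cases
      case 1 thus ?thesis by (rule b(2))
    next
      case 2
      have "face \<gamma> ?l \<le> face \<gamma> x"
      proof (rule DERIV_nonpos_imp_nonincreasing[OF less_imp_le[OF 2]])
        fix u assume u: "x \<le> u" "u \<le> ?l"
        have "0 \<le> slope \<gamma> u" using slope_mono[of u ?l] sl(1) u x lr by simp
        thus "\<exists>y. (face \<gamma> has_real_derivative y) (at u) \<and> y \<le> 0"
          using D[of u] u x lr by (intro exI[of _ "- slope \<gamma> u"]) auto
      qed
      thus ?thesis using b(2)[of ?l] by simp
    next
      case 3
      have "face \<gamma> ?r \<le> face \<gamma> x"
      proof (rule DERIV_nonneg_imp_nondecreasing[OF less_imp_le[OF 3]])
        fix u assume u: "?r \<le> u" "u \<le> x"
        have "slope \<gamma> u \<le> 0" using slope_mono[of ?r u] sr(2) u x lr by simp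
        thus "\<exists>y. (face \<gamma> has_real_derivative y) (at u) \<and> 0 \<le> y"
          using D[of u] u x lr by (intro exI[of _ "- slope \<gamma> u"]) auto
      qed
      thus ?thesis using b(2)[of ?r] by simp
    qed
  next
    have *: "\<bar>slope \<gamma> u\<bar> \<le> 0.003" if "?l \<le> u" "u \<le> ?r" for u
      using slope_mono[of ?l u] slope_mono[of u ?r] that lr sr(1) sl(2) by (simp add: abs_le_iff)
    have "\<bar>face \<gamma> b - face \<gamma> b0\<bar> \<le> 0.003 * \<bar>b - b0\<bar>"
      unfolding real_norm_def[symmetric]
    proof (rule field_differentiable_bound)
      show "(face \<gamma> has_real_derivative - slope \<gamma> u) (at u within {?l..?r})" if "u \<in> {?l..?r}" for u
        by (rule DERIV_subset[OF D]) (use that lr in auto)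
    qed (use b(1) * in auto)
    moreover have "\<bar>b - b0\<bar> \<le> 0.000001" using b(1) unfolding abs_le_iff by auto
    moreover have "y - 0.00000001 \<le> x" if "\<bar>x - y\<bar> \<le> 0.003 * d" "d \<le> 0.000001" for x y d :: real
      using that by (simp add: abs_if split: if_splits)
    ultimately show "face \<gamma> b0 - 0.00000001 \<le> face \<gamma> b" by blast
  qed
qed

text \<open>\<open>h_ge_of_face\<close> is applied with \<open>v\<close> equal to the minimal facet
  value itself, so the comparison is sharp although the estimates off the facet are rough.\<close>

lemma h_minimum:
  assumes g: "0.9539798 \<le> \<gamma>" "\<gamma> \<le> 0.95398"
  obtains b where "b \<in> {b0 - 0.000001 .. b0 + 0.000001}" "feasible b b (- 1 - 2 * b)"
    "\<And>b1 b2 b12. feasible b1 b2 b12 \<Longrightarrow> h \<gamma> b b (- 1 - 2 * b) \<le> h \<gamma> b1 b2 b12"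
    "face \<gamma> b0 - 0.00000001 \<le> h \<gamma> b b (- 1 - 2 * b)"
proof -
  have g01: "0 < \<gamma>" "\<gamma> < 1" using g by auto
  obtain b where b: "b \<in> {b0 - 0.000001 .. b0 + 0.000001}"
    "\<And>x. - 0.45 \<le> x \<Longrightarrow> x \<le> - 0.1 \<Longrightarrow> face \<gamma> b \<le> face \<gamma> x"
    "face \<gamma> b0 - 0.00000001 \<le> face \<gamma> b"
    by (rule face_minimum[OF g]) (rule that; blast)
  have b1: "- 1 < b" "b < 0" using b(1) by (auto simp: b0_def)
  note hb = face_eq_h[OF g01 b1]
  \<comment> \<open>The size of the minimum is computed only at the left end of the range of
    \<gamma>; antitonicity in \<gamma> carries it over.\<close>
  have "face \<gamma> b0 = h \<gamma> b0 b0 (- 1 - 2 * b0)" by (rule face_eq_h[OF g01 b0_bounds, symmetric])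
  also have "\<dots> \<le> h 0.9539798 b0 b0 (- 1 - 2 * b0)"
    using g b0_bounds by (intro h_face_antimono) auto
  also have "\<dots> = face 0.9539798 b0" by (rule face_eq_h[OF _ _ b0_bounds]) auto
  finally have "face \<gamma> b0 \<le> 0.000001" using face_b0_upper by linarith
  moreover have "face \<gamma> b \<le> face \<gamma> b0" by (rule b(2)) (simp_all add: b0_def)
  ultimately have v: "face \<gamma> b \<le> 0.000001" by linarith
  show ?thesis
    by (rule that[OF b(1) feasible_face]) (use b1 b(3) h_ge_of_face[OF g v b(2)] in \<open>auto simp: hb\<close>)
qed

theorem theorem4p4:
  shows "gamma_star \<in> {0.9539798 .. 0.95398} \<and>
    (\<exists>b \<in> {-0.1824167935 - 10 powi (-6) .. -0.1824167935 + 10 powi (-6)}.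
       feasible b b (-1 - 2 * b) \<and>
       (\<forall>b1 b2 b12. feasible b1 b2 b12 \<longrightarrow>
          h gamma_star b b (-1 - 2 * b) \<le> h gamma_star b1 b2 b12))"
proof -
  define S where "S = {\<gamma> \<in> {0..1}. \<forall>b1 b2 b12. feasible b1 b2 b12 \<longrightarrow> h \<gamma> b1 b2 b12 \<ge> 0}"
  have lo: "0.9539798 \<in> S"
  proof -
    have g: "0.9539798 \<le> (0.9539798 :: real)" "0.9539798 \<le> (0.95398 :: real)" by simp_all
    obtain b where b: "\<And>b1 b2 b12. feasible b1 b2 b12 \<Longrightarrow> h 0.9539798 b b (- 1 - 2 * b) \<le> h 0.9539798 b1 b2 b12"
      "face 0.9539798 b0 - 0.00000001 \<le> h 0.9539798 b b (- 1 - 2 * b)"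
      by (rule h_minimum[OF g]) (rule that; blast)
    \<comment> \<open>The value at \<open>b0\<close> is at least 0.0000001, ten times the possible
      drop to the minimiser.\<close>
    have "0 \<le> h 0.9539798 b b (- 1 - 2 * b)" using b(2) face_b0_lower by simp
    thus ?thesis unfolding S_def using b(1) by (auto intro: order_trans)
  qed
  \<comment> \<open>Every larger \<gamma> already fails at the facet configuration with bias
    \<open>b0\<close>.\<close>
  have up: "\<gamma> \<le> 0.95398" if "\<gamma> \<in> S" for \<gamma>
  proof (rule ccontr)
    assume "\<not> \<gamma> \<le> 0.95398"
    hence "h \<gamma> b0 b0 (- 1 - 2 * b0) \<le> h 0.95398 b0 b0 (- 1 - 2 * b0)"
      using that b0_bounds by (intro h_face_antimono) (auto simp: S_def)
    also have "\<dots> = face 0.95398 b0" by (rule face_eq_h[OF _ _ b0_bounds]) auto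
    also have "\<dots> < 0" by (rule face_b0_negative)
    finally have "h \<gamma> b0 b0 (- 1 - 2 * b0) < 0" .
    moreover have "feasible b0 b0 (- 1 - 2 * b0)" using b0_bounds by (intro feasible_face) auto
    ultimately show False using that unfolding S_def by fastforce
  qed
  have "0.9539798 \<le> gamma_star"
    unfolding gamma_star_def S_def[symmetric] using up by (intro cSup_upper lo bdd_aboveI)
  moreover have "gamma_star \<le> 0.95398"
    unfolding gamma_star_def S_def[symmetric] using lo up by (intro cSup_least) auto
  ultimately have g: "0.9539798 \<le> gamma_star" "gamma_star \<le> 0.95398" .
  obtain b where b: "b \<in> {b0 - 0.000001 .. b0 + 0.000001}" "feasible b b (- 1 - 2 * b)"
    "\<And>b1 b2 b12. feasible b1 b2 b12 \<Longrightarrow> h gamma_star b b (- 1 - 2 * b) \<le> h gamma_star b1 b2 b12"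
    by (rule h_minimum[OF g]) (rule that; blast)
  have "(10 :: real) powi (- 6) = 0.000001" by (simp add: power_int_def power_divide)
  hence "b \<in> {-0.1824167935 - 10 powi (-6) .. -0.1824167935 + 10 powi (-6)}"
    using b(1) by (simp add: b0_def)
  thus ?thesis using g b(2,3) by auto
qed

end
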